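(* Let $\mathcal{A} \subset \mathbb{N} \setminus \{1\}$ be a set of positive integers such that $\gcd(a,b)=1$ for all distinct $a,b\in\mathcal{A}$ and $\sum_{a\in\mathcal{A}} \frac{1}{a} = \infty$. Let $\lambda_{\mathcal{A}}:\mathbb{N}\to\{-1,1\}$ be either one of the two functions $\lambda_{\mathcal{A}}(n) = (-1)^{\omega_{\mathcal{A}}(n)}$ or $\lambda_{\mathcal{A}}(n) = (-1)^{\Omega_{\mathcal{A}}(n)}$ (the statements below hold for each of the two choices). (a) We have $$\lim_{x\to\infty}\frac{1}{x}\sum_{n\le x}\lambda_{\mathcal{A}}(n) = 0.$$ (b) Let $k\ge 2$ and let $a_1,\dots,a_k,h_1,\dots,h_k\in\mathbb{N}$ be fixed with $a_ih_j - a_jh_i \ne 0$ whenever $i\ne j$. If $\mathcal{A}\cap\mathbb{P}$ has relative density $0$ in $\mathbb{P}$, then $$\lim_{x\to\infty}\frac{1}{x}\sum_{n\le x}\lambda_{\mathcal{A}}(a_1n+h_1)\cdots\lambda_{\mathcal{A}}(a_kn+h_k) = 0.$$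
   Context: $\mathbb{N}$ is the set of positive integers and $\mathbb{P}$ is the set of primes. Sums over $n\le x$ run over positive integers $n \le x$. For a set $\mathcal{K}\subset\mathbb{N}\setminus\{1\}$ of mutually coprime positive integers and $n\in\mathbb{N}$, define $$\omega_{\mathcal{K}}(n) = \sum_{k\mid n,\ k\in\mathcal{K}} 1,\qquad \Omega_{\mathcal{K}}(n) = \sum_{k^\nu \parallel n,\ k\in\mathcal{K}} \nu,$$ where $k^\nu\parallel n$ means that $k^\nu\mid n$ and $k^{\nu+1}\nmid n$. Thus $\omega_{\mathcal{K}}(n)$ is the number of $k\in\mathcal{K}$ dividing $n$, and $\Omega_{\mathcal{K}}(n)$ is the sum over $k\in\mathcal{K}$ of the largest integer $\nu\ge 0$ with $k^\nu\mid n$. The relative density in $\mathbb{P}$ of a subset $\mathcal{P}\subset\mathbb{P}$ is $\lim_{x\to\infty} |\mathcal{P}\cap[1,x]|/|\mathbb{P}\cap[1,x]|$, provided the limit exists; relative density $0$ means that this limit exists and equals $0$. *)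

theory Defs
  imports "HOL-Analysis.Analysis" "HOL-Computational_Algebra.Computational_Algebra"
begin

definition pos_upto :: "real \<Rightarrow> nat set" where
  "pos_upto x = {n. 1 \<le> n \<and> real n \<le> x}"

definition omega_on :: "nat set \<Rightarrow> nat \<Rightarrow> nat" where
  "omega_on K n = card {k \<in> K. k dvd n}"

(* For k > 1 and n > 0, multiplicity k n is the nu with k^nu dividing n exactly, also for
   composite k.  The summation is restricted to the k dividing n, which omits only zero terms,
   because a sum over an infinite index set is 0 by convention. *)
definition Omega_on :: "nat set \<Rightarrow> nat \<Rightarrow> nat" where
  "Omega_on K n = (\<Sum>k | k \<in> K \<and> k dvd n. multiplicity k n)"

definition has_relative_density :: "nat set \<Rightarrow> real \<Rightarrow> bool" where
  "has_relative_density P d \<longleftrightarrow>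
     ((\<lambda>x. real (card (P \<inter> pos_upto x)) / real (card ({p. prime p} \<inter> pos_upto x)))
       \<longlongrightarrow> d) at_top"

end

theory Submission
  imports Defs "HOL-Number_Theory.Prime_Powers" "HOL-Number_Theory.Cong" "HOL-Real_Asymp.Real_Asymp"
begin

text \<open>
  Both choices of the function are \<open>f n = (-1) ^ omega_on K n\<close> with \<open>K = A\<close>,
  respectively with \<open>K\<close> the set of all powers \<open>a ^ j\<close> (\<open>a \<in> A\<close>,
  \<open>j \<ge> 1\<close>). The composite elements of \<open>K\<close> have a convergent sum of reciprocals:
  pairwise coprime composite numbers \<open>a\<close> have distinct prime factors not exceeding their square
  roots, and the powers \<open>a ^ j\<close> with \<open>j \<ge> 2\<close> contribute at most \<open>2 /
  a\<^sup>2\<close> for each \<open>a\<close>. Hence the primes in \<open>K\<close> carry the divergence, and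
  deleting the large composite elements changes \<open>f\<close> on a set of small density only. After this
  deletion \<open>f (p * m) = s p * f m\<close> for every large prime \<open>p\<close> not dividing
  \<open>m\<close>, where \<open>s p = -1\<close> if \<open>p \<in> K\<close> and \<open>s p = 1\<close>
  otherwise.

  For the mean value let \<open>M x\<close> be the mean of \<open>f\<close> over the integers up to
  \<open>x\<close>. The dual form of the Turan-Kubilius inequality (\<open>turan_kubilius_dual\<close>,
  \<open>M_prime_shift\<close>) bounds the sum of \<open>(s p * M (x / p) - M x)\<^sup>2 / p\<close> over any
  finite set of large primes by an absolute constant, once \<open>x\<close> is sufficiently large. So
  \<open>\<bar>M (x / p)\<bar>\<close> is close to \<open>\<bar>M x\<bar>\<close> for most \<open>p\<close>. If
  \<open>\<bar>M\<bar>\<close> had many well separated values at points \<open>x\<^sub>1, x\<^sub>2,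
  \<dots>\<close> close to each other on a logarithmic scale, the quotients \<open>x\<^sub>i / p\<close> for
  different \<open>i\<close> would fall into different short logarithmic windows. The Brun-Titchmarsh bound limits
  the mass of each window and leaves room for a bounded number of points only
  (\<open>few_separated_values\<close>). As \<open>M\<close> varies almost continuously, it follows that a value
  \<open>M x\<close> bounded away from zero keeps its sign at \<open>x / p\<close> for each fixed \<open>p\<close>
  (\<open>slow_variation\<close>). Each prime with \<open>s p = -1\<close> then contributes at least \<open>(M
  x)\<^sup>2 / p\<close> to the bounded sum above, and the divergence of the sum of \<open>1 / p\<close> over
  these primes forces \<open>M x\<close> to zero (\<open>mean_value_zero\<close>). The input on primes consists of
  the bounds of Chebyshev and Mertens and of the Brun-Titchmarsh bound, which is read off from Selberg's formula
  (\<open>selberg_formula\<close>).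

  For the correlations the density hypothesis implies that the sum of \<open>1 / p\<close> over the primes of
  \<open>K\<close> between \<open>N powr \<epsilon>\<close> and a multiple of \<open>N\<close> tends to zero for
  fixed \<open>\<epsilon>\<close> (\<open>zero_density_sum_inv\<close>), so that the primes of \<open>K\<close>
  above \<open>z = N powr \<epsilon>\<close> can be ignored. A large prime divides at most one of the values
  \<open>a\<^sub>i * n + h\<^sub>i\<close>, so what remains is a product of factors \<open>1 - 2 * e p n\<close>
  with \<open>e p n\<close> indicating a union of at most \<open>k\<close> residue classes modulo
  \<open>p\<close>. Brun's sieve replaces the part of the product over the larger primes by a sum of periodic
  functions whose moduli stay below a power of \<open>z\<close> (\<open>brun_correlation_bound\<close>). This part
  is therefore independent of any fixed finite set of primes, up to small errors, and the correlation is bounded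
  by the product of the means of finitely many factors \<open>1 - 2 * e p n\<close>. These means lie between
  \<open>0\<close> and \<open>1 - 2 / p\<close>, and by divergence their product can be made as small as desired
  (\<open>exists_small_product\<close>).
\<close>

section \<open>Chebyshev's bound\<close>

text \<open>
  Both sides sum over the pairs \<open>(d, m)\<close> with \<open>d dvd m\<close> and \<open>1 \<le> m \<le> N\<close>. In this form sums of Dirichlet convolutions
  become sums over quotients, and conversely.
\<close>

lemma sum_div_swap:
  fixes G :: "nat \<Rightarrow> nat \<Rightarrow> real"
  shows "(\<Sum>d\<in>{1..N}. \<Sum>n\<in>{1..N div d}. G d (d * n)) = (\<Sum>m\<in>{1..N}. \<Sum>d | d dvd m. G d m)"
proof -
  have *: "d * n \<le> N \<longleftrightarrow> n \<le> N div d" if "d > 0" for d n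
    using that by (simp add: less_eq_div_iff_mult_less_eq mult.commute)
  have "(\<Sum>d\<in>{1..N}. \<Sum>n\<in>{1..N div d}. G d (d * n))
      = (\<Sum>(d, n)\<in>(SIGMA d:{1..N}. {1..N div d}). G d (d * n))"
    by (rule sum.Sigma) auto
  also have "\<dots> = (\<Sum>(m, d)\<in>(SIGMA m:{1..N}. {d. d dvd m}). G d m)"
  proof (rule sum.reindex_bij_witness[of _ "\<lambda>(m, d). (d, m div d)" "\<lambda>(d, n). (d * n, d)"], goal_cases)
    case (2 a) thus ?case using * by (cases a) auto
  next
    case (4 b)
    obtain m d where b: "b = (m, d)" by (cases b)
    with 4 have d: "1 \<le> m" "m \<le> N" "d dvd m" by auto
    then obtain k where k: "m = d * k" by (auto elim: dvdE)
    have "d > 0" "k > 0" using d k by (auto intro!: Nat.gr0I)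
    moreover have "d \<le> N" using d by (metis dvd_imp_le le_trans less_eq_Suc_le One_nat_def)
    ultimately show ?case using b k d * by auto
  qed (auto)
  also have "\<dots> = (\<Sum>m\<in>{1..N}. \<Sum>d | d dvd m. G d m)"
    by (rule sum.Sigma[symmetric]) auto
  finally show ?thesis .
qed

lemma sum_dvd_flip:
  fixes f :: "nat \<Rightarrow> real" assumes "m > 0"
  shows "(\<Sum>d | d dvd m. f (m div d)) = (\<Sum>d | d dvd m. f d)"
  using assms
  by (intro sum.reindex_bij_witness[of _ "\<lambda>d. m div d" "\<lambda>d. m div d"])
     (auto simp: div_div_eq_right elim!: dvdE)

abbreviation Lam :: "nat \<Rightarrow> real" where "Lam \<equiv> mangoldt"

lemma ln_fact_eq_sum: "ln (fact N :: real) = (\<Sum>n\<in>{1..N}. ln (real n))"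
  by (induction N) (auto simp: ln_mult)

lemma sum_mangoldt_times_div: "(\<Sum>d\<in>{1..N}. Lam d * real (N div d)) = ln (fact N)"
proof -
  have "(\<Sum>d\<in>{1..N}. Lam d * real (N div d)) = (\<Sum>d\<in>{1..N}. \<Sum>n\<in>{1..N div d}. Lam d)"
    by (simp add: mult.commute)
  also have "\<dots> = (\<Sum>m\<in>{1..N}. \<Sum>d | d dvd m. Lam d)" by (rule sum_div_swap)
  also have "\<dots> = ln (fact N)" unfolding ln_fact_eq_sum
    by (intro sum.cong refl, subst mangoldt_sum) auto
  finally show ?thesis .
qed

lemma ln_Suc_split: assumes "n > 0" shows "ln (1 + real n) = ln n + ln (1 + 1 / real n)"
proof -
  have "1 + real n = real n * (1 + 1 / n)" using assms by (simp add: field_simps)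
  thus ?thesis using assms by (metis add_pos_pos divide_pos_pos ln_mult_pos of_nat_0_less_iff zero_less_one)
qed

lemma ln_fact_bounds:
  assumes "N \<ge> 1"
  shows "real N * ln N - N \<le> ln (fact N)" "ln (fact N) \<le> real N * ln N - N + ln N + 1"
proof -
  have "real N * ln N - N \<le> ln (fact N) \<and> ln (fact N) \<le> real N * ln N - N + ln N + 1"
    using assms
  proof (induction N rule: nat_induct_at_least)
    case (Suc n)
    hence n: "real n > 0" by auto
    have l: "ln (1 + real n) = ln n + ln (1 + 1 / n)" using n ln_Suc_split[of n] by simp
    have a: "ln (1 + 1 / n) \<le> 1 / n" using n by (intro ln_add_one_self_le_self) auto
    have "ln (inverse (1 + 1 / n)) \<le> inverse (1 + 1 / n) - 1" using n by (intro ln_le_minus_one) (auto simp: add_pos_pos)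
    hence b: "ln (1 + 1 / n) \<ge> 1 - inverse (1 + 1 / n)" using n by (simp add: ln_inverse add_pos_pos)
    have "n * ln (1 + 1 / n) \<le> n * (1 / n)" using a n by (intro mult_left_mono) auto
    hence a': "n * ln (1 + 1 / n) \<le> 1" using n by simp
    have "(n + 1) * ln (1 + 1 / n) \<ge> (n + 1) * (1 - inverse (1 + 1 / n))" using b n by (intro mult_left_mono) auto
    moreover have "(n + 1) * (1 - inverse (1 + 1 / n)) = 1" using n by (simp add: field_simps)
    ultimately have b': "(n + 1) * ln (1 + 1 / n) \<ge> 1" by linarith
    have f: "ln (fact (Suc n) :: real) = ln (1 + real n) + ln (fact n)"
      by (simp add: ln_mult)
    show ?case using Suc.IH a' b' unfolding f l of_nat_Suc by (simp add: algebra_simps l)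
  qed auto
  thus "real N * ln N - N \<le> ln (fact N)" "ln (fact N) \<le> real N * ln N - N + ln N + 1" by auto
qed

definition psi :: "real \<Rightarrow> real" where "psi x = (\<Sum>n\<in>{1..nat \<lfloor>x\<rfloor>}. Lam n)"

lemma psi_nonneg: "psi x \<ge> 0" unfolding psi_def by (intro sum_nonneg mangoldt_nonneg)

lemma psi_mono: "x \<le> y \<Longrightarrow> psi x \<le> psi y" unfolding psi_def
  by (intro sum_mono2) (auto simp: mangoldt_nonneg intro: le_trans[OF _ nat_mono] floor_mono)

text \<open>
  Let \<open>M = N div 2\<close>. The integer \<open>N div d - 2 * (M div d)\<close> is never negative and equals \<open>1\<close> for \<open>M < d \<le> N\<close>, so
  \<open>psi N - psi M\<close> is at most the logarithm of \<open>fact N / (fact M)\<^sup>2\<close>, which is a binomial coefficient up to a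
  factor \<open>N\<close>. Repeated halving of \<open>N\<close> then produces a geometric series.
\<close>

lemma psi_nat_le: "psi (real N) \<le> 4 * real N"
proof (induction N rule: less_induct)
  case (less N)
  show ?case
  proof (cases "N = 0")
    case True thus ?thesis by (simp add: psi_def)
  next
    case False
    define M where "M = N div 2"
    have MN: "M < N" "2 * M \<le> N" "N \<le> 2 * M + 1" using False by (auto simp: M_def)
    have "psi N - psi M = (\<Sum>n\<in>{1..N} - {1..M}. Lam n)"
      unfolding psi_def using MN by (subst sum_diff) auto
    also have "\<dots> \<le> (\<Sum>d\<in>{1..N}. Lam d * (real (N div d) - 2 * real (M div d)))"
    proof -
      have "(\<Sum>n\<in>{1..N} - {1..M}. Lam n) = (\<Sum>d\<in>{1..N}. Lam d * (if d > M then 1 else 0))"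
        by (intro sum.mono_neutral_cong_left) auto
      also have "\<dots> \<le> (\<Sum>d\<in>{1..N}. Lam d * (real (N div d) - 2 * real (M div d)))"
      proof (intro sum_mono mult_left_mono mangoldt_nonneg)
        fix d assume d: "d \<in> {1..N}"
        show "(if M < d then 1 else 0) \<le> real (N div d) - 2 * real (M div d)"
        proof (cases "M < d")
          case True
          thus ?thesis using d div_greater_zero_iff[of N d] by simp
        next
          case F: False
          have "2 * (M div d) * d \<le> N" using MN by (metis (no_types, lifting) div_times_less_eq_dividend le_trans mult.assoc mult_le_mono2)
          hence "2 * (M div d) \<le> N div d" using d by (simp add: less_eq_div_iff_mult_less_eq)
          thus ?thesis using F by simp
        qed
      qed
      finally show ?thesis .
    qed
    also have "\<dots> = ln (fact N) - 2 * ln (fact M)"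
    proof -
      have "(\<Sum>d\<in>{1..N}. Lam d * real (M div d)) = (\<Sum>d\<in>{1..M}. Lam d * real (M div d))"
        using MN by (intro sum.mono_neutral_right) auto
      moreover have "(\<Sum>d\<in>{1..N}. Lam d * (real (N div d) - 2 * real (M div d))) =
          (\<Sum>d\<in>{1..N}. Lam d * real (N div d)) - 2 * (\<Sum>d\<in>{1..N}. Lam d * real (M div d))"
        unfolding sum_distrib_left sum_subtractf[symmetric] by (intro sum.cong refl) (simp add: algebra_simps)
      ultimately show ?thesis using sum_mangoldt_times_div[of N] sum_mangoldt_times_div[of M] by simp
    qed
    also have "\<dots> \<le> 2 * real N"
    proof -
      have "fact N = fact M * fact (N - M) * (N choose M)"
        using binomial_fact_lemma[of M N] MN by simp
      also have "\<dots> \<le> fact M * (real (Suc M) * fact M) * 2 ^ N"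
      proof -
        have "N - M = M \<or> N - M = Suc M" using MN by linarith
        hence "(fact (N - M) :: real) \<le> real (Suc M) * fact M" by auto
        moreover have "real (N choose M) \<le> 2 ^ N" using binomial_le_pow2[of N M] by (metis of_nat_le_iff of_nat_numeral of_nat_power)
        ultimately show ?thesis unfolding of_nat_mult of_nat_fact by (intro mult_mono) auto
      qed
      finally have "fact N \<le> fact M * (real (Suc M) * fact M) * 2 ^ N" by simp
      hence "ln (fact N) \<le> ln (fact M * (real (Suc M) * fact M) * 2 ^ N)"
        by (subst ln_le_cancel_iff) (auto intro!: mult_pos_pos)
      also have "\<dots> = 2 * ln (fact M) + ln (1 + real M) + N * ln 2"
        by (simp add: ln_mult ln_realpow del: fact_Suc)
      also have "ln (1 + real M) \<le> M" by (intro ln_add_one_self_le_self) auto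
      also have "N * ln 2 \<le> real N * 1" using ln_2_less_1 by (intro mult_left_mono) auto
      finally show ?thesis using MN by simp
    qed
    finally have "psi N \<le> 2 * real N + psi M" by simp
    also have "psi M \<le> 4 * real M" using less[of M] MN by simp
    also have "2 * real N + 4 * real M \<le> 4 * real N" using MN by linarith
    finally show ?thesis by simp
  qed
qed

lemma psi_floor: "x \<ge> 0 \<Longrightarrow> psi x = psi (real (nat \<lfloor>x\<rfloor>))" by (simp add: psi_def)

lemma psi_le: assumes "x \<ge> 0" shows "psi x \<le> 4 * x"
proof -
  have "psi x \<le> 4 * real (nat \<lfloor>x\<rfloor>)" using psi_floor[OF assms] psi_nat_le by simp
  also have "\<dots> \<le> 4 * x" using assms by (simp add: of_nat_nat)
  finally show ?thesis .
qed

section \<open>Sums of reciprocals of primes\<close>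

definition mertens_sum :: "real \<Rightarrow> real" where "mertens_sum x = (\<Sum>n\<in>{1..nat \<lfloor>x\<rfloor>}. Lam n / n)"

lemma real_quotient_minus_div_le_1: "real N / real d - real (N div d) \<le> 1"
  using real_of_int_div3[of "int N" "int d"] by (simp flip: zdiv_int)

text \<open>
  In \<open>sum_mangoldt_times_div\<close>, replacing \<open>N div d\<close> by \<open>N / d\<close> changes the sum by at most \<open>psi N\<close>, which is \<open>O(N)\<close>
  by Chebyshev's bound; dividing by \<open>N\<close> gives Mertens' estimate.
\<close>

lemma mertens_sum_bounds: assumes "x \<ge> 1" shows "\<bar>mertens_sum x - ln x\<bar> \<le> 5"
proof -
  define N where "N = nat \<lfloor>x\<rfloor>"
  have N: "N \<ge> 1" "real N \<le> x" "x \<le> real N + 1" using assms unfolding N_def by linarith+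
  have S: "mertens_sum x = (\<Sum>n\<in>{1..N}. Lam n / n)" by (simp add: mertens_sum_def N_def)
  have "ln (fact N) \<le> (\<Sum>d\<in>{1..N}. Lam d * (N / d))"
    unfolding sum_mangoldt_times_div[symmetric]
    by (intro sum_mono mult_left_mono mangoldt_nonneg of_nat_div_le_of_nat)
  also have "\<dots> = N * mertens_sum x" unfolding S sum_distrib_left by (intro sum.cong refl) simp
  finally have "real N * ln N - N \<le> N * mertens_sum x" using ln_fact_bounds(1)[OF N(1)] by simp
  hence "real N * (ln N - 1) \<le> N * mertens_sum x" by (simp add: algebra_simps)
  hence lo: "ln N - 1 \<le> mertens_sum x" using N by simp
  have "N * mertens_sum x - ln (fact N) = (\<Sum>d\<in>{1..N}. Lam d * (N / d - N div d))"
    unfolding sum_mangoldt_times_div[symmetric] S sum_distrib_left sum_subtractf[symmetric]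
    by (intro sum.cong refl) (simp add: algebra_simps)
  also have "\<dots> \<le> (\<Sum>d\<in>{1..N}. Lam d * 1)"
    by (intro sum_mono mult_left_mono mangoldt_nonneg) (simp add: real_quotient_minus_div_le_1)
  also have "\<dots> = psi N" by (simp add: psi_def)
  also have "\<dots> \<le> 4 * real N" by (rule psi_nat_le)
  finally have "N * mertens_sum x \<le> ln (fact N) + 4 * N" by simp
  also have "ln (fact N) \<le> N * ln N"
  proof -
    have "ln (fact N :: real) \<le> (\<Sum>n\<in>{1..N}. ln N)" unfolding ln_fact_eq_sum
      by (intro sum_mono) auto
    thus ?thesis by simp
  qed
  finally have "N * mertens_sum x \<le> real N * (ln N + 4)" by (simp add: algebra_simps)
  hence hi: "mertens_sum x \<le> ln N + 4" using N by simp
  have "ln x \<ge> ln N" using N by simp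
  have "ln x \<le> ln (1 + real N)" using N assms by simp
  also have "\<dots> = ln N + ln (1 + 1 / real N)" using N by (intro ln_Suc_split) auto
  also have "ln (1 + 1/real N) \<le> 1 / N" by (intro ln_add_one_self_le_self) auto
  also have "1 / real N \<le> 1" using N by simp
  finally show ?thesis using lo hi \<open>ln x \<ge> ln N\<close> by linarith
qed

definition primes_in :: "real \<Rightarrow> real \<Rightarrow> nat set" where
  "primes_in w z = {p. prime p \<and> w < real p \<and> real p \<le> z}"

abbreviation recip_sum :: "nat set \<Rightarrow> real" where "recip_sum X \<equiv> (\<Sum>n\<in>X. 1 / real n)"

lemma finite_primes_in [simp]: "finite (primes_in w z)"
  by (rule finite_subset[of _ "{..nat \<lfloor>z\<rfloor>}"]) (auto simp: primes_in_def le_nat_floor)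

lemma sum_upto_diff:
  fixes f :: "nat \<Rightarrow> real"
  assumes "1 \<le> w" "w \<le> z"
  shows "(\<Sum>n\<in>{1..nat \<lfloor>z\<rfloor>}. f n) - (\<Sum>n\<in>{1..nat \<lfloor>w\<rfloor>}. f n) = (\<Sum>n | w < real n \<and> real n \<le> z. f n)"
proof -
  have "{1..nat \<lfloor>z\<rfloor>} - {1..nat \<lfloor>w\<rfloor>} = {n. w < real n \<and> real n \<le> z}"
    using assms by (auto simp: le_nat_floor le_nat_iff le_floor_iff floor_less_iff not_le nat_less_iff)
  moreover have "nat \<lfloor>w\<rfloor> \<le> nat \<lfloor>z\<rfloor>" using assms by (intro nat_mono floor_mono)
  ultimately show ?thesis by (subst sum_diff[symmetric]) auto
qed

lemma mertens_sum_diff: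
  "1 \<le> w \<Longrightarrow> w \<le> z \<Longrightarrow> mertens_sum z - mertens_sum w = (\<Sum>n | w < real n \<and> real n \<le> z. Lam n / n)"
  unfolding mertens_sum_def by (rule sum_upto_diff)

lemma finite_real_interval: "finite {n::nat. w < real n \<and> real n \<le> z}"
  by (rule finite_subset[of _ "{..nat \<lfloor>z\<rfloor>}"]) (auto simp: le_nat_floor)

lemma sum_ln_prime_le:
  assumes "1 \<le> w" "w \<le> z" shows "(\<Sum>p\<in>primes_in w z. ln p / p) \<le> ln z - ln w + 10"
proof -
  have "(\<Sum>p\<in>primes_in w z. ln p / p) = (\<Sum>p\<in>primes_in w z. Lam p / p)"
    by (intro sum.cong) (auto simp: primes_in_def)
  also have "\<dots> \<le> mertens_sum z - mertens_sum w" unfolding mertens_sum_diff[OF assms]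
    by (intro sum_mono2 finite_real_interval) (auto simp: primes_in_def mangoldt_nonneg)
  finally show ?thesis using mertens_sum_bounds[of w] mertens_sum_bounds[of z] assms by linarith
qed

text \<open>
  Since \<open>ln p \<ge> ln t\<close> on the range of summation, Mertens' estimate bounds the sum by \<open>(ln t + 10) / ln t\<close>.
\<close>

lemma sum_inv_prime_square_le:
  assumes "2 \<le> t" shows "recip_sum (primes_in t (t^2)) \<le> 21"
proof -
  have lt: "ln t > 0" using assms by simp
  have "ln t * recip_sum (primes_in t (t^2)) \<le> (\<Sum>p\<in>primes_in t (t^2). ln p / p)"
    unfolding sum_distrib_left using assms by (intro sum_mono) (auto simp: primes_in_def divide_right_mono)
  also have "\<dots> \<le> ln (t^2) - ln t + 10" using assms by (intro sum_ln_prime_le) (auto simp: power2_eq_square)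
  also have "\<dots> = ln t + 10" using assms by (simp add: ln_realpow)
  also have "\<dots> \<le> ln t * 21"
  proof -
    have "ln t \<ge> ln 2" using assms by simp
    moreover have "ln 2 \<ge> (1/2::real)" using ln2_ge_two_thirds by simp
    ultimately show ?thesis by linarith
  qed
  finally show ?thesis using lt by simp
qed

lemma sum_inv_prime_iterate:
  assumes "2 \<le> t" shows "recip_sum (primes_in t (t^(2^m))) \<le> 21 * real m"
proof (induction m)
  case 0
  have "primes_in t t = {}" by (auto simp: primes_in_def)
  thus ?case by simp
next
  case (Suc m)
  let ?u = "t^(2^m)"
  have "t ^ 1 \<le> ?u" using assms by (intro power_increasing) auto
  hence u: "2 \<le> ?u" using assms by simp
  have e: "t^(2^Suc m) = ?u^2" by (simp add: power_mult[symmetric] mult.commute)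
  have "recip_sum (primes_in t (t^(2^Suc m))) \<le> recip_sum (primes_in t ?u \<union> primes_in ?u (?u^2))"
    unfolding e by (intro sum_mono2, simp_all) (auto simp: primes_in_def)
  also have "\<dots> \<le> recip_sum (primes_in t ?u) + recip_sum (primes_in ?u (?u^2))"
    by (subst sum_Un) (auto intro!: sum_nonneg)
  also have "\<dots> \<le> 21 * real m + 21" using Suc.IH sum_inv_prime_square_le[OF u] by linarith
  finally show ?case by (simp add: algebra_simps)
qed

lemma sum_inv_prime_le_aux:
  assumes "2 \<le> w" "w \<le> z" shows "recip_sum (primes_in w z) \<le> 42 * (1 + ln (ln z / ln w))"
proof -
  define r where "r = ln z / ln w"
  have r: "r \<ge> 1" using assms by (simp add: r_def)
  define m where "m = nat \<lceil>log 2 r\<rceil>"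
  have l0: "log 2 r \<ge> 0" using r by simp
  have m: "log 2 r \<le> real m" "real m \<le> log 2 r + 1" using l0 unfolding m_def by linarith+
  have "r = 2 powr (log 2 r)" using r by simp
  also have "\<dots> \<le> 2 powr m" using m by (intro powr_mono) auto
  finally have "r \<le> 2 ^ m" by (simp add: powr_realpow)
  hence "ln z \<le> 2 ^ m * ln w" using assms by (simp add: r_def divide_simps mult.commute)
  also have "\<dots> = ln (w ^ (2 ^ m))" using assms by (simp add: ln_realpow)
  finally have "z \<le> w ^ (2 ^ m)" using assms by (subst (asm) ln_le_cancel_iff) auto
  hence "recip_sum (primes_in w z) \<le> recip_sum (primes_in w (w ^ (2 ^ m)))"
    by (intro sum_mono2, simp_all) (auto simp: primes_in_def)
  also have "\<dots> \<le> 21 * real m" using assms by (intro sum_inv_prime_iterate)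
  also have "real m \<le> ln r / ln 2 + 1" using m by (simp add: log_def)
  also have "ln r / ln 2 \<le> ln r / (1/2)" using r ln2_ge_two_thirds by (intro divide_left_mono) auto
  finally have "recip_sum (primes_in w z) \<le> 21 * (2 * ln r + 1)" by simp
  also have "\<dots> \<le> 42 * (1 + ln r)" using r by simp
  finally show ?thesis by (simp add: r_def)
qed

text \<open>
  The range is covered by about \<open>log 2 (ln z / ln w)\<close> ranges of the form \<open>(t, t\<^sup>2]\<close>, each of bounded mass. Values
  \<open>w\<close> between \<open>1\<close> and \<open>2\<close> are admitted because the sieve uses thresholds \<open>z powr \<theta> ^ j\<close>, which tend to \<open>1\<close>.
\<close>

lemma sum_inv_prime_le:
  assumes "1 < w" "w \<le> z" shows "recip_sum (primes_in w z) \<le> 43 * (1 + ln (ln z / ln w))"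
proof (cases "w \<ge> 2")
  case True
  have "ln z / ln w \<ge> 1" using assms by simp
  hence "ln (ln z / ln w) \<ge> 0" by (rule ln_ge_zero)
  moreover have "42 * (1 + ln (ln z / ln w)) \<le> 43 * (1 + ln (ln z / ln w))" using calculation by (intro mult_right_mono) auto
  ultimately show ?thesis using sum_inv_prime_le_aux[OF True assms(2)] by linarith
next
  case w: False
  have a: "ln z / ln w \<ge> 1" using assms by simp
  hence a': "ln (ln z / ln w) \<ge> 0" by (rule ln_ge_zero)
  show ?thesis
  proof (cases "z < 2")
    case True
    have "primes_in w z = {}"
    proof (rule ccontr)
      assume "primes_in w z \<noteq> {}"
      then obtain p where "prime p" "real p \<le> z" by (auto simp: primes_in_def)
      thus False using prime_ge_2_nat[of p] True by linarith
    qed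
    thus ?thesis using a' by (simp del: ln_ge_zero_iff)
  next
    case False
    have "ln z / ln 2 \<le> ln z / ln w" using w assms by (intro divide_left_mono) auto
    hence b: "ln (ln z / ln 2) \<le> ln (ln z / ln w)" using False a by (intro ln_mono) auto
    have "recip_sum (primes_in w z) \<le> recip_sum (insert 2 (primes_in 2 z))"
    proof (intro sum_mono2)
      show "primes_in w z \<subseteq> insert 2 (primes_in 2 z)"
      proof
        fix p assume p: "p \<in> primes_in w z"
        hence "p \<ge> 2" using prime_ge_2_nat by (auto simp: primes_in_def)
        thus "p \<in> insert 2 (primes_in 2 z)" using p by (auto simp: primes_in_def)
      qed
    qed auto
    also have "\<dots> = 1/2 + recip_sum (primes_in 2 z)" by (subst sum.insert) (simp, simp add: primes_in_def, simp)
    also have "\<dots> \<le> 1 + 42 * (1 + ln (ln z / ln 2))" using sum_inv_prime_le_aux[of 2 z] False by simp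
    also have "\<dots> \<le> 43 * (1 + ln (ln z / ln w))"
    proof -
      have "1 + 42 * (1 + u) \<le> 43 * (1 + v)" if "0 \<le> v" "u \<le> v" for u v :: real using that by simp
      thus ?thesis using a' b by blast
    qed
    finally show ?thesis .
  qed
qed

lemma sum_power_from_2_le:
  fixes q :: real assumes "0 \<le> q" "q \<le> 1/2" shows "(\<Sum>k\<in>{2..N}. q ^ k) \<le> 2 * q ^ 2"
proof -
  have "(\<Sum>k\<in>{2..Suc n}. q ^ k) \<le> 2 * q ^ 2 - 2 * q ^ (n + 2)" for n
  proof (induction n)
    case (Suc n)
    have "2 * q * q ^ (n + 2) \<le> 1 * q ^ (n + 2)" using assms by (intro mult_right_mono) auto
    thus ?case using Suc by simp
  qed (auto simp: power2_eq_square)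
  from this[of N] have "(\<Sum>k\<in>{2..Suc N}. q ^ k) \<le> 2 * q ^ 2" using assms by (smt (verit) zero_le_power)
  moreover have "(\<Sum>k\<in>{2..N}. q ^ k) \<le> (\<Sum>k\<in>{2..Suc N}. q ^ k)" using assms by (intro sum_mono2) auto
  ultimately show ?thesis by linarith
qed

lemma ln_le_2_sqrt: assumes "x > 0" shows "ln x \<le> 2 * sqrt x"
proof -
  have "ln x = 2 * ln (sqrt x)" using assms by (simp add: ln_sqrt)
  also have "ln (sqrt x) \<le> sqrt x" using assms ln_le_minus_one[of "sqrt x"] by simp
  finally show ?thesis by simp
qed

text \<open>
  The powers \<open>p ^ k\<close> with \<open>k \<ge> 2\<close> contribute at most \<open>2 * ln p / p\<^sup>2\<close> for each \<open>p\<close>, which is summable. This allows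
  passing from Mertens' estimate to lower bounds for sums over primes alone.
\<close>

lemma sum_mangoldt_nonprime_bounded:
  obtains C where "C \<ge> 0" "\<And>N. (\<Sum>n | n \<in> {1..N} \<and> \<not> prime n. Lam n / n) \<le> C"
proof -
  define C where "C = (\<Sum>n. 4 * real n powr (-3/2))"
  have sm: "summable (\<lambda>n. 4 * real n powr (-3/2))" by (intro summable_mult) (simp add: summable_real_powr_iff)
  show ?thesis
  proof (rule that)
    show "C \<ge> 0" unfolding C_def by (intro suminf_nonneg sm) auto
    fix N :: nat
    define X where "X = {n\<in>{1..N}. \<not> prime n \<and> primepow n}"
    define Y where "Y = {p. prime p \<and> p \<le> N} \<times> {2..N}"
    have fY: "finite {p::nat. prime p \<and> p \<le> N}" by (rule finite_subset[of _ "{..N}"]) auto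
    have sub: "X \<subseteq> (\<lambda>(p, k). p ^ k) ` Y"
    proof
      fix n assume n: "n \<in> X"
      then obtain p k where pk: "prime p" "k > 0" "n = p ^ k" by (auto simp: X_def primepow_def)
      have "k \<noteq> 1" using n pk by (auto simp: X_def)
      moreover have "p \<le> p ^ k" using pk by (simp add: self_le_power prime_gt_0_nat Suc_le_eq)
      moreover have "k \<le> p ^ k" using prime_gt_1_nat[OF pk(1)] power_gt_expt[of p k] by simp
      ultimately show "n \<in> (\<lambda>(p, k). p ^ k) ` Y" using pk n
        by (intro image_eqI[of _ _ "(p, k)"]) (auto simp: Y_def X_def)
    qed
    have inj: "inj_on (\<lambda>(p, k). p ^ k) Y"
    proof (intro inj_onI, clarify)
      fix p k q l assume a: "(p, k) \<in> Y" "(q, l) \<in> Y" and b: "p ^ k = q ^ l"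
      from a have "prime p" "prime q" "k > 0" "l > 0" by (auto simp: Y_def)
      with b show "p = q \<and> k = l" using prime_power_inj''[of p q k l] by auto
    qed
    have "(\<Sum>n | n \<in> {1..N} \<and> \<not> prime n. Lam n / n) = (\<Sum>n\<in>X. Lam n / n)"
      by (intro sum.mono_neutral_right) (auto simp: X_def mangoldt_def)
    also have "\<dots> \<le> (\<Sum>n\<in>(\<lambda>(p, k). p ^ k) ` Y. Lam n / n)"
      using fY by (intro sum_mono2 sub) (auto simp: Y_def mangoldt_nonneg)
    also have "\<dots> = (\<Sum>(p, k)\<in>Y. Lam (p ^ k) / (p ^ k))"
      by (subst sum.reindex[OF inj]) (simp add: case_prod_unfold)
    also have "\<dots> = (\<Sum>p | prime p \<and> p \<le> N. \<Sum>k\<in>{2..N}. ln p * (1 / p) ^ k)"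
      unfolding Y_def using fY by (subst sum.cartesian_product[symmetric], intro sum.cong refl) (auto simp: power_divide)
    also have "\<dots> \<le> (\<Sum>p | prime p \<and> p \<le> N. 4 * real p powr (-3/2))"
    proof (intro sum_mono)
      fix p assume "p \<in> {p. prime p \<and> p \<le> N}"
      hence p: "real p \<ge> 2" using prime_ge_2_nat[of p] by simp
      have "(\<Sum>k\<in>{2..N}. ln p * (1 / p) ^ k) = ln p * (\<Sum>k\<in>{2..N}. (1 / p) ^ k)" by (simp add: sum_distrib_left)
      also have "\<dots> \<le> (2 * sqrt p) * (2 * (1 / p) ^ 2)" using p
        by (intro mult_mono sum_power_from_2_le ln_le_2_sqrt sum_nonneg) auto
      also have "\<dots> = 4 * real p powr (-3/2)"
      proof -
        have "sqrt p * (1 / p)^2 = p powr (1/2) * p powr (-2)" using p by (simp add: powr_half_sqrt powr_minus powr_numeral power_divide field_simps)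
        also have "\<dots> = p powr (-3/2)" by (simp add: powr_add[symmetric])
        finally show ?thesis by simp
      qed
      finally show "(\<Sum>k\<in>{2..N}. ln p * (1 / p) ^ k) \<le> 4 * real p powr (-3/2)" .
    qed
    also have "\<dots> \<le> C" unfolding C_def using fY by (intro sum_le_suminf sm) auto
    finally show "(\<Sum>n | n \<in> {1..N} \<and> \<not> prime n. Lam n / n) \<le> C" .
  qed
qed

text \<open>
  Mertens' sum grows by \<open>ln t + O(1)\<close> over the range, the proper prime powers account for \<open>O(1)\<close> of this growth,
  and \<open>ln p \<le> 2 * ln t\<close> on the range. Any bound below \<open>1 / 2\<close> would be obtained in this way.
\<close>

lemma sum_inv_prime_square_ge:
  obtains t0 where "t0 \<ge> 2" "\<And>t. t \<ge> t0 \<Longrightarrow> recip_sum (primes_in t (t^2)) \<ge> 1/4"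
proof -
  obtain C where C: "C \<ge> 0" "\<And>N. (\<Sum>n | n \<in> {1..N} \<and> \<not> prime n. Lam n / n) \<le> C"
    using sum_mangoldt_nonprime_bounded by blast
  show ?thesis
  proof (rule that[of "max 2 (exp (20 + 2 * C))"])
    fix t assume t: "t \<ge> max 2 (exp (20 + 2 * C))"
    hence t2: "t \<ge> 2" by simp
    have "ln t \<ge> ln (exp (20 + 2 * C))" using t by (subst ln_le_cancel_iff) auto
    hence l: "ln t \<ge> 20 + 2 * C" by simp
    have tt: "t \<le> t^2" using t2 by (simp add: power2_eq_square)
    let ?A = "{n. t < real n \<and> real n \<le> t^2}"
    have "ln t - 10 \<le> mertens_sum (t^2) - mertens_sum t"
      using mertens_sum_bounds[of t] mertens_sum_bounds[of "t^2"] t2 tt by (simp add: ln_realpow)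
    also have "\<dots> = (\<Sum>n\<in>?A. Lam n / n)" using t2 tt by (intro mertens_sum_diff) auto
    also have "?A = primes_in t (t^2) \<union> {n\<in>?A. \<not> prime n}" by (auto simp: primes_in_def)
    finally have D: "ln t - 10 \<le> (\<Sum>n\<in>primes_in t (t^2) \<union> {n\<in>?A. \<not> prime n}. Lam n / n)" .
    have "finite {n\<in>?A. \<not> prime n}" by (rule finite_subset[OF _ finite_real_interval]) auto
    hence U: "(\<Sum>n\<in>primes_in t (t^2) \<union> {n\<in>?A. \<not> prime n}. Lam n / n) = (\<Sum>n\<in>primes_in t (t^2). Lam n / n) + (\<Sum>n\<in>{n\<in>?A. \<not> prime n}. Lam n / n)"
      by (intro sum.union_disjoint finite_primes_in) (auto simp: primes_in_def)
    note D
    also note U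
    also have "(\<Sum>n\<in>{n\<in>?A. \<not> prime n}. Lam n / n) \<le> (\<Sum>n | n \<in> {1..nat \<lfloor>t^2\<rfloor>} \<and> \<not> prime n. Lam n / n)"
      using t2 by (intro sum_mono2) (auto simp: mangoldt_nonneg le_nat_floor Suc_le_eq intro!: Nat.gr0I)
    also have "\<dots> \<le> C" by (rule C(2))
    finally have "ln t - 10 - C \<le> (\<Sum>n\<in>primes_in t (t^2). Lam n / n)" by simp
    also have "\<dots> \<le> (\<Sum>n\<in>primes_in t (t^2). (2 * ln t) * (1 / n))"
    proof (intro sum_mono)
      fix n assume n: "n \<in> primes_in t (t^2)"
      hence n': "prime n" "real n \<le> t^2" "real n > 0" using prime_gt_0_nat by (auto simp: primes_in_def)
      have "ln n \<le> ln (t^2)" using n' by (intro ln_mono) auto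
      thus "Lam n / n \<le> (2 * ln t) * (1 / n)" using n' t2 by (simp add: ln_realpow divide_right_mono)
    qed
    also have "\<dots> = 2 * ln t * (\<Sum>n\<in>primes_in t (t^2). 1 / n)" by (simp add: sum_distrib_left)
    finally have "ln t - 10 - C \<le> 2 * ln t * (\<Sum>n\<in>primes_in t (t^2). 1 / n)" .
    moreover have "2 * ln t * (1/4) \<le> ln t - 10 - C" using l by simp
    ultimately have "2 * ln t * (1/4) \<le> 2 * ln t * (\<Sum>n\<in>primes_in t (t^2). 1 / n)" by linarith
    thus "recip_sum (primes_in t (t^2)) \<ge> 1/4" using t2 by simp
  qed auto
qed

section \<open>Selberg's formula and primes in short intervals\<close>

definition moebius :: "nat \<Rightarrow> real" where
  "moebius n = (if squarefree n then (-1) ^ card (prime_factors n) else 0)"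

lemma abs_moebius_le: "\<bar>moebius n\<bar> \<le> 1" by (simp add: moebius_def)

lemma moebius_1 [simp]: "moebius (Suc 0) = 1" by (simp add: moebius_def)

lemma moebius_prime_mult:
  assumes "prime p" "\<not> p dvd e" shows "moebius (p * e) = - moebius e"
proof -
  have "coprime p e" using assms by (simp add: prime_imp_coprime)
  hence "squarefree (p * e) \<longleftrightarrow> squarefree e" using assms(1)
    using squarefree_mult_coprime[of p e] squarefree_prime[OF assms(1)] squarefree_multD(2)[of p e] by blast
  moreover have "prime_factors (p * e) = insert p (prime_factors e)" "p \<notin> prime_factors e"
    using assms prime_factors_product[of p e] by (cases "e = 0", auto simp: prime_prime_factors prime_gt_0_nat)
  ultimately show ?thesis by (simp add: moebius_def)
qed

text \<open>
  For a prime \<open>p\<close> dividing \<open>n\<close>, multiplication by \<open>p\<close> maps the divisors prime to \<open>p\<close> onto the divisors exactly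
  divisible by \<open>p\<close> and reverses the sign of \<open>moebius\<close>; on the divisors divisible by \<open>p\<^sup>2\<close> it vanishes.
\<close>

lemma sum_moebius_dvd:
  assumes "n > 0" shows "(\<Sum>d | d dvd n. moebius d) = (if n = 1 then 1 else 0)"
proof (cases "n = 1")
  case False
  then obtain p where p: "prime p" "p dvd n" using prime_factor_nat by blast
  let ?A = "{d. d dvd n \<and> \<not> p dvd d}" and ?B = "{d. d dvd n \<and> p dvd d \<and> \<not> p * p dvd d}"
  have fin: "finite {d. d dvd n}" using assms by simp
  have "(\<Sum>d | d dvd n. moebius d) = (\<Sum>d\<in>?A \<union> ?B. moebius d)"
  proof (intro sum.mono_neutral_right fin ballI)
    fix d assume "d \<in> {d. d dvd n} - (?A \<union> ?B)"
    hence "p ^ 2 dvd d" by (auto simp: power2_eq_square)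
    hence "\<not> squarefree d" using p(1) not_prime_unit by (auto simp: squarefree_def)
    thus "moebius d = 0" by (simp add: moebius_def)
  qed auto
  also have "\<dots> = (\<Sum>d\<in>?A. moebius d) + (\<Sum>d\<in>?B. moebius d)"
    using fin by (intro sum.union_disjoint) auto
  also have "(\<Sum>d\<in>?B. moebius d) = (\<Sum>e\<in>?A. - moebius e)"
  proof (rule sum.reindex_bij_witness[of _ "\<lambda>e. p * e" "\<lambda>d. d div p"], goal_cases)
    case (2 d)
    then obtain e where e: "d = p * e" by (auto elim: dvdE)
    thus ?case using 2 p by (auto intro: dvd_mult_right)
  next
    case (4 e)
    have "coprime p e" using 4 p by (auto simp: prime_imp_coprime)
    thus ?case using 4 p by (auto intro: divides_mult simp: prime_gt_0_nat)
  next
    case (5 d)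
    then obtain e where e: "d = p * e" by (auto elim: dvdE)
    thus ?case using 5 p by (auto simp: moebius_prime_mult prime_gt_0_nat)
  qed (use p in \<open>auto simp: prime_gt_0_nat\<close>)
  finally show ?thesis using False by (simp add: sum_negf)
qed (use assms in auto)

text \<open>
  Moebius inversion of \<open>ln m = (\<Sum>d | d dvd m. mangoldt d)\<close>.
\<close>

lemma sum_moebius_ln_dvd:
  assumes "m > 0" shows "(\<Sum>d | d dvd m. moebius d * ln d) = - Lam m"
proof -
  have fin: "finite {d. d dvd k}" if "k > 0" for k :: nat using that by simp
  have dp: "d > 0" "m div d > 0" if "d dvd m" for d using that assms by (auto elim!: dvdE)
  have "(\<Sum>d | d dvd m. moebius d * ln (m div d)) = (\<Sum>d | d dvd m. \<Sum>e | e dvd m div d. moebius d * Lam e)"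
    by (intro sum.cong refl) (use dp in \<open>simp add: mangoldt_sum flip: sum_distrib_left\<close>)
  also have "\<dots> = (\<Sum>(d, e)\<in>(SIGMA d:{d. d dvd m}. {e. e dvd m div d}). moebius d * Lam e)"
    using dp assms by (intro sum.Sigma) auto
  also have "\<dots> = (\<Sum>(e, d)\<in>(SIGMA e:{e. e dvd m}. {d. d dvd m div e}). moebius d * Lam e)"
    using assms by (intro sum.reindex_bij_witness[of _ "\<lambda>(e, d). (d, e)" "\<lambda>(d, e). (e, d)"]) (auto elim!: dvdE)
  also have "\<dots> = (\<Sum>e | e dvd m. \<Sum>d | d dvd m div e. moebius d * Lam e)"
    using dp assms by (intro sum.Sigma[symmetric]) auto
  also have "\<dots> = (\<Sum>e | e dvd m. if e = m then Lam e else 0)"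
  proof (intro sum.cong refl)
    fix e assume "e \<in> {e. e dvd m}"
    hence e: "e dvd m" by simp
    have "(\<Sum>d | d dvd m div e. moebius d * Lam e) = (\<Sum>d | d dvd m div e. moebius d) * Lam e" by (simp add: sum_distrib_right)
    also have "(\<Sum>d | d dvd m div e. moebius d) = (if m div e = 1 then 1 else 0)" using dp[OF e] by (intro sum_moebius_dvd)
    also have "m div e = 1 \<longleftrightarrow> e = m" using e assms by (auto elim!: dvdE)
    finally show "(\<Sum>d | d dvd m div e. moebius d * Lam e) = (if e = m then Lam e else 0)" by simp
  qed
  also have "\<dots> = Lam m" using fin[OF assms] by simp
  finally have 1: "(\<Sum>d | d dvd m. moebius d * ln (m div d)) = Lam m" .
  have "(\<Sum>d | d dvd m. moebius d * ln (m div d)) = (\<Sum>d | d dvd m. moebius d * ln m - moebius d * ln d)"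
  proof (intro sum.cong refl)
    fix d assume "d \<in> {d. d dvd m}"
    hence d: "d dvd m" by simp
    show "moebius d * ln (m div d) = moebius d * ln m - moebius d * ln d"
      using dp[OF d] assms d by (simp add: real_of_nat_div ln_div algebra_simps)
  qed
  also have "\<dots> = (\<Sum>d | d dvd m. moebius d) * ln m - (\<Sum>d | d dvd m. moebius d * ln d)"
    by (simp add: sum_subtractf sum_distrib_right)
  also have "(\<Sum>d | d dvd m. moebius d) * ln m = 0" using assms by (simp add: sum_moebius_dvd)
  finally show ?thesis using 1 by simp
qed


lemma nat_floor_divide: assumes "x \<ge> 0" shows "nat \<lfloor>x / real n\<rfloor> = nat \<lfloor>x\<rfloor> div n"
proof -
  have "\<lfloor>x / real_of_int (int n)\<rfloor> = \<lfloor>x\<rfloor> div int n" by (rule floor_divide_real_eq_div) simp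
  thus ?thesis using assms by (simp add: nat_div_distrib)
qed

lemma sum_psi: assumes "x \<ge> 1"
  shows "(\<Sum>n\<in>{1..nat \<lfloor>x\<rfloor>}. psi (x / n)) = ln (fact (nat \<lfloor>x\<rfloor>))"
proof -
  define N where "N = nat \<lfloor>x\<rfloor>"
  have fl: "nat \<lfloor>x / real n\<rfloor> = N div n" for n using nat_floor_divide[of x n] assms by (simp add: N_def)
  have "(\<Sum>n\<in>{1..N}. psi (x / n)) = (\<Sum>n\<in>{1..N}. \<Sum>d\<in>{1..N div n}. Lam d)"
    by (simp add: psi_def fl)
  also have "\<dots> = (\<Sum>n\<in>{1..N}. \<Sum>d\<in>{1..N div n}. Lam ((n * d) div n))" by (intro sum.cong refl) auto
  also have "\<dots> = (\<Sum>m\<in>{1..N}. \<Sum>n | n dvd m. Lam (m div n))" by (rule sum_div_swap)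
  also have "\<dots> = (\<Sum>m\<in>{1..N}. ln (real m))"
    by (intro sum.cong refl, subst sum_dvd_flip) (auto simp: mangoldt_sum)
  finally show ?thesis by (simp add: ln_fact_eq_sum N_def)
qed

lemma harm_approx: assumes "N \<ge> 1" shows "\<bar>harm N - euler_mascheroni - ln (real N)\<bar> \<le> 1 / real N"
proof -
  have b: "euler_mascheroni \<in> {harm N - ln (real (Suc N)) + inverse (real (2*(N+1)))..harm N - ln (real (Suc N)) + inverse (real (2*N))}"
    using euler_mascheroni_bounds[OF assms] by simp
  have N: "real N > 0" using assms by simp
  have "ln (real (Suc N)) - ln (real N) = ln (1 + 1 / real N)" using ln_Suc_split[of N] N by simp
  moreover have "ln (1 + 1 / real N) \<le> 1 / N" by (intro ln_add_one_self_le_self) auto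
  moreover have "ln (real (Suc N)) \<ge> ln (real N)" using N by simp
  moreover have "inverse (real (2*N)) \<le> 1 / N" "inverse (real (2*(N+1))) \<ge> 0" using N by (auto simp: field_simps)
  ultimately show ?thesis using b by (simp only: atLeastAtMost_iff) linarith
qed

text \<open>
  The constant is chosen so that all main terms cancel in the sum of \<open>ti_kernel (x / n)\<close> over \<open>n \<le> x\<close>: the three
  summands contribute \<open>x * ln x - x\<close>, \<open>- x * (ln x + euler_mascheroni)\<close> and \<open>(euler_mascheroni + 1) * x\<close>.
\<close>

definition ti_kernel :: "real \<Rightarrow> real" where "ti_kernel x = psi x - x + (euler_mascheroni + 1)"

lemma sum_ti_kernel_bound:
  assumes "x \<ge> 1" shows "\<bar>\<Sum>n\<in>{1..nat \<lfloor>x\<rfloor>}. ti_kernel (x / n)\<bar> \<le> 6 + 2 * ln x"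
proof -
  define N where "N = nat \<lfloor>x\<rfloor>"
  define c where "c = (euler_mascheroni :: real)"
  have c: "0 < c" "c < 1" unfolding c_def using euler_mascheroni_pos euler_mascheroni_less_13_over_22 by auto
  have N: "N \<ge> 1" "real N \<le> x" "x \<le> real N + 1" using assms unfolding N_def by linarith+
  have "(\<Sum>n\<in>{1..N}. x / n) = x * harm N" by (simp add: harm_def sum_distrib_left divide_inverse)
  hence eq: "(\<Sum>n\<in>{1..N}. ti_kernel (x / n)) = ln (fact N) - x * harm N + (c + 1) * N"
    using sum_psi[OF assms] by (simp add: ti_kernel_def sum.distrib sum_subtractf N_def c_def mult.commute)
  have "\<bar>x * (harm N - c - ln N)\<bar> \<le> x * (1 / N)"
    unfolding abs_mult using harm_approx[OF N(1)] assms by (intro mult_mono) (auto simp: c_def)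
  also have "\<dots> \<le> 2" using N by (simp add: field_simps)
  finally have h: "\<bar>x * harm N - x * c - x * ln N\<bar> \<le> 2" by (simp add: algebra_simps)
  have l: "0 \<le> ln N" "ln N \<le> ln x" using N by auto
  have a: "0 \<le> (x - N) * ln N" "(x - N) * ln N \<le> 1 * ln N" using N l mult_right_mono[of "x - N" 1 "ln N"] by (auto intro!: mult_nonneg_nonneg)
  have b: "0 \<le> (x - N) * c" "(x - N) * c \<le> 1 * 1" using N c mult_mono[of "x - N" 1 c 1] by (auto intro!: mult_nonneg_nonneg)
  have "ln (fact N) - x * harm N + (c + 1) * N = (ln (fact N) - (real N * ln N - N)) - (x * harm N - x * c - x * ln N) - (x - N) * ln N - (x - N) * c"
    by (simp add: algebra_simps)
  thus ?thesis using ln_fact_bounds[OF N(1)] h a b l eq unfolding N_def[symmetric] by linarith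
qed

lemma sum_inv_sqrt_le: "(\<Sum>d\<in>{1..N}. 1 / sqrt (real d)) \<le> 2 * sqrt (real N)"
proof (induction N)
  case (Suc n)
  have "1 / sqrt (real (Suc n)) \<le> 2 * sqrt (real (Suc n)) - 2 * sqrt (real n)"
  proof -
    have "(sqrt (real (Suc n)) - sqrt (real n)) ^ 2 \<ge> 0" by simp
    hence "2 * sqrt (real n) * sqrt (real (Suc n)) \<le> real (Suc n) + real n"
      by (simp add: power2_diff algebra_simps)
    hence "1 \<le> (2 * sqrt (real (Suc n)) - 2 * sqrt (real n)) * sqrt (real (Suc n))"
      by (simp add: algebra_simps)
    thus ?thesis by (simp add: pos_divide_le_eq)
  qed
  thus ?case using Suc by simp
qed auto

text \<open>
  Any bound by a power of \<open>y\<close> with exponent below one would do in place of \<open>sqrt y\<close>: it makes the sum over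
  \<open>d \<le> x\<close> of this quantity at \<open>y = x / d\<close> of size \<open>O(x)\<close>.
\<close>

lemma ln_poly_le_sqrt: assumes "y \<ge> 1" shows "ln y * (6 + 2 * ln y) \<le> 44 * sqrt y"
proof -
  define u where "u = sqrt (sqrt y)"
  have u: "u \<ge> 1" "u ^ 2 = sqrt y" using assms by (auto simp: u_def)
  have l: "0 \<le> ln y" "ln y \<le> 2 * sqrt y" using assms ln_le_2_sqrt[of y] by auto
  have "ln y = 2 * ln (sqrt y)" using assms by (simp add: ln_sqrt)
  also have "\<dots> \<le> 4 * u" using ln_le_2_sqrt[of "sqrt y"] assms by (simp add: u_def)
  finally have "ln y * ln y \<le> (4 * u) * (4 * u)" using l u by (intro mult_mono) auto
  also have "\<dots> = 16 * sqrt y" using u by (simp add: power2_eq_square)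
  finally have "ln y * ln y \<le> 16 * sqrt y" .
  thus ?thesis using l by (simp add: algebra_simps)
qed

text \<open>
  Let \<open>H y\<close> be the sum of \<open>ti_kernel (y / n)\<close> over \<open>n \<le> y\<close>, which is \<open>O(1 + ln y)\<close>. Moebius inversion of \<open>H\<close> with the
  additional weight \<open>ln (x / d)\<close> produces, besides \<open>ti_kernel x * ln x\<close>, the sum against \<open>mangoldt\<close>, because the
  sum of \<open>moebius d * ln d\<close> over the divisors of \<open>m\<close> is \<open>- mangoldt m\<close>. The bound on \<open>H\<close> makes the inverted sum \<open>O(x)\<close>.
\<close>

lemma tatuzawa_iseki:
  assumes "x \<ge> 1"
  shows "\<bar>ti_kernel x * ln x + (\<Sum>n\<in>{1..nat \<lfloor>x\<rfloor>}. Lam n * ti_kernel (x / n))\<bar> \<le> 88 * x"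
proof -
  define N where "N = nat \<lfloor>x\<rfloor>"
  have N: "N \<ge> 1" "real N \<le> x" "x \<le> real N + 1" using assms unfolding N_def by linarith+
  have fl: "nat \<lfloor>x / real n\<rfloor> = N div n" for n using nat_floor_divide[of x n] assms by (simp add: N_def)
  let ?H = "\<lambda>x. \<Sum>n\<in>{1..nat \<lfloor>x\<rfloor>}. ti_kernel (x / n)"
  have "(\<Sum>d\<in>{1..N}. moebius d * ln (x / d) * ?H (x / d))
      = (\<Sum>d\<in>{1..N}. \<Sum>n\<in>{1..N div d}. moebius d * ln (x / d) * ti_kernel (x / real (d * n)))"
    by (simp add: fl sum_distrib_left)
  also have "\<dots> = (\<Sum>m\<in>{1..N}. \<Sum>d | d dvd m. moebius d * ln (x / d) * ti_kernel (x / m))"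
    by (rule sum_div_swap)
  also have "\<dots> = (\<Sum>m\<in>{1..N}. ((if m = 1 then ln x else 0) + Lam m) * ti_kernel (x / m))"
  proof (intro sum.cong refl)
    fix m assume m: "m \<in> {1..N}"
    have "(\<Sum>d | d dvd m. moebius d * ln (x / d)) = (\<Sum>d | d dvd m. moebius d * ln x - moebius d * ln d)"
      using m assms by (intro sum.cong refl) (auto simp: ln_div algebra_simps intro!: Nat.gr0I)
    also have "\<dots> = (\<Sum>d | d dvd m. moebius d) * ln x - (\<Sum>d | d dvd m. moebius d * ln d)"
      by (simp add: sum_subtractf sum_distrib_right)
    also have "\<dots> = (if m = 1 then ln x else 0) + Lam m" using m
      by (subst sum_moebius_dvd, simp, subst sum_moebius_ln_dvd) auto
    finally show "(\<Sum>d | d dvd m. moebius d * ln (x / d) * ti_kernel (x / m)) = ((if m = 1 then ln x else 0) + Lam m) * ti_kernel (x / m)"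
      by (simp flip: sum_distrib_right)
  qed
  also have "\<dots> = (\<Sum>m\<in>{1..N}. if m = 1 then ln x * ti_kernel (x / m) else 0) + (\<Sum>m\<in>{1..N}. Lam m * ti_kernel (x / m))"
    unfolding sum.distrib[symmetric] by (intro sum.cong refl) (auto simp: algebra_simps)
  also have "(\<Sum>m\<in>{1..N}. if m = 1 then ln x * ti_kernel (x / m) else 0) = ti_kernel x * ln x"
    using N by (simp add: mult.commute)
  finally have "\<bar>ti_kernel x * ln x + (\<Sum>m\<in>{1..N}. Lam m * ti_kernel (x / m))\<bar> = \<bar>\<Sum>d\<in>{1..N}. moebius d * ln (x / d) * ?H (x / d)\<bar>"
    by simp
  also have "\<dots> \<le> (\<Sum>d\<in>{1..N}. 44 * sqrt x * (1 / sqrt d))"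
  proof (intro order_trans[OF sum_abs] sum_mono)
    fix d assume d: "d \<in> {1..N}"
    hence y: "x / d \<ge> 1" using N by (simp add: field_simps)
    have "\<bar>moebius d * ln (x / d) * ?H (x / d)\<bar> \<le> 1 * ln (x / d) * (6 + 2 * ln (x / d))"
      unfolding abs_mult using y sum_ti_kernel_bound[OF y] abs_moebius_le[of d]
      by (intro mult_mono) (auto intro!: mult_nonneg_nonneg)
    also have "\<dots> \<le> 44 * sqrt (x / d)" using ln_poly_le_sqrt[OF y] by simp
    also have "\<dots> = 44 * sqrt x * (1 / sqrt d)" by (simp add: real_sqrt_divide)
    finally show "\<bar>moebius d * ln (x / d) * ?H (x / d)\<bar> \<le> 44 * sqrt x * (1 / sqrt d)" .
  qed
  also have "\<dots> = 44 * sqrt x * (\<Sum>d\<in>{1..N}. 1 / sqrt d)" by (simp add: sum_distrib_left)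
  also have "\<dots> \<le> 44 * sqrt x * (2 * sqrt x)" using N assms
    by (intro mult_left_mono order_trans[OF sum_inv_sqrt_le]) auto
  also have "\<dots> = 88 * x" using assms by simp
  finally show ?thesis by (simp add: N_def)
qed

definition selberg_sum :: "real \<Rightarrow> real" where
  "selberg_sum x = psi x * ln x + (\<Sum>n\<in>{1..nat \<lfloor>x\<rfloor>}. Lam n * psi (x / n))"

text \<open>
  In \<open>tatuzawa_iseki\<close> the contributions of \<open>- x\<close> and of the constant in \<open>ti_kernel\<close> are evaluated by Mertens' estimate
  and Chebyshev's bound; what is left is Selberg's sum.
\<close>

lemma selberg_formula: assumes "x \<ge> 1" shows "\<bar>selberg_sum x - 2 * x * ln x\<bar> \<le> 103 * x"
proof -
  define c where "c = (euler_mascheroni + 1 :: real)"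
  have c: "0 < c" "c < 2" unfolding c_def using euler_mascheroni_pos euler_mascheroni_less_13_over_22 by linarith+
  let ?I = "{1..nat \<lfloor>x\<rfloor>}"
  have "(\<Sum>n\<in>?I. Lam n * ti_kernel (x / n)) = (\<Sum>n\<in>?I. Lam n * psi (x / n)) - x * mertens_sum x + c * psi x"
    unfolding mertens_sum_def psi_def[of x] sum_distrib_left sum.distrib[symmetric] sum_subtractf[symmetric]
    by (intro sum.cong refl) (auto simp: ti_kernel_def c_def algebra_simps)
  hence eq: "ti_kernel x * ln x + (\<Sum>n\<in>?I. Lam n * ti_kernel (x / n)) = selberg_sum x - 2 * x * ln x - x * (mertens_sum x - ln x) + c * ln x + c * psi x"
    by (simp add: selberg_sum_def ti_kernel_def c_def algebra_simps)
  have "\<bar>x * (mertens_sum x - ln x)\<bar> \<le> x * 5" unfolding abs_mult using mertens_sum_bounds[OF assms] assms by (intro mult_mono) auto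
  moreover have "0 \<le> c * ln x" "c * ln x \<le> 2 * x" using c assms ln_le_minus_one[of x]
    by (auto intro!: mult_nonneg_nonneg mult_mono)
  moreover have "0 \<le> c * psi x" "c * psi x \<le> 2 * (4 * x)" using c assms psi_nonneg[of x] psi_le[of x]
      mult_mono[of c 2 "psi x" "4 * x"] by (auto intro!: mult_nonneg_nonneg)
  ultimately show ?thesis using tatuzawa_iseki[OF assms] unfolding eq by linarith
qed

text \<open>
  Both summands of \<open>selberg_sum\<close> are nondecreasing, so the increase of \<open>psi\<close> over the window times \<open>ln x\<close> is at most
  the increase \<open>2 * h * x * ln x + O(x)\<close> of Selberg's sum. Once \<open>ln x\<close> exceeds a large multiple of \<open>1 / h\<close>, the error
  is absorbed. What matters is that the constant \<open>5\<close> does not depend on \<open>h\<close>: an arbitrarily short window cannot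
  carry more than a bounded multiple of its expected share of primes.
\<close>

lemma brun_titchmarsh:
  assumes h: "0 < h" "h \<le> 1" and x: "x \<ge> exp (1000 / h)"
  shows "recip_sum (primes_in x (x * exp h)) \<le> 5 * h / ln x"
proof -
  define y where "y = x * exp h"
  have "1 \<le> 1000 / h" using h by (simp add: field_simps)
  have "exp (1000 / h) \<ge> 1" using h by simp
  hence x1: "x \<ge> 1" using x by linarith
  have "ln x \<ge> ln (exp (1000 / h))" using x by (subst ln_le_cancel_iff) (auto intro: less_le_trans[OF exp_gt_zero])
  hence lx: "ln x \<ge> 1000 / h" by simp
  hence lx0: "ln x > 0" using \<open>1 \<le> 1000 / h\<close> by linarith
  have e: "exp h \<le> 1 + 2 * h"
  proof -
    have "exp h \<le> 1 + h + h\<^sup>2" using h by (intro exp_bound) auto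
    moreover have "h\<^sup>2 \<le> h" using h by (simp add: power2_eq_square mult_left_le)
    ultimately show ?thesis by linarith
  qed
  have xy: "x \<le> y" using x1 h by (simp add: y_def)
  have yx: "y - x \<le> 2 * h * x" using mult_left_mono[OF e, of x] x1 by (simp add: y_def algebra_simps)
  have y3: "y \<le> 3 * x" using e h mult_left_mono[of "exp h" 3 x] x1 by (simp add: y_def mult.commute)
  have ly: "ln y = ln x + h" using x1 by (simp add: y_def ln_mult)
  have "(psi y - psi x) * ln x \<le> selberg_sum y - selberg_sum x"
  proof -
    have "psi y * ln x \<le> psi y * ln y" using xy x1 by (intro mult_left_mono psi_nonneg) auto
    moreover have "(\<Sum>n\<in>{1..nat \<lfloor>x\<rfloor>}. Lam n * psi (x / n)) \<le> (\<Sum>n\<in>{1..nat \<lfloor>y\<rfloor>}. Lam n * psi (y / n))"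
    proof -
      have "(\<Sum>n\<in>{1..nat \<lfloor>x\<rfloor>}. Lam n * psi (x / n)) \<le> (\<Sum>n\<in>{1..nat \<lfloor>x\<rfloor>}. Lam n * psi (y / n))"
        using xy by (intro sum_mono mult_left_mono psi_mono mangoldt_nonneg divide_right_mono) auto
      also have "\<dots> \<le> (\<Sum>n\<in>{1..nat \<lfloor>y\<rfloor>}. Lam n * psi (y / n))"
        using nat_mono[OF floor_mono[OF xy]]
        by (intro sum_mono2) (auto intro!: mult_nonneg_nonneg mangoldt_nonneg psi_nonneg)
      finally show ?thesis .
    qed
    ultimately show ?thesis by (simp add: selberg_sum_def algebra_simps)
  qed
  also have "\<dots> \<le> 2 * y * ln y - 2 * x * ln x + 103 * y + 103 * x"
    using selberg_formula[OF x1] selberg_formula[of y] x1 xy by linarith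
  also have "\<dots> = 2 * (y - x) * ln x + 2 * y * h + 103 * y + 103 * x" by (simp add: ly algebra_simps)
  also have "\<dots> \<le> 2 * (2 * h * x) * ln x + 2 * (3 * x) * 1 + 103 * (3 * x) + 103 * x"
    using yx y3 lx0 h x1 xy by (intro add_mono mult_mono) auto
  also have "\<dots> \<le> 5 * h * x * ln x"
  proof -
    have "h * ln x \<ge> h * (1000 / h)" using lx h by (intro mult_left_mono) auto
    hence "h * ln x \<ge> 1000" using h by simp
    hence "x * (h * ln x) \<ge> x * 1000" using x1 by (intro mult_left_mono) auto
    thus ?thesis using x1 by (simp add: algebra_simps)
  qed
  finally have "(psi y - psi x) * ln x \<le> (5 * h * x) * ln x" .
  hence ps: "psi y - psi x \<le> 5 * h * x" using lx0 by simp
  have d: "psi y - psi x = (\<Sum>n | x < real n \<and> real n \<le> y. Lam n)"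
    unfolding psi_def by (rule sum_upto_diff[OF x1 xy])
  have "x * ln x * recip_sum (primes_in x y) \<le> (\<Sum>p\<in>primes_in x y. Lam p)"
    unfolding sum_distrib_left
  proof (intro sum_mono)
    fix p assume "p \<in> primes_in x y"
    hence p: "prime p" "x < real p" by (auto simp: primes_in_def)
    have "x * ln x \<le> p * ln p" using p x1 lx0 by (intro mult_mono) auto
    thus "x * ln x * (1 / real p) \<le> Lam p" using p x1 by (simp add: field_simps)
  qed
  also have "\<dots> \<le> psi y - psi x" unfolding d
    by (intro sum_mono2 finite_real_interval) (auto simp: primes_in_def mangoldt_nonneg)
  finally have "x * ln x * recip_sum (primes_in x y) \<le> 5 * h * x" using ps by linarith
  thus ?thesis using x1 lx0 unfolding y_def by (simp add: field_simps)
qed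

section \<open>The dual Turan-Kubilius inequality\<close>

lemma card_multiples: "card {n\<in>{1..N}. d dvd n} = N div d" if "d > 0"
proof -
  have "{n\<in>{1..N}. d dvd n} = (\<lambda>m. d * m) ` {1..N div d}"
    using that by (auto simp: less_eq_div_iff_mult_less_eq mult.commute elim!: dvdE)
  moreover have "inj_on (\<lambda>m. d * m) {1..N div d}" using that by (auto simp: inj_on_def)
  ultimately show ?thesis by (simp add: card_image)
qed

lemma sum_of_bool_dvd: "(\<Sum>n\<in>{1..N}. of_bool (d dvd n) :: real) = real (N div d)" if "d > 0"
  using card_multiples[OF that, of N] by (simp add: of_bool_def sum.If_cases Int_def)

text \<open>
  Divisibility by \<open>p\<close> and by \<open>q\<close> are independent events up to the rounding in three quotients, and the
  rounding errors \<open>N mod (p * q)\<close>, \<open>N mod p\<close> and \<open>N mod q\<close> enter with opposite signs.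
\<close>

lemma tk_covariance:
  assumes "prime p" "prime q" "p \<noteq> q"
  shows "\<bar>\<Sum>n\<in>{1..N}. (real p * of_bool (p dvd n) - 1) * (real q * of_bool (q dvd n) - 1)\<bar> \<le> real p * real q"
proof -
  have pq: "p \<ge> 2" "q \<ge> 2" using assms prime_ge_2_nat by auto
  have "coprime p q" using assms primes_coprime by auto
  hence d: "p * q dvd n \<longleftrightarrow> p dvd n \<and> q dvd n" for n
    by (meson divides_mult dvd_mult_left dvd_mult_right)
  have "(\<Sum>n\<in>{1..N}. (real p * of_bool (p dvd n) - 1) * (real q * of_bool (q dvd n) - 1))
     = (\<Sum>n\<in>{1..N}. real (p * q) * of_bool (p * q dvd n) - real p * of_bool (p dvd n) - real q * of_bool (q dvd n) + 1)"
    by (intro sum.cong refl) (auto simp: d algebra_simps)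
  also have "\<dots> = real (p * q) * (\<Sum>n\<in>{1..N}. of_bool (p * q dvd n)) - real p * (\<Sum>n\<in>{1..N}. of_bool (p dvd n)) - real q * (\<Sum>n\<in>{1..N}. of_bool (q dvd n)) + N"
    by (simp add: sum.distrib sum_subtractf sum_distrib_left)
  also have "\<dots> = real (p * q) * real (N div (p * q)) - real p * real (N div p) - real q * real (N div q) + real N"
  proof -
    have "p > 0" "q > 0" "p * q > 0" using pq by auto
    thus ?thesis by (simp only: sum_of_bool_dvd)
  qed
  finally have eq: "(\<Sum>n\<in>{1..N}. (real p * of_bool (p dvd n) - 1) * (real q * of_bool (q dvd n) - 1)) = \<dots>" .
  have r: "real d * real (N div d) = real N - real (N mod d)" for d
    by (metis add_diff_cancel_right' mult_div_mod_eq of_nat_add of_nat_mult)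
  have m: "N mod (p * q) < p * q" "N mod p < p" "N mod q < q" using pq by auto
  have "p + q \<le> p * q"
  proof -
    obtain a b where "p = 2 + a" "q = 2 + b" using pq le_Suc_ex by metis
    thus ?thesis by (simp add: algebra_simps)
  qed
  hence "real p + real q \<le> real (p * q)" by (metis of_nat_add of_nat_le_iff)
  moreover have "real (N mod (p * q)) \<le> real (p * q)" "real (N mod p) \<le> real p" "real (N mod q) \<le> real q"
    using m by (simp_all only: of_nat_le_iff less_imp_le)
  moreover have "real p * real q = real (p * q)" by simp
  moreover have "\<bar>(n - u) - (n - v) - (n - v') + n\<bar> \<le> c"
    if "a + b \<le> c" "u \<le> c" "v \<le> a" "v' \<le> b" "0 \<le> u" "0 \<le> v" "0 \<le> v'" for a b c u v v' n :: real
    using that by linarith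
  ultimately show ?thesis unfolding eq r[of p] r[of q] r[of "p * q"] by (metis of_nat_0_le_iff)
qed

lemma tk_variance:
  assumes "prime p"
  shows "(\<Sum>n\<in>{1..N}. (real p * of_bool (p dvd n) - 1) * (real p * of_bool (p dvd n) - 1)) \<le> real p * real N"
proof -
  have p: "p \<ge> 2" using assms prime_ge_2_nat by auto
  have "(\<Sum>n\<in>{1..N}. (real p * of_bool (p dvd n) - 1) * (real p * of_bool (p dvd n) - 1))
     = (\<Sum>n\<in>{1..N}. (real p - 2) * p * of_bool (p dvd n) + 1)"
    by (intro sum.cong refl) (auto simp: algebra_simps)
  also have "\<dots> = (real p - 2) * p * (\<Sum>n\<in>{1..N}. of_bool (p dvd n)) + N"
    by (simp add: sum.distrib sum_distrib_left)
  also have "\<dots> = (real p - 2) * (p * real (N div p)) + N" using p by (subst sum_of_bool_dvd) auto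
  also have "\<dots> \<le> (real p - 2) * N + N"
  proof -
    have "real p * real (N div p) \<le> N" by (metis of_nat_le_iff of_nat_mult times_div_less_eq_dividend)
    thus ?thesis using p by (intro add_mono mult_left_mono) auto
  qed
  also have "\<dots> \<le> real p * N" by (simp add: algebra_simps)
  finally show ?thesis .
qed

text \<open>
  Let \<open>X\<close> be the left-hand side and \<open>b p = \<Delta> p / p\<close>. Then \<open>X\<close> is the sum over \<open>n\<close> of \<open>c n\<close> times the sum of
  \<open>b p * (p * of_bool (p dvd n) - 1)\<close> over \<open>p \<in> Q\<close>. By \<open>tk_variance\<close> and \<open>tk_covariance\<close> the second moment of the
  inner sum is at most \<open>N * X\<close> plus the square of the sum of \<open>\<bar>b p\<bar> * p\<close>, and this square is at most \<open>\<Sum>Q * X \<le> N * X\<close>.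
  The Cauchy-Schwarz inequality gives \<open>X\<^sup>2 \<le> 2 * N\<^sup>2 * X\<close>.
\<close>

lemma turan_kubilius_dual:
  fixes c :: "nat \<Rightarrow> real"
  assumes c: "\<And>n. \<bar>c n\<bar> \<le> 1" and Q: "finite Q" "\<And>p. p \<in> Q \<Longrightarrow> prime p" and N: "N \<ge> \<Sum>Q"
  defines "\<Delta> \<equiv> \<lambda>p. \<Sum>n\<in>{1..N}. c n * (real p * of_bool (p dvd n) - 1)"
  shows "(\<Sum>p\<in>Q. (\<Delta> p)^2 / p) \<le> 2 * real N ^ 2"
proof -
  define b where "b = (\<lambda>p. \<Delta> p / real p)"
  define e where "e = (\<lambda>p n. real p * of_bool (p dvd n) - 1)"
  define X where "X = (\<Sum>p\<in>Q. (\<Delta> p)^2 / p)"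
  have X0: "X \<ge> 0" unfolding X_def by (intro sum_nonneg) auto
  have Xb: "X = (\<Sum>p\<in>Q. p * (b p)^2)" unfolding X_def b_def using Q(2)
    by (intro sum.cong refl) (auto simp: power2_eq_square prime_gt_0_nat)
  have "(\<Sum>n\<in>{1..N}. (\<Sum>p\<in>Q. b p * e p n)^2) = (\<Sum>p\<in>Q. \<Sum>q\<in>Q. b p * b q * (\<Sum>n\<in>{1..N}. e p n * e q n))"
  proof -
    have "(\<Sum>n\<in>{1..N}. (\<Sum>p\<in>Q. b p * e p n)^2) = (\<Sum>n\<in>{1..N}. \<Sum>p\<in>Q. \<Sum>q\<in>Q. b p * b q * (e p n * e q n))"
      by (simp add: power2_eq_square sum_product algebra_simps)
    also have "\<dots> = (\<Sum>p\<in>Q. \<Sum>n\<in>{1..N}. \<Sum>q\<in>Q. b p * b q * (e p n * e q n))" by (rule sum.swap)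
    also have "\<dots> = (\<Sum>p\<in>Q. \<Sum>q\<in>Q. \<Sum>n\<in>{1..N}. b p * b q * (e p n * e q n))"
      by (rule sum.cong[OF refl], rule sum.swap)
    also have "\<dots> = (\<Sum>p\<in>Q. \<Sum>q\<in>Q. b p * b q * (\<Sum>n\<in>{1..N}. e p n * e q n))"
      by (simp only: sum_distrib_left)
    finally show ?thesis .
  qed
  also have "\<dots> \<le> (\<Sum>p\<in>Q. \<Sum>q\<in>Q. (if p = q then N * (p * (b p)^2) else 0) + \<bar>b p\<bar> * p * (\<bar>b q\<bar> * q))"
  proof (intro sum_mono)
    fix p q assume pq: "p \<in> Q" "q \<in> Q"
    show "b p * b q * (\<Sum>n\<in>{1..N}. e p n * e q n) \<le> (if p = q then N * (p * (b p)^2) else 0) + \<bar>b p\<bar> * p * (\<bar>b q\<bar> * q)"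
    proof (cases "p = q")
      case True
      have "b p * b p * (\<Sum>n\<in>{1..N}. e p n * e p n) \<le> b p * b p * (real p * real N)"
        unfolding e_def using pq Q by (intro mult_left_mono tk_variance) auto
      also have "\<dots> = N * (p * (b p)^2)" by (simp add: power2_eq_square)
      finally show ?thesis using True by (simp add: add_increasing2)
    next
      case False
      have "b p * b q * (\<Sum>n\<in>{1..N}. e p n * e q n) \<le> \<bar>b p * b q * (\<Sum>n\<in>{1..N}. e p n * e q n)\<bar>" by simp
      also have "\<dots> \<le> \<bar>b p\<bar> * \<bar>b q\<bar> * (real p * real q)" unfolding abs_mult e_def
        using tk_covariance[of p q N] pq Q False by (intro mult_left_mono) (auto simp: abs_mult)
      finally show ?thesis using False by (simp add: mult_ac)
    qed
  qed
  also have "\<dots> = (\<Sum>p\<in>Q. N * (p * (b p)^2)) + (\<Sum>p\<in>Q. \<bar>b p\<bar> * p)^2"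
    using Q by (simp add: sum.distrib power2_eq_square sum_product)
  also have "(\<Sum>p\<in>Q. N * (p * (b p)^2)) = N * X" by (simp add: Xb sum_distrib_left)
  also have "(\<Sum>p\<in>Q. \<bar>b p\<bar> * p)^2 = (\<Sum>p\<in>Q. sqrt p * (sqrt p * \<bar>b p\<bar>))^2"
    by (intro arg_cong[of _ _ "\<lambda>x. x^2"] sum.cong refl) (metis mult.assoc mult.commute of_nat_0_le_iff real_sqrt_mult_self abs_of_nonneg)
  also have "\<dots> \<le> (\<Sum>p\<in>Q. (sqrt p)^2) * (\<Sum>p\<in>Q. (sqrt p * \<bar>b p\<bar>)^2)" by (rule Cauchy_Schwarz_ineq_sum)
  also have "(\<Sum>p\<in>Q. (sqrt p * \<bar>b p\<bar>)^2) = X" by (simp add: Xb power_mult_distrib)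
  also have "(\<Sum>p\<in>Q. (sqrt (real p))^2) = real (\<Sum>Q)" by simp
  also have "real (\<Sum>Q) * X \<le> N * X" using N X0 by (intro mult_right_mono) (simp_all only: of_nat_le_iff)
  finally have T: "(\<Sum>n\<in>{1..N}. (\<Sum>p\<in>Q. b p * e p n)^2) \<le> 2 * (N * X)" by (simp add: mult.commute)
  have "X = (\<Sum>p\<in>Q. b p * \<Delta> p)" by (simp add: X_def b_def power2_eq_square)
  also have "\<dots> = (\<Sum>p\<in>Q. \<Sum>n\<in>{1..N}. c n * (b p * e p n))" by (simp add: \<Delta>_def e_def sum_distrib_left mult_ac)
  also have "\<dots> = (\<Sum>n\<in>{1..N}. \<Sum>p\<in>Q. c n * (b p * e p n))" by (rule sum.swap)
  also have "\<dots> = (\<Sum>n\<in>{1..N}. c n * (\<Sum>p\<in>Q. b p * e p n))" by (simp add: sum_distrib_left)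
  finally have "X^2 = (\<Sum>n\<in>{1..N}. c n * (\<Sum>p\<in>Q. b p * e p n))^2" by simp
  also have "\<dots> \<le> (\<Sum>n\<in>{1..N}. (c n)^2) * (\<Sum>n\<in>{1..N}. (\<Sum>p\<in>Q. b p * e p n)^2)" by (rule Cauchy_Schwarz_ineq_sum)
  also have "\<dots> \<le> real N * (2 * (N * X))"
  proof (intro mult_mono T)
    have "(\<Sum>n\<in>{1..N}. (c n)^2) \<le> (\<Sum>n\<in>{1..N}. 1)" using c by (intro sum_mono) (simp add: abs_square_le_1)
    thus "(\<Sum>n\<in>{1..N}. (c n)^2) \<le> N" by simp
  qed (auto intro: sum_nonneg)
  finally have "X * X \<le> (2 * real N ^ 2) * X" by (simp add: power2_eq_square mult_ac)
  hence "X \<le> 2 * real N ^ 2" using X0 by (cases "X = 0") auto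
  thus ?thesis by (simp add: X_def)
qed

lemma sum_inv_squares_le: "finite Q \<Longrightarrow> (\<And>p. p \<in> Q \<Longrightarrow> p \<ge> (2::nat)) \<Longrightarrow> (\<Sum>p\<in>Q. 1 / real p ^ 2) \<le> 1"
proof -
  assume Q: "finite Q" "\<And>p. p \<in> Q \<Longrightarrow> p \<ge> (2::nat)"
  have a: "(\<Sum>n\<in>{2..Suc m}. 1 / real n ^ 2) \<le> 1 - 1 / real (Suc m)" for m
  proof (induction m)
    case (Suc m)
    have "1 / real (Suc (Suc m))^2 \<le> 1 / (real (Suc m) * real (Suc (Suc m)))"
      by (intro divide_left_mono) (auto simp: power2_eq_square intro!: mult_mono)
    also have "\<dots> = 1 / real (Suc m) - 1 / real (Suc (Suc m))" by (simp add: divide_simps)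
    finally show ?case using Suc by simp
  qed auto
  define m where "m = Max (insert 0 Q)"
  have "Q \<subseteq> {2..Suc m}" using Q by (auto simp: m_def le_SucI)
  hence "(\<Sum>p\<in>Q. 1 / real p ^ 2) \<le> (\<Sum>n\<in>{2..Suc m}. 1 / real n ^ 2)" by (intro sum_mono2) auto
  also have "\<dots> \<le> 1" using a[of m] by (smt (verit) divide_nonneg_nonneg of_nat_0_le_iff)
  finally show ?thesis .
qed

section \<open>Mean values of almost multiplicative functions\<close>

text \<open>
  Attach to \<open>p \<in> G i\<close> the window with number \<open>\<lfloor>ln (x i / p) / h\<rfloor>\<close>. By the separation hypothesis a window receives
  primes from one \<open>G i\<close> only, so by the Brun-Titchmarsh bound its mass is at most \<open>10 * h / ln t\<close>. There are at most
  \<open>4 * ln t / h\<close> windows. The point of the bound \<open>40\<close> is its independence of \<open>K\<close> and \<open>h\<close>.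
\<close>

lemma sum_inv_primes_separated_le:
  fixes x :: "nat \<Rightarrow> real" and G :: "nat \<Rightarrow> nat set" and N U t h :: real
  assumes h: "0 < h" "h \<le> 1" and t: "t > 0" "ln t \<ge> 2000 / h" and U: "U > 0" "ln U \<le> ln t" and N: "N > 0"
    and x: "\<And>i. i < K \<Longrightarrow> N / U \<le> x i \<and> x i \<le> N"
    and G: "\<And>i. i < K \<Longrightarrow> G i \<subseteq> primes_in t (t\<^sup>2)"
    and sep: "\<And>i j p q. i < K \<Longrightarrow> j < K \<Longrightarrow> p \<in> G i \<Longrightarrow> q \<in> G j \<Longrightarrow>
                \<bar>ln (x i / p) - ln (x j / q)\<bar> < h \<Longrightarrow> i = j"
  shows "(\<Sum>i<K. \<Sum>p\<in>G i. 1 / real p) \<le> 40"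
proof -
  define l where "l = ln t"
  have "2000 / h \<ge> 2000" using h by (simp add: field_simps)
  hence l: "l \<ge> 2000" "l \<ge> 2000 / h" using t by (auto simp: l_def)
  define I where "I = (SIGMA i:{..<K}. G i)"
  define \<beta> where "\<beta> = (\<lambda>(i, p). \<lfloor>ln (x i / real p) / h\<rfloor>)"
  have finG: "finite (G i)" if "i < K" for i using finite_subset[OF G[OF that] finite_primes_in] .
  hence finI: "finite I" by (auto simp: I_def)
  have xpos: "x i > 0" if "i < K" for i using x[OF that] N U by (smt (verit) divide_pos_pos)
  have pr: "p > 0 \<and> l < ln p \<and> ln p \<le> 2 * l \<and> t < real p" if "i < K" "p \<in> G i" for i p
  proof -
    have p: "t < p" "p \<le> t\<^sup>2" using G[OF that(1)] that(2) by (auto simp: primes_in_def)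
    hence "real p > 0" using t by linarith
    moreover have "ln t < ln p" using p t by simp
    moreover have "ln p \<le> ln (t\<^sup>2)" using p \<open>real p > 0\<close> by (intro ln_mono) auto
    ultimately show ?thesis using p t by (simp add: l_def ln_realpow)
  qed
  have \<beta>: "of_int (\<beta> (i, p)) * h \<le> ln (x i / p)" "ln (x i / p) < (of_int (\<beta> (i, p)) + 1) * h" for i p
  proof -
    have "of_int (\<beta> (i, p)) \<le> ln (x i / p) / h" "ln (x i / p) / h < of_int (\<beta> (i, p)) + 1"
      unfolding \<beta>_def by (simp_all add: floor_correct)
    thus "of_int (\<beta> (i, p)) * h \<le> ln (x i / p)" "ln (x i / p) < (of_int (\<beta> (i, p)) + 1) * h"
      using h by (simp_all add: field_simps)
  qed
  have bin: "(\<Sum>z\<in>{z\<in>I. \<beta> z = b}. 1 / real (snd z)) \<le> 10 * h / l" if b: "b \<in> \<beta> ` I" for b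
  proof -
    obtain i p where ip: "i < K" "p \<in> G i" "\<beta> (i, p) = b" using b by (auto simp: I_def)
    define z where "z = x i * exp (- (of_int b + 1) * h)"
    have z0: "z > 0" using xpos[OF ip(1)] by (simp add: z_def)
    have lz: "ln z = ln (x i) - (of_int b + 1) * h" using xpos[OF ip(1)] by (simp add: z_def ln_mult algebra_simps)
    have sub: "{z\<in>I. \<beta> z = b} \<subseteq> Pair i ` primes_in z (z * exp h)"
    proof
      fix y assume "y \<in> {z\<in>I. \<beta> z = b}"
      then obtain j q where jq: "y = (j, q)" "j < K" "q \<in> G j" "\<beta> (j, q) = b" by (auto simp: I_def)
      have "\<bar>A - B\<bar> < h" if "of_int b * h \<le> A" "A < (of_int b + 1) * h" "of_int b * h \<le> B" "B < (of_int b + 1) * h"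
        for A B :: real
        using that unfolding distrib_right by (simp add: abs_less_iff)
      from this[OF \<beta>[of i p, unfolded ip(3)] \<beta>[of j q, unfolded jq(4)]]
      have "\<bar>ln (x i / p) - ln (x j / q)\<bar> < h" .
      hence ji: "j = i" using sep[of i j p q] ip jq by auto
      have q0: "q > 0" using pr jq by auto
      have lq: "ln (x i / q) = ln (x i) - ln q" using q0 xpos[OF ip(1)] by (intro ln_divide_pos) auto
      have "ln z < ln q" using \<beta>(2)[of i q] jq ji lq lz by simp
      hence "z < q" using z0 q0 by simp
      moreover have "ln q \<le> ln (z * exp h)" using \<beta>(1)[of i q] jq ji lq lz z0 by (simp add: ln_mult algebra_simps)
      hence "q \<le> z * exp h" using z0 q0 by simp
      moreover have "prime q" using G[OF jq(2)] jq(3) by (auto simp: primes_in_def)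
      ultimately show "y \<in> Pair i ` primes_in z (z * exp h)" using jq ji by (auto simp: primes_in_def)
    qed
    have "(i, p) \<in> {z\<in>I. \<beta> z = b}" using ip by (auto simp: I_def)
    hence "p \<in> primes_in z (z * exp h)" using sub by blast
    hence "real p \<le> z * exp h" by (simp add: primes_in_def)
    hence "ln p \<le> ln (z * exp h)" using pr ip by (intro ln_mono) auto
    hence "ln p \<le> ln z + h" using z0 by (simp add: ln_mult)
    hence lz2: "ln z \<ge> l / 2" using pr[OF ip(1,2)] h l by linarith
    hence "ln z \<ge> 1000 / h" using l by simp
    hence "exp (1000 / h) \<le> exp (ln z)" by (simp only: exp_le_cancel_iff)
    hence z1: "z \<ge> exp (1000 / h)" using z0 by simp
    have "(\<Sum>z\<in>{z\<in>I. \<beta> z = b}. 1 / real (snd z)) \<le> (\<Sum>z\<in>Pair i ` primes_in z (z * exp h). 1 / real (snd z))"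
      by (intro sum_mono2 sub) auto
    also have "\<dots> = recip_sum (primes_in z (z * exp h))"
      by (subst sum.reindex) (auto simp: inj_on_def)
    also have "\<dots> \<le> 5 * h / ln z" by (rule brun_titchmarsh[OF h z1])
    also have "\<dots> \<le> 5 * h / (l / 2)" using lz2 l h by (intro divide_left_mono) auto
    finally show ?thesis by simp
  qed
  define a where "a = (ln N - ln U - 2 * l) / h"
  define c where "c = (ln N - l) / h"
  have cardb: "real (card (\<beta> ` I)) \<le> 4 * l / h"
  proof -
    have "\<beta> ` I \<subseteq> {\<lfloor>a\<rfloor>..\<lfloor>c\<rfloor>}"
    proof
      fix b assume "b \<in> \<beta> ` I"
      then obtain i p where ip: "i < K" "p \<in> G i" "b = \<lfloor>ln (x i / p) / h\<rfloor>" by (auto simp: I_def \<beta>_def)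
      have "ln (x i / p) = ln (x i) - ln p" using pr[OF ip(1,2)] xpos[OF ip(1)] by (simp add: ln_div)
      moreover have "ln (x i) \<le> ln N" using x[OF ip(1)] xpos[OF ip(1)] by (intro ln_mono) auto
      moreover have "ln (N / U) \<le> ln (x i)" using x[OF ip(1)] N U by (intro ln_mono) auto
      hence "ln N - ln U \<le> ln (x i)" using N U by (simp add: ln_div)
      ultimately have "ln N - ln U - 2 * l \<le> ln (x i / p)" "ln (x i / p) \<le> ln N - l"
        using pr[OF ip(1,2)] by linarith+
      thus "b \<in> {\<lfloor>a\<rfloor>..\<lfloor>c\<rfloor>}" using h unfolding ip(3) a_def c_def
        by (auto intro!: floor_mono divide_right_mono)
    qed
    hence "card (\<beta> ` I) \<le> card {\<lfloor>a\<rfloor>..\<lfloor>c\<rfloor>}" by (intro card_mono) auto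
    hence "card (\<beta> ` I) \<le> nat (\<lfloor>c\<rfloor> - \<lfloor>a\<rfloor> + 1)" by simp
    moreover have "c - a = (ln U + l) / h" unfolding a_def c_def diff_divide_distrib[symmetric] by simp
    moreover have "(ln U + l) / h \<le> 2 * l / h" using U h by (intro divide_right_mono) (auto simp: l_def)
    moreover have "2 \<le> 2 * l / h"
    proof -
      have "2 * h \<le> 2 * l" using h l by linarith
      thus ?thesis using h by (simp add: le_divide_eq)
    qed
    moreover have "4 * l / h = 2 * l / h + 2 * l / h" by (simp add: field_simps)
    moreover have "2 * l / h \<ge> 0" using h l by simp
    ultimately show ?thesis by linarith
  qed
  have "(\<Sum>i<K. \<Sum>p\<in>G i. 1 / real p) = (\<Sum>z\<in>I. 1 / real (snd z))"
    unfolding I_def using finG by (subst sum.Sigma) (auto intro!: sum.cong)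
  also have "\<dots> = (\<Sum>b\<in>\<beta> ` I. \<Sum>z\<in>{z\<in>I. \<beta> z = b}. 1 / real (snd z))"
    by (rule sum.image_gen[OF finI])
  also have "\<dots> \<le> (\<Sum>b\<in>\<beta> ` I. 10 * h / l)" by (intro sum_mono bin)
  also have "\<dots> = real (card (\<beta> ` I)) * (10 * h / l)" by simp
  also have "\<dots> \<le> (4 * l / h) * (10 * h / l)" using h l by (intro mult_right_mono cardb) auto
  also have "\<dots> = 40" using h l by simp
  finally show ?thesis .
qed

text \<open>
  The sign \<open>s p\<close> is the factor by which \<open>g\<close> changes when a prime \<open>p > w\<close> is introduced. Exempting the primes up to \<open>w\<close>
  admits signs \<open>g\<close> that also depend on finitely many composite divisors.
\<close>

locale almost_mult =
  fixes g :: "nat \<Rightarrow> real" and s :: "nat \<Rightarrow> real" and w :: nat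
  assumes g_le: "\<And>n. \<bar>g n\<bar> \<le> 1"
    and s_cases: "\<And>p. s p = 1 \<or> s p = -1"
    and g_mult: "\<And>p m. prime p \<Longrightarrow> p > w \<Longrightarrow> m > 0 \<Longrightarrow> \<not> p dvd m \<Longrightarrow> g (p * m) = s p * g m"
begin

text \<open>
  The mean is defined at real points so that \<open>M (N / p)\<close> is an exact multiple of the sum of \<open>g\<close> up to \<open>N div p\<close>.
\<close>

definition M :: "real \<Rightarrow> real" where "M x = (\<Sum>n\<in>{1..nat \<lfloor>x\<rfloor>}. g n) / x"

lemma abs_sum_le: "finite A \<Longrightarrow> \<bar>\<Sum>n\<in>A. g n\<bar> \<le> real (card A)"
  using order_trans[OF sum_abs[of g A] sum_bounded_above[of A "\<lambda>n. \<bar>g n\<bar>" 1]] g_le by simp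

lemma M_lipschitz:
  assumes "0 < y" "y \<le> y'" shows "\<bar>M y' - M y\<bar> \<le> (2 * (y' - y) + 1) / y'"
proof -
  let ?S = "\<lambda>y. \<Sum>n\<in>{1..nat \<lfloor>y\<rfloor>}. g n"
  have y': "y' > 0" using assms by simp
  have le: "nat \<lfloor>y\<rfloor> \<le> nat \<lfloor>y'\<rfloor>" using assms by (intro nat_mono floor_mono)
  have "?S y' - ?S y = (\<Sum>n\<in>{1..nat \<lfloor>y'\<rfloor>} - {1..nat \<lfloor>y\<rfloor>}. g n)" using le by (subst sum_diff) auto
  also have "{1..nat \<lfloor>y'\<rfloor>} - {1..nat \<lfloor>y\<rfloor>} = {nat \<lfloor>y\<rfloor><..nat \<lfloor>y'\<rfloor>}" by auto
  finally have "\<bar>?S y' - ?S y\<bar> \<le> real (nat \<lfloor>y'\<rfloor> - nat \<lfloor>y\<rfloor>)" using abs_sum_le[of "{nat \<lfloor>y\<rfloor><..nat \<lfloor>y'\<rfloor>}"] by simp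
  also have "\<dots> \<le> y' - y + 1" using assms by linarith
  finally have 1: "\<bar>?S y' - ?S y\<bar> \<le> y' - y + 1" .
  have "\<bar>?S y\<bar> \<le> real (nat \<lfloor>y\<rfloor>)" using abs_sum_le[of "{1..nat \<lfloor>y\<rfloor>}"] by simp
  also have "\<dots> \<le> y" using assms by simp
  finally have 2: "\<bar>?S y\<bar> \<le> y" .
  have "M y' - M y = ((?S y' - ?S y) - ?S y / y * (y' - y)) / y'"
    using assms y' by (simp add: M_def field_simps)
  hence "\<bar>M y' - M y\<bar> = \<bar>(?S y' - ?S y) - ?S y / y * (y' - y)\<bar> / y'" using y' by simp
  also have "\<dots> \<le> ((y' - y + 1) + 1 * (y' - y)) / y'"
  proof (intro divide_right_mono)
    have "\<bar>?S y / y * (y' - y)\<bar> \<le> 1 * (y' - y)" unfolding abs_mult using 2 assms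
      by (intro mult_mono) auto
    thus "\<bar>(?S y' - ?S y) - ?S y / y * (y' - y)\<bar> \<le> (y' - y + 1) + 1 * (y' - y)" using 1 by linarith
  qed (use y' in auto)
  also have "(y' - y + 1) + 1 * (y' - y) = 2 * (y' - y) + 1" by simp
  finally show ?thesis .
qed

text \<open>
  By the dual Turan-Kubilius inequality the mean of \<open>g\<close> over the multiples of \<open>p\<close> is close to the overall mean for most
  \<open>p\<close>. On the multiples \<open>g (p * m) = s p * g m\<close> unless \<open>p dvd m\<close>; these exceptions change the quantity to be squared
  by at most \<open>2 / p\<close>, which is harmless since the sum of \<open>1 / p\<^sup>2\<close> converges.
\<close>

lemma M_prime_shift:
  fixes N :: nat
  assumes Q: "finite Q" "\<And>p. p \<in> Q \<Longrightarrow> prime p \<and> p > w" and N: "N \<ge> \<Sum>Q" "N > 0"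
  shows "(\<Sum>p\<in>Q. (1 / real p) * (s p * M (N / p) - M N)^2) \<le> 12"
proof -
  define D where "D = (\<lambda>p::nat. \<Sum>n\<in>{1..N}. g n * (real p * of_bool (p dvd n) - 1))"
  have tk: "(\<Sum>p\<in>Q. (D p)^2 / p) \<le> 2 * real N ^ 2"
    unfolding D_def using Q N by (intro turan_kubilius_dual g_le) auto
  have E: "(1 / real p) * (s p * M (N / p) - M N)^2 \<le> (2 / real N ^ 2) * ((D p)^2 / p) + 8 * (1 / real p ^ 2)"
    if p: "p \<in> Q" for p
  proof -
    have p0: "p \<ge> 2" "prime p" "p > w" using Q(2)[OF p] prime_ge_2_nat by auto
    define K where "K = N div p"
    have K: "nat \<lfloor>real N / real p\<rfloor> = K" unfolding K_def by (simp add: floor_divide_of_nat_eq)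
    have "(\<Sum>n\<in>{1..N}. g n * of_bool (p dvd n)) = (\<Sum>n\<in>{n\<in>{1..N}. p dvd n}. g n)"
      by (subst sum.inter_filter) (auto simp: of_bool_def if_distrib cong: if_cong)
    also have "\<dots> = (\<Sum>m\<in>{1..K}. g (p * m))"
    proof (rule sum.reindex_bij_witness[of _ "\<lambda>m. p * m" "\<lambda>n. n div p"], goal_cases)
      case (2 a) thus ?case using p0 by (auto simp: K_def elim!: dvdE intro!: Nat.gr0I div_le_mono)
    next
      case (4 b)
      thus ?case using p0 by (auto simp: K_def less_eq_div_iff_mult_less_eq mult.commute)
    qed (use p0 in auto)
    finally have Deq: "D p = p * (\<Sum>m\<in>{1..K}. g (p * m)) - (\<Sum>n\<in>{1..N}. g n)"
      by (simp add: D_def right_diff_distrib sum_subtractf mult.left_commute flip: sum_distrib_left)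
    have "\<bar>(\<Sum>m\<in>{1..K}. g (p * m)) - s p * (\<Sum>m\<in>{1..K}. g m)\<bar> \<le> (\<Sum>m\<in>{1..K}. 2 * of_bool (p dvd m))"
      unfolding sum_distrib_left sum_subtractf[symmetric]
    proof (intro order_trans[OF sum_abs] sum_mono)
      fix m assume m: "m \<in> {1..K}"
      show "\<bar>g (p * m) - s p * g m\<bar> \<le> 2 * of_bool (p dvd m)"
      proof (cases "p dvd m")
        case True
        have "\<bar>s p * g m\<bar> \<le> 1" using g_le[of m] s_cases[of p] by auto
        thus ?thesis using g_le[of "p * m"] True by simp
      next
        case False
        thus ?thesis using g_mult[of p m] p0 m by simp
      qed
    qed
    also have "\<dots> = 2 * real (K div p)" using sum_of_bool_dvd[of p K] p0 by (simp flip: sum_distrib_left)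
    also have "\<dots> \<le> 2 * (real N / p / p)"
    proof -
      have "real (K div p) \<le> real K / p" by (rule of_nat_div_le_of_nat)
      also have "\<dots> \<le> (real N / p) / p" unfolding K_def by (intro divide_right_mono of_nat_div_le_of_nat) auto
      finally show ?thesis by simp
    qed
    finally have d: "\<bar>(\<Sum>m\<in>{1..K}. g (p * m)) - s p * (\<Sum>m\<in>{1..K}. g m)\<bar> \<le> 2 * (real N / p / p)" .
    have "(s p * M (N / p) - M N) = D p / N - p / N * ((\<Sum>m\<in>{1..K}. g (p * m)) - s p * (\<Sum>m\<in>{1..K}. g m))"
      using N p0 by (simp add: M_def K Deq field_simps)
    moreover have "\<bar>p / N * ((\<Sum>m\<in>{1..K}. g (p * m)) - s p * (\<Sum>m\<in>{1..K}. g m))\<bar> \<le> p / N * (2 * (real N / p / p))"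
      unfolding abs_mult using d by (intro mult_mono) auto
    moreover have "p / N * (2 * (real N / p / p)) = 2 / real p" using N p0 by simp
    ultimately obtain r where r: "s p * M (N / p) - M N = D p / N - r" "\<bar>r\<bar> \<le> 2 / real p" by metis
    have "r^2 \<le> (2 / real p)^2" using r(2) by (metis abs_ge_zero power2_abs power_mono)
    hence r2: "r^2 \<le> 4 / real p ^ 2" by (simp add: power_divide)
    have "(s p * M (N / p) - M N)^2 \<le> 2 * (D p / N)^2 + 2 * r^2"
      unfolding r(1) using zero_le_power2[of "D p / N + r"] by (simp add: power2_diff power2_sum)
    also have "\<dots> \<le> 2 * (D p / N)^2 + 8 / real p ^ 2" using r2 by simp
    finally have "(1 / real p) * (s p * M (N / p) - M N)^2 \<le> (1 / real p) * (2 * (D p / N)^2 + 8 / real p ^ 2)"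
      by (intro mult_left_mono) auto
    also have "\<dots> = (2 / real N ^ 2) * ((D p)^2 / p) + (1 / real p) * (8 / real p ^ 2)"
      by (simp add: power_divide algebra_simps)
    also have "(1 / real p) * (8 / real p ^ 2) \<le> 1 * (8 / real p ^ 2)" using p0 by (intro mult_right_mono) auto
    finally show ?thesis by simp
  qed
  have "(\<Sum>p\<in>Q. (1 / real p) * (s p * M (N / p) - M N)^2) \<le> (\<Sum>p\<in>Q. (2 / real N ^ 2) * ((D p)^2 / p) + 8 * (1 / real p ^ 2))"
    by (intro sum_mono E)
  also have "\<dots> = (2 / real N ^ 2) * (\<Sum>p\<in>Q. (D p)^2 / p) + 8 * (\<Sum>p\<in>Q. 1 / real p ^ 2)"
    by (simp add: sum.distrib sum_distrib_left)
  also have "\<dots> \<le> (2 / real N ^ 2) * (2 * real N ^ 2) + 8 * 1"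
    using tk Q prime_ge_2_nat by (intro add_mono mult_left_mono sum_inv_squares_le) auto
  also have "\<dots> = 12" using N by simp
  finally show ?thesis .
qed


text \<open>
  The logarithmic distance of \<open>y\<close> and \<open>y'\<close> bounds the relative one, since \<open>1 - y / y' \<le> ln y' - ln y\<close> for \<open>y \<le> y'\<close>.
  The lower bounds on \<open>y\<close> and \<open>y'\<close> control the jump of \<open>M\<close> at an integer.
\<close>

lemma M_close:
  assumes "0 < \<epsilon>" "y \<ge> 12 / \<epsilon>" "y' \<ge> 12 / \<epsilon>" "\<bar>ln y - ln y'\<bar> < \<epsilon> / 12"
  shows "\<bar>M y - M y'\<bar> < \<epsilon> / 3"
proof -
  have *: "\<bar>M y' - M y\<bar> < \<epsilon> / 3" if y: "y \<ge> 12 / \<epsilon>" and le: "y \<le> y'" and l: "ln y' - ln y < \<epsilon> / 12" for y y'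
  proof -
    have y0: "y > 0" using y assms(1) by (smt (verit) divide_pos_pos)
    have "ln (y / y') \<le> y / y' - 1" using y0 le by (intro ln_le_minus_one) auto
    hence "1 - y / y' \<le> \<epsilon> / 12" using y0 le l by (simp add: ln_div)
    moreover have "1 / y' \<le> \<epsilon> / 12"
    proof -
      have "12 / \<epsilon> \<le> y'" using y le by linarith
      thus ?thesis using assms(1) y0 le by (simp add: field_simps)
    qed
    ultimately have "2 * (1 - y / y') + 1 / y' \<le> 2 * (\<epsilon> / 12) + \<epsilon> / 12" by (intro add_mono mult_left_mono) auto
    moreover have "(2 * (y' - y) + 1) / y' = 2 * (1 - y / y') + 1 / y'" using y0 le by (simp add: field_simps)
    ultimately have "\<bar>M y' - M y\<bar> \<le> 2 * (\<epsilon> / 12) + \<epsilon> / 12" using M_lipschitz[OF y0 le] by simp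
    thus ?thesis using assms(1) by simp
  qed
  show ?thesis
  proof (cases "y \<le> y'")
    case True
    have "ln y' - ln y < \<epsilon> / 12" using assms(4) by linarith
    from *[OF assms(2) True this] show ?thesis by (simp add: abs_minus_commute)
  next
    case False
    have "ln y - ln y' < \<epsilon> / 12" using assms(4) by linarith
    from *[OF assms(3) _ this] False show ?thesis by simp
  qed
qed

text \<open>
  By \<open>M_prime_shift\<close> the primes \<open>p\<close> for which \<open>\<bar>M (x i / p)\<bar>\<close> is not close to \<open>\<bar>M (x i)\<bar>\<close> have bounded mass for each
  \<open>i\<close>. Among sufficiently many consecutive ranges \<open>(t, t\<^sup>2]\<close>, each of mass at least \<open>1 / 4\<close>, one contains exceptional
  primes of total mass at most \<open>1 / 8\<close> for all \<open>400\<close> points together. On this range separated values \<open>\<bar>M (x i)\<bar>\<close> give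
  separated values \<open>\<bar>M (x i / p)\<bar>\<close>, so by \<open>M_close\<close> the hypothesis of \<open>sum_inv_primes_separated_le\<close> holds for the
  unexceptional primes. The mass \<open>400 / 8 = 50\<close> exceeds the bound \<open>40\<close>.
\<close>

lemma few_separated_values:
  assumes e: "0 < \<epsilon>" "\<epsilon> \<le> 1" and U: "U \<ge> 1"
  obtains N0 :: nat where "\<And>N x. N \<ge> N0 \<Longrightarrow> (\<And>i::nat. i < 400 \<Longrightarrow> real N / U \<le> real (x i) \<and> x i \<le> N) \<Longrightarrow>
     \<exists>i<400. \<exists>j<400. i \<noteq> j \<and> \<bar>\<bar>M (real (x i))\<bar> - \<bar>M (real (x j))\<bar>\<bar> < \<epsilon>"
proof -
  obtain t0 where t0: "t0 \<ge> 2" "\<And>t. t \<ge> t0 \<Longrightarrow> recip_sum (primes_in t (t^2)) \<ge> 1/4"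
    using sum_inv_prime_square_ge by blast
  \<comment> \<open>short enough for \<open>M_close\<close>\<close>
  define h where "h = \<epsilon> / 12"
  have h: "0 < h" "h \<le> 1" using e by (auto simp: h_def)
  define T where "T = max (max t0 (real w)) (exp (max (2000 / h) (ln U)))"
  have T: "T \<ge> t0" "T \<ge> real w" "T \<ge> exp (max (2000 / h) (ln U))" "T \<ge> 2"
    unfolding T_def using t0(1) by auto
  \<comment> \<open>\<open>R\<close> ranges: a total exceptional mass of \<open>400 * 108 / \<epsilon>\<^sup>2\<close> must leave one range with at most \<open>1 / 8\<close>\<close>
  define R where "R = nat \<lceil>8 * 400 * 108 / \<epsilon>^2\<rceil> + 1"
  have R: "real R > 8 * 400 * 108 / \<epsilon>^2" unfolding R_def by linarith
  define B where "B = (\<lambda>j. primes_in (T^2^j) (T^2^(Suc j)))"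
  define Q where "Q = primes_in T (T^2^R)"
  have mono: "T^2^i \<le> T^2^j" if "i \<le> j" for i j :: nat
    using T that by (intro power_increasing) auto
  have BQ: "B j \<subseteq> Q" if "j < R" for j
    using mono[of 0 j] mono[of "Suc j" R] that by (auto simp: B_def Q_def primes_in_def)
  have Bdisj: "B i \<inter> B j = {}" if "i \<noteq> j" for i j
  proof -
    have "B i \<inter> B j = {}" if "i < j" for i j
      using mono[of "Suc i" j] that by (fastforce simp: B_def primes_in_def)
    thus ?thesis using that by (metis inf_commute linorder_neqE_nat)
  qed
  have Qp: "prime p \<and> p > w" if "p \<in> Q" for p using that T by (auto simp: Q_def primes_in_def)
  \<comment> \<open>large enough for \<open>M_prime_shift\<close> at all points and for \<open>x i / p \<ge> 12 / \<epsilon>\<close>, as \<open>M_close\<close> requires\<close>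
  define N0 where "N0 = nat \<lceil>U * (real (\<Sum>Q) + 1 + 12 / \<epsilon> * T^2^R)\<rceil>"
  show ?thesis
  proof (rule that[of N0], rule ccontr)
    fix N :: nat and x :: "nat \<Rightarrow> nat"
    assume N: "N \<ge> N0" and x: "\<And>i. i < 400 \<Longrightarrow> real N / U \<le> real (x i) \<and> x i \<le> N"
    assume "\<not> (\<exists>i<400. \<exists>j<400. i \<noteq> j \<and> \<bar>\<bar>M (real (x i))\<bar> - \<bar>M (real (x j))\<bar>\<bar> < \<epsilon>)"
    hence far: "\<bar>\<bar>M (real (x i))\<bar> - \<bar>M (real (x j))\<bar>\<bar> \<ge> \<epsilon>" if "i < 400" "j < 400" "i \<noteq> j" for i j
      using that by (meson not_le)
    have "U * (real (\<Sum>Q) + 1 + 12 / \<epsilon> * T^2^R) \<le> real N0" unfolding N0_def by linarith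
    hence "U * (real (\<Sum>Q) + 1 + 12 / \<epsilon> * T^2^R) \<le> real N" using N by linarith
    hence NU: "real (\<Sum>Q) + 1 + 12 / \<epsilon> * T^2^R \<le> real N / U" using U by (simp add: field_simps)
    have pos: "12 / \<epsilon> * T^2^R \<ge> 0" using e T by (intro mult_nonneg_nonneg) auto
    have xge: "real (x i) \<ge> real (\<Sum>Q) + 1 + 12 / \<epsilon> * T^2^R" if "i < 400" for i using NU x[OF that] by linarith
    have xQ: "x i \<ge> \<Sum>Q" "x i > 0" if "i < 400" for i
    proof -
      have "real (x i) \<ge> real (\<Sum>Q)" "real (x i) > 0" using xge[OF that] pos by linarith+
      thus "x i \<ge> \<Sum>Q" "x i > 0" by (simp_all only: of_nat_le_iff of_nat_0_less_iff)
    qed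
    have xp: "real (x i) / p \<ge> 12 / \<epsilon>" if "i < 400" "p \<in> Q" for i p
    proof -
      have p: "real p \<le> T^2^R" "p > 0" using that(2) T by (auto simp: Q_def primes_in_def prime_gt_0_nat)
      have "12 / \<epsilon> * p \<le> 12 / \<epsilon> * T^2^R" using p e by (intro mult_left_mono) auto
      also have "\<dots> \<le> x i" using xge[OF that(1)] by linarith
      finally show ?thesis using p by (simp add: field_simps)
    qed
    define C where "C = (\<lambda>i. {p\<in>Q. \<bar>s p * M (x i / p) - M (x i)\<bar> \<ge> \<epsilon> / 3})"
    have finQ: "finite Q" by (simp add: Q_def)
    have finB: "finite (B j)" for j by (simp add: B_def)
    have finC: "finite (C i)" for i using finQ by (simp add: C_def)
    have massC: "recip_sum (C i) \<le> 108 / \<epsilon>^2" if "i < 400" for i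
    proof -
      have "(\<epsilon>/3)^2 * recip_sum (C i) \<le> (\<Sum>p\<in>C i. (1 / real p) * (s p * M (x i / p) - M (x i))^2)"
        unfolding sum_distrib_left
      proof (intro sum_mono)
        fix p assume p: "p \<in> C i"
        hence "(\<epsilon>/3)^2 \<le> \<bar>s p * M (x i / p) - M (x i)\<bar>^2" using e by (intro power_mono) (auto simp: C_def)
        hence "(\<epsilon>/3)^2 * (1 / real p) \<le> (s p * M (x i / p) - M (x i))^2 * (1 / real p)"
          by (intro mult_right_mono) auto
        thus "(\<epsilon>/3)^2 * (1 / real p) \<le> (1 / real p) * (s p * M (x i / p) - M (x i))^2" by (simp add: mult.commute)
      qed
      also have "\<dots> \<le> (\<Sum>p\<in>Q. (1 / real p) * (s p * M (x i / p) - M (x i))^2)"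
        using finQ by (intro sum_mono2) (auto simp: C_def)
      also have "\<dots> \<le> 12" using finQ Qp xQ[OF that] by (intro M_prime_shift) auto
      finally show ?thesis using e by (simp add: field_simps power2_eq_square)
    qed
    have "\<exists>j<R. (\<Sum>i<400. \<Sum>p\<in>B j \<inter> C i. 1 / real p) \<le> 1/8"
    proof (rule ccontr)
      assume "\<not> (\<exists>j<R. (\<Sum>i<400. \<Sum>p\<in>B j \<inter> C i. 1 / real p) \<le> 1/8)"
      hence a: "(\<Sum>i<400. \<Sum>p\<in>B j \<inter> C i. 1 / real p) > 1/8" if "j < R" for j using that by (meson not_le)
      have "real R * (1/8) = (\<Sum>j<R. 1/8)" by simp
      also have "\<dots> \<le> (\<Sum>j<R. \<Sum>i<400. \<Sum>p\<in>B j \<inter> C i. 1 / real p)" using a by (intro sum_mono) (auto simp: less_imp_le)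
      also have "\<dots> = (\<Sum>i<400. \<Sum>j<R. \<Sum>p\<in>B j \<inter> C i. 1 / real p)" by (rule sum.swap)
      also have "\<dots> \<le> (\<Sum>i<(400::nat). 108 / \<epsilon>^2)"
      proof (intro sum_mono)
        fix i :: nat assume i: "i \<in> {..<400}"
        have "(\<Sum>j<R. \<Sum>p\<in>B j \<inter> C i. 1 / real p) = (\<Sum>p\<in>(\<Union>j<R. B j \<inter> C i). 1 / real p)"
          using finB Bdisj by (subst sum.UNION_disjoint) auto
        also have "\<dots> \<le> recip_sum (C i)" using finC by (intro sum_mono2) auto
        also have "\<dots> \<le> 108 / \<epsilon>^2" using i by (intro massC) auto
        finally show "(\<Sum>j<R. \<Sum>p\<in>B j \<inter> C i. 1 / real p) \<le> 108 / \<epsilon>^2" .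
      qed
      also have "\<dots> = 400 * (108 / \<epsilon>^2)" by simp
      finally show False using R by simp
    qed
    then obtain j where j: "j < R" "(\<Sum>i<400. \<Sum>p\<in>B j \<inter> C i. 1 / real p) \<le> 1/8" by blast
    define t where "t = T^2^j"
    have tT: "t \<ge> T" using mono[of 0 j] by (simp add: t_def)
    have Bt: "B j = primes_in t (t\<^sup>2)" by (simp add: B_def t_def power_mult[symmetric] mult.commute)
    have t1: "t > 0" "t \<ge> t0" using tT T by linarith+
    have "ln t \<ge> ln (exp (max (2000 / h) (ln U)))" using tT T(3) by (intro ln_mono) auto
    hence lt: "ln t \<ge> 2000 / h" "ln U \<le> ln t" by auto
    define G where "G = (\<lambda>i. B j - C i)"
    have massG: "recip_sum (G i) \<ge> 1/8" if "i < 400" for i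
    proof -
      have "recip_sum (B j \<inter> C i) \<le> (\<Sum>i<400. \<Sum>p\<in>B j \<inter> C i. 1 / real p)"
        using that by (intro member_le_sum) (auto intro!: sum_nonneg)
      hence "recip_sum (B j \<inter> C i) \<le> 1/8" using j by linarith
      moreover have "recip_sum (B j) = recip_sum (B j \<inter> C i) + recip_sum (G i)"
        unfolding G_def using finB by (subst sum.Int_Diff[of _ _ "C i"]) auto
      moreover have "recip_sum (B j) \<ge> 1/4" unfolding Bt using t1 by (intro t0(2))
      ultimately show ?thesis by linarith
    qed
    have "400 * (1/8) = (\<Sum>i<(400::nat). 1/8 :: real)" by simp
    also have "\<dots> \<le> (\<Sum>i<400. \<Sum>p\<in>G i. 1 / real p)" using massG by (intro sum_mono) auto
    also have "\<dots> \<le> 40"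
    proof (rule sum_inv_primes_separated_le[where x = "\<lambda>i. real (x i)" and N = "real N" and U = U, OF h t1(1) lt(1) _ lt(2)])
      show "0 < U" using U by simp
      show "0 < real N" using xQ(2)[of 0] x[of 0] by simp
      show "real N / U \<le> real (x i) \<and> real (x i) \<le> real N" if "i < 400" for i using x[OF that] by simp
      show "G i \<subseteq> primes_in t (t\<^sup>2)" for i by (auto simp: G_def Bt)
    next
      fix i i' p q assume i: "i < 400" "i' < 400" and p: "p \<in> G i" and q: "q \<in> G i'"
        and cl: "\<bar>ln (real (x i) / p) - ln (real (x i') / q)\<bar> < h"
      have pQ: "p \<in> Q" "q \<in> Q" using p q BQ[OF j(1)] by (auto simp: G_def)
      have "\<bar>M (x i / p) - M (x i' / q)\<bar> < \<epsilon> / 3"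
        using cl i pQ by (intro M_close e(1) xp) (auto simp: h_def)
      moreover have "\<bar>s p * M (x i / p) - M (x i)\<bar> < \<epsilon> / 3" using p pQ by (auto simp: G_def C_def)
      moreover have "\<bar>s q * M (x i' / q) - M (x i')\<bar> < \<epsilon> / 3" using q pQ by (auto simp: G_def C_def)
      moreover have "\<bar>s p * M (x i / p)\<bar> = \<bar>M (x i / p)\<bar>" using s_cases[of p] by auto
      moreover have "\<bar>s q * M (x i' / q)\<bar> = \<bar>M (x i' / q)\<bar>" using s_cases[of q] by auto
      ultimately have "\<bar>\<bar>M (real (x i))\<bar> - \<bar>M (real (x i'))\<bar>\<bar> < \<epsilon>" by linarith
      thus "i = i'" using far[OF i] by (cases "i = i'") auto
    qed
    finally show False by simp
  qed
qed

text \<open>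
  If \<open>M\<close> dropped from above \<open>3 * \<delta>\<close> at \<open>N\<close> to below \<open>\<delta>\<close> at \<open>N'\<close>, it would come close to \<open>400\<close> equally spaced levels
  in between, because its steps are of size \<open>O(1 / N)\<close>. This contradicts \<open>few_separated_values\<close>.
\<close>

lemma slow_variation:
  assumes d: "0 < \<delta>" "\<delta> \<le> 1" and U: "U \<ge> 1"
  obtains N0 :: nat where "\<And>N N'. N \<ge> N0 \<Longrightarrow> real N / U \<le> real N' \<Longrightarrow> N' \<le> N \<Longrightarrow> M (real N) > 3 * \<delta> \<Longrightarrow> M (real N') \<ge> \<delta>"
proof -
  have e: "0 < \<delta> / 400" "\<delta> / 400 \<le> 1" using d by auto
  show thesis
  proof (rule few_separated_values[OF e U])
  fix N1 :: nat assume N1: "\<And>N x. N \<ge> N1 \<Longrightarrow> (\<And>i::nat. i < 400 \<Longrightarrow> real N / U \<le> real (x i) \<and> x i \<le> N) \<Longrightarrow>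
     \<exists>i<400. \<exists>j<400. i \<noteq> j \<and> \<bar>\<bar>M (real (x i))\<bar> - \<bar>M (real (x j))\<bar>\<bar> < \<delta> / 400"
  \<comment> \<open>the steps of \<open>M\<close> between \<open>N / U\<close> and \<open>N\<close> are at most \<open>3 * U / N\<close>, half the spacing of the levels being \<open>\<delta> / 400\<close>\<close>
  define N0 where "N0 = max N1 (nat \<lceil>1200 * U / \<delta>\<rceil>)"
  show ?thesis
  proof (rule that[of N0], rule ccontr)
    fix N N' :: nat
    assume N: "N \<ge> N0" "real N / U \<le> real N'" "N' \<le> N" "M (real N) > 3 * \<delta>" and "\<not> M (real N') \<ge> \<delta>"
    hence N': "M (real N') < \<delta>" by simp
    have "1200 * U / \<delta> \<le> real N" using N(1) unfolding N0_def by linarith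
    hence "1200 / \<delta> \<le> real N / U" using U by (simp add: field_simps)
    hence N'ge: "1200 / \<delta> \<le> real N'" using N by linarith
    have pos: "1200 / \<delta> > 0" using d by simp
    have N'0: "N' > 0" using N'ge pos by (cases N') auto
    have step: "\<bar>M (real (Suc n)) - M (real n)\<bar> \<le> \<delta> / 400" if n: "n \<ge> N'" for n
    proof -
      have "\<bar>M (real (Suc n)) - M (real n)\<bar> \<le> (2 * (real (Suc n) - real n) + 1) / real (Suc n)"
        using n N'0 by (intro M_lipschitz) auto
      also have "\<dots> = 3 / real (Suc n)" by simp
      also have "\<dots> \<le> 3 / (1200 / \<delta>)" using n N'ge pos by (intro divide_left_mono) auto
      finally show ?thesis by simp
    qed
    have "\<exists>n. N' \<le> n \<and> n \<le> N \<and> \<delta> + real i * \<delta> / 200 \<le> M (real n) \<and> M (real n) \<le> \<delta> + real i * \<delta> / 200 + \<delta> / 400"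
      if i: "i < 400" for i :: nat
    proof -
      define v where "v = \<delta> + real i * \<delta> / 200"
      have "real i * \<delta> \<le> 400 * \<delta>" using i d by (intro mult_right_mono) auto
      hence v: "\<delta> \<le> v" "v \<le> 3 * \<delta>" using d by (auto simp: v_def)
      define n where "n = (LEAST n. N' \<le> n \<and> v \<le> M (real n))"
      have ex: "N' \<le> N \<and> v \<le> M (real N)" using N v by simp
      have n: "N' \<le> n" "v \<le> M (real n)" unfolding n_def using LeastI[of "\<lambda>n. N' \<le> n \<and> v \<le> M (real n)", OF ex] by auto
      have nN: "n \<le> N" unfolding n_def by (rule Least_le[of "\<lambda>n. N' \<le> n \<and> v \<le> M (real n)", OF ex])
      have "n \<noteq> N'" using n(2) N' v by auto
      then obtain m where m: "n = Suc m" "N' \<le> m" using n(1) by (cases n) auto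
      have "\<not> (N' \<le> m \<and> v \<le> M (real m))" using not_less_Least[of m "\<lambda>n. N' \<le> n \<and> v \<le> M (real n)"] m(1) unfolding n_def[symmetric] by auto
      hence "M (real m) < v" using m(2) by auto
      hence "M (real n) \<le> v + \<delta> / 400" using step[OF m(2)] unfolding m(1) by linarith
      thus ?thesis using n nN by (auto simp: v_def)
    qed
    then obtain x where x: "\<And>i::nat. i < 400 \<Longrightarrow> N' \<le> x i \<and> x i \<le> N \<and> \<delta> + real i * \<delta> / 200 \<le> M (real (x i)) \<and> M (real (x i)) \<le> \<delta> + real i * \<delta> / 200 + \<delta> / 400"
      by metis
    have "\<exists>i<400. \<exists>j<400. i \<noteq> j \<and> \<bar>\<bar>M (real (x i))\<bar> - \<bar>M (real (x j))\<bar>\<bar> < \<delta> / 400"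
    proof (rule N1)
      show "N \<ge> N1" using N(1) by (simp add: N0_def)
      fix i :: nat assume "i < 400"
      thus "real N / U \<le> real (x i) \<and> x i \<le> N" using x[of i] N(2) by (meson of_nat_le_iff order_trans)
    qed
    then obtain i j where ij: "i < 400" "j < 400" "i \<noteq> j" "\<bar>\<bar>M (real (x i))\<bar> - \<bar>M (real (x j))\<bar>\<bar> < \<delta> / 400" by blast
    have *: "\<bar>\<bar>M (real (x i))\<bar> - \<bar>M (real (x j))\<bar>\<bar> \<ge> \<delta> / 400" if "i < 400" "j < 400" "i < j" for i j
    proof -
      have "(real i + 1) * \<delta> \<le> real j * \<delta>" using that d by (intro mult_right_mono) auto
      hence "real i * \<delta> + \<delta> \<le> real j * \<delta>" by (simp add: algebra_simps)
      moreover have "real i * \<delta> \<ge> 0" "real j * \<delta> \<ge> 0" using d by auto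
      ultimately show ?thesis using x[OF that(1)] x[OF that(2)] d by linarith
    qed
    show False using *[of i j] *[of j i] ij by linarith
  qed
qed
qed

text \<open>
  If \<open>M N > 3 * \<delta>\<close>, then \<open>M (N / p) \<ge> 0\<close> for the primes \<open>p\<close> of a fixed finite set \<open>Q\<close> by slow variation, so a
  prime with \<open>s p = -1\<close> contributes at least \<open>9 * \<delta>\<^sup>2 / p\<close> to the sum in \<open>M_prime_shift\<close>. This is impossible when
  the sum of \<open>1 / p\<close> over \<open>Q\<close> is large.
\<close>

lemma mean_upper:
  assumes div: "\<And>C::real. \<exists>Q. finite Q \<and> (\<forall>p\<in>Q. prime p \<and> p > w \<and> s p = -1) \<and> recip_sum Q \<ge> C"
    and d: "0 < \<delta>" "\<delta> \<le> 1"
  obtains N0 :: nat where "\<And>N. N \<ge> N0 \<Longrightarrow> M (real N) \<le> 3 * \<delta>"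
proof -
  obtain Q where Q: "finite Q" "\<And>p. p \<in> Q \<Longrightarrow> prime p \<and> p > w \<and> s p = -1" "recip_sum Q \<ge> 12 / \<delta>^2"
    using div[of "12 / \<delta>^2"] by blast
  define U where "U = 2 * real (\<Sum>Q) + 1"
  have U: "U \<ge> 1" by (simp add: U_def sum_nonneg)
  obtain N1 :: nat where N1: "\<And>N N'. N \<ge> N1 \<Longrightarrow> real N / U \<le> real N' \<Longrightarrow> N' \<le> N \<Longrightarrow> M (real N) > 3 * \<delta> \<Longrightarrow> M (real N') \<ge> \<delta>"
    using slow_variation[OF d U] by blast
  show ?thesis
  proof (rule that[of "max N1 (2 * \<Sum>Q + 1)"], rule ccontr)
    fix N :: nat
    assume N: "N \<ge> max N1 (2 * \<Sum>Q + 1)" and "\<not> M (real N) \<le> 3 * \<delta>"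
    hence big: "M (real N) > 3 * \<delta>" by simp
    have N0: "N > 0" "N \<ge> \<Sum>Q" using N by auto
    have sq: "(s p * M (N / p) - M N)^2 \<ge> \<delta>^2 * 9" if p: "p \<in> Q" for p
    proof -
      have p0: "p > 0" "s p = -1" using Q(2)[OF p] by (auto simp: prime_gt_0_nat)
      have pQ: "p \<le> \<Sum>Q" using Q(1) p by (intro member_le_sum) auto
      define K where "K = N div p"
      have K: "nat \<lfloor>real N / real p\<rfloor> = K" unfolding K_def by (simp add: floor_divide_of_nat_eq)
      have "real N / real p - real K \<le> 1" unfolding K_def by (rule real_quotient_minus_div_le_1)
      moreover have "real N / (2 * real p) \<ge> 1" using N pQ p0 by simp
      moreover have "real N / real p = 2 * (real N / (2 * real p))" by simp
      ultimately have "real K \<ge> real N / (2 * real p)" by linarith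
      moreover have "real p \<le> real (\<Sum>Q)" using pQ by (simp only: of_nat_le_iff)
      hence "real N / U \<le> real N / (2 * real p)" using p0 by (intro divide_left_mono) (auto simp: U_def)
      ultimately have "real N / U \<le> real K" by linarith
      hence MK: "M (real K) \<ge> \<delta>" using N big by (intro N1[of N K]) (auto simp: K_def)
      have "K > 0" using \<open>real N / (2 * real p) \<ge> 1\<close> \<open>real K \<ge> real N / (2 * real p)\<close> by (cases K) auto
      have "(\<Sum>n\<in>{1..K}. g n) \<ge> 0"
      proof -
        have "0 \<le> M (real K) * real K" using MK d by auto
        also have "M (real K) * real K = (\<Sum>n\<in>{1..K}. g n)" using \<open>K > 0\<close> by (simp add: M_def)
        finally show ?thesis .
      qed
      hence "M (N / p) \<ge> 0" by (simp add: M_def K)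
      hence "(3 * \<delta>)^2 \<le> (M (N / p) + M N)^2" using big d by (intro power_mono) auto
      also have "\<dots> = (s p * M (N / p) - M N)^2" using p0 by (simp add: power2_eq_square algebra_simps)
      finally show ?thesis by (simp add: power_mult_distrib)
    qed
    have "(12 / \<delta>^2) * (\<delta>^2 * 9) \<le> recip_sum Q * (\<delta>^2 * 9)" using Q(3) by (intro mult_right_mono) auto
    also have "\<dots> \<le> (\<Sum>p\<in>Q. (1 / real p) * (s p * M (N / p) - M N)^2)"
      unfolding sum_distrib_right by (intro sum_mono mult_left_mono sq) auto
    also have "\<dots> \<le> 12" using Q N0 by (intro M_prime_shift) auto
    finally show False using d by simp
  qed
qed

end

text \<open>
  The upper bound of \<open>mean_upper\<close> applies to \<open>g\<close> and to \<open>- g\<close>, which picks up the same signs \<open>s p\<close>.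
\<close>

lemma (in almost_mult) mean_value_zero:
  assumes div: "\<And>C::real. \<exists>Q. finite Q \<and> (\<forall>p\<in>Q. prime p \<and> p > w \<and> s p = -1) \<and> recip_sum Q \<ge> C"
  shows "(\<lambda>N. (\<Sum>n\<in>{1..N}. g n) / real N) \<longlonglongrightarrow> 0"
proof -
  interpret neg: almost_mult "\<lambda>n. - g n" s w
    by unfold_locales (use g_le s_cases g_mult in auto)
  have neg: "neg.M x = - M x" for x by (simp add: M_def neg.M_def sum_negf)
  have M: "(\<Sum>n\<in>{1..N}. g n) / real N = M (real N)" for N by (simp add: M_def)
  show ?thesis unfolding M
  proof (rule LIMSEQ_I)
    fix r :: real assume r: "r > 0"
    define \<delta> where "\<delta> = min 1 (r / 4)"
    have d: "0 < \<delta>" "\<delta> \<le> 1" "3 * \<delta> < r" using r by (auto simp: \<delta>_def min_def)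
    obtain N1 where N1: "\<And>N::nat. N \<ge> N1 \<Longrightarrow> M (real N) \<le> 3 * \<delta>" using mean_upper[OF div d(1,2)] by blast
    obtain N2 where N2: "\<And>N::nat. N \<ge> N2 \<Longrightarrow> neg.M (real N) \<le> 3 * \<delta>" using neg.mean_upper[OF div d(1,2)] by blast
    show "\<exists>no. \<forall>n\<ge>no. norm (M (real n) - 0) < r"
    proof (intro exI[of _ "max N1 N2"] allI impI)
      fix n assume "n \<ge> max N1 N2"
      thus "norm (M (real n) - 0) < r" using N1[of n] N2[of n] d(3) unfolding neg by auto
    qed
  qed
qed

section \<open>Mean values of periodic functions\<close>

definition periodic :: "nat \<Rightarrow> (nat \<Rightarrow> real) \<Rightarrow> bool" where
  "periodic q f \<longleftrightarrow> (\<forall>n. f (n + q) = f n)"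

definition avg :: "nat \<Rightarrow> (nat \<Rightarrow> real) \<Rightarrow> real" where
  "avg q f = (\<Sum>r<q. f r) / real q"

lemma periodic_times: "periodic q f \<Longrightarrow> f (n + q * k) = f n"
proof (induction k)
  case (Suc k)
  have "f (n + q * Suc k) = f ((n + q * k) + q)" by (simp add: algebra_simps)
  thus ?case using Suc by (simp add: periodic_def)
qed simp

lemma periodic_mod: "periodic q f \<Longrightarrow> f (n mod q) = f n"
  using periodic_times[of q f "n mod q" "n div q"] by simp

lemma periodic_dvd: "periodic q f \<Longrightarrow> q dvd q' \<Longrightarrow> periodic q' f"
  by (auto simp: periodic_def elim!: dvdE simp: periodic_times[unfolded periodic_def])

lemma periodic_mult: "periodic q f \<Longrightarrow> periodic r g \<Longrightarrow> periodic (q * r) (\<lambda>n. f n * g n)"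
  using periodic_dvd[of q f "q * r"] periodic_dvd[of r g "q * r"] by (auto simp: periodic_def)

lemma avg_abs_le: assumes "q > 0" "\<And>n. \<bar>f n\<bar> \<le> B" shows "\<bar>avg q f\<bar> \<le> B"
proof -
  have "\<bar>\<Sum>r<q. f r\<bar> \<le> (\<Sum>r<q. B)" by (intro order_trans[OF sum_abs] sum_mono assms)
  thus ?thesis using assms(1) by (simp add: avg_def field_simps)
qed

lemma mean_periodic:
  assumes f: "periodic q f" "\<And>n. \<bar>f n\<bar> \<le> 1" and q: "q > 0"
  shows "\<bar>(\<Sum>n\<in>{1..N}. f n) - real N * avg q f\<bar> \<le> 4 * real q"
proof -
  define k r where "k = N div q" and "r = N mod q"
  have N: "N = k * q + r" "r < q" using q by (simp_all add: k_def r_def)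
  have bl: "(\<Sum>n\<in>{m*q..<m*q+q}. f n) = (\<Sum>n<q. f n)" for m
  proof -
    have "(\<Sum>n\<in>{m*q..<m*q+q}. f n) = (\<Sum>n\<in>{0..<q}. f (n + m * q))"
      using sum.shift_bounds_nat_ivl[of f 0 "m*q" q] by (simp add: add.commute)
    also have "\<dots> = (\<Sum>n<q. f n)" using periodic_times[OF f(1), of _ m]
      by (simp add: atLeast0LessThan mult.commute)
    finally show ?thesis .
  qed
  have full: "(\<Sum>n<k*q. f n) = k * (\<Sum>n<q. f n)"
    unfolding sum.nat_group[symmetric] bl by simp
  have "(\<Sum>n<N. f n) = (\<Sum>n<k*q. f n) + (\<Sum>n\<in>{k*q..<N}. f n)"
    using N sum.atLeastLessThan_concat[of 0 "k*q" N f] by (simp add: atLeast0LessThan)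
  moreover have "\<bar>\<Sum>n\<in>{k*q..<N}. f n\<bar> \<le> (\<Sum>n\<in>{k*q..<N}. 1)" by (intro order_trans[OF sum_abs] sum_mono f)
  moreover have "(\<Sum>n\<in>{k*q..<N}. 1) = real r" using N by simp
  moreover have "real k * (\<Sum>n<q. f n) = real N * avg q f - real r * avg q f"
  proof -
    have "(\<Sum>n<q. f n) = q * avg q f" using q by (simp add: avg_def)
    thus ?thesis using N by (simp add: algebra_simps)
  qed
  moreover have "\<bar>r * avg q f\<bar> \<le> real r * 1" unfolding abs_mult using avg_abs_le[OF q, of f 1] f by (intro mult_mono) auto
  ultimately have a: "\<bar>(\<Sum>n<N. f n) - real N * avg q f\<bar> \<le> 2 * real r" unfolding full by linarith
  have "(\<Sum>n\<in>{1..N}. f n) = (\<Sum>n<N. f n) + f N - f 0"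
    by (induction N) (auto simp: sum.cl_ivl_Suc)
  moreover have "\<bar>f N\<bar> \<le> 1" "\<bar>f 0\<bar> \<le> 1" using f by auto
  moreover have "real r + 1 \<le> real q" using N by linarith
  ultimately show ?thesis using a by linarith
qed

text \<open>
  By the Chinese remainder theorem a full period \<open>q * r\<close> runs through all pairs of residues modulo \<open>q\<close> and \<open>r\<close>.
\<close>

lemma avg_mult_coprime:
  assumes f: "periodic q f" "periodic r g" and qr: "q > 0" "r > 0" "coprime q r"
  shows "avg (q * r) (\<lambda>n. f n * g n) = avg q f * avg r g"
proof -
  let ?h = "\<lambda>n. (n mod q, n mod r)"
  have inj: "inj_on ?h {..<q * r}"
  proof (intro inj_onI)
    fix x y assume xy: "x \<in> {..<q * r}" "y \<in> {..<q * r}" "?h x = ?h y"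
    hence "[x = y] (mod q)" "[x = y] (mod r)" by (auto simp: cong_def)
    hence "[x = y] (mod (q * r))" using qr(3) by (intro coprime_cong_mult_nat) auto
    thus "x = y" using xy by (simp add: cong_def)
  qed
  have "?h ` {..<q * r} \<subseteq> {..<q} \<times> {..<r}" using qr by auto
  hence img: "?h ` {..<q * r} = {..<q} \<times> {..<r}"
    using inj by (intro card_subset_eq) (auto simp: card_image)
  have "(\<Sum>n<q * r. f n * g n) = (\<Sum>n<q * r. (\<lambda>(x, y). f x * g y) (?h n))"
    using f by (simp add: periodic_mod)
  also have "\<dots> = (\<Sum>(x, y)\<in>{..<q} \<times> {..<r}. f x * g y)"
    using sum.reindex[OF inj, of "\<lambda>(x, y). f x * g y"] unfolding img by (simp add: o_def)
  also have "\<dots> = (\<Sum>x<q. f x) * (\<Sum>y<r. g y)" by (simp add: sum_product sum.cartesian_product)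
  finally show ?thesis by (simp add: avg_def)
qed

section \<open>Brun's sieve\<close>

text \<open>
  An expansion of \<open>\<Prod>p\<leftarrow>ps. 1 - g p\<close>, truncated by thresholds \<open>w\<close>. The primes of the list, in descending order, are
  chosen or omitted one after the other, and \<open>i\<close> counts the primes chosen so far. The next prime \<open>p\<close> may be
  chosen freely, with a factor \<open>c * g p\<close>, if \<open>p \<le> w i\<close>; otherwise choosing it ends the expansion with the value
  \<open>d * g p\<close>. A choice that reaches the end of the list contributes the factor \<open>b\<close>. Keeping \<open>b\<close>, \<open>c\<close> and \<open>d\<close> as
  parameters lets the truncated product \<open>brun_main\<close>, the sum \<open>brun_err\<close> over the minimal forbidden sets of
  primes and the count \<open>brun_count\<close> of rounding errors share their mean value computation.
\<close>

primrec brun :: "real \<Rightarrow> real \<Rightarrow> real \<Rightarrow> (nat \<Rightarrow> real) \<Rightarrow> (nat \<Rightarrow> real) \<Rightarrow> nat list \<Rightarrow> nat \<Rightarrow> real" where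
  "brun b c d w g [] i = b"
| "brun b c d w g (p # ps) i = brun b c d w g ps i +
     (if real p \<le> w i then c * g p * brun b c d w g ps (Suc i) else d * g p)"

abbreviation "brun_main \<equiv> brun 1 (-1) 0"
abbreviation "brun_err \<equiv> brun 0 1 1"
abbreviation "brun_count \<equiv> brun 1 1 1"

lemma brun_nonneg: "0 \<le> b \<Longrightarrow> 0 \<le> c \<Longrightarrow> 0 \<le> d \<Longrightarrow> (\<And>p. p \<in> set ps \<Longrightarrow> 0 \<le> g p) \<Longrightarrow> 0 \<le> brun b c d w g ps i"
  by (induction ps arbitrary: i) auto

text \<open>
  Every set of primes that is missing in \<open>brun_main\<close> has a shortest forbidden initial segment in descending order. The
  sets with a common segment add up to the product of \<open>g\<close> over the segment times factors \<open>1 - g p\<close>, which have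
  absolute value at most one.
\<close>

lemma brun_identity:
  assumes "\<And>p. p \<in> set ps \<Longrightarrow> 0 \<le> g p \<and> g p \<le> 2"
  shows "\<bar>(\<Prod>p\<leftarrow>ps. 1 - g p) - brun_main w g ps i\<bar> \<le> brun_err w g ps i"
  using assms
proof (induction ps arbitrary: i)
  case (Cons p ps)
  let ?P = "\<Prod>p\<leftarrow>ps. 1 - g p"
  have g: "0 \<le> g p" "g p \<le> 2" using Cons.prems by auto
  have IH: "\<bar>?P - brun_main w g ps i\<bar> \<le> brun_err w g ps i" for i using Cons by auto
  have P1: "\<bar>?P\<bar> \<le> 1" using Cons.prems
  proof (induction ps)
    case (Cons a ps)
    have "\<bar>1 - g a\<bar> \<le> 1" using Cons.prems[of a] by auto
    moreover have "\<bar>\<Prod>p\<leftarrow>ps. 1 - g p\<bar> \<le> 1" using Cons by auto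
    ultimately have "\<bar>1 - g a\<bar> * \<bar>\<Prod>p\<leftarrow>ps. 1 - g p\<bar> \<le> 1 * 1" by (intro mult_mono) auto
    thus ?case by (simp add: abs_mult)
  qed auto
  show ?case
  proof (cases "real p \<le> w i")
    case True
    have "\<bar>g p * (?P - brun_main w g ps (Suc i))\<bar> \<le> g p * brun_err w g ps (Suc i)"
      unfolding abs_mult using IH[of "Suc i"] g by (simp add: mult_left_mono)
    thus ?thesis using IH[of i] True by (simp add: algebra_simps)
  next
    case False
    have "\<bar>g p * ?P\<bar> \<le> g p * 1" unfolding abs_mult using g P1 by (intro mult_mono) auto
    thus ?thesis using IH[of i] False by (simp add: algebra_simps)
  qed
qed simp

text \<open>
  Over a full period, divisibility conditions for distinct primes are independent, so the mean of each term is the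
  corresponding product of means. The rounding error of a term is at most a constant times its period, the
  product of \<open>q\<close> and the chosen primes; with the factors \<open>2\<close> these add up to \<open>brun_count\<close> with weights \<open>2 * p\<close>.
\<close>

lemma mean_brun:
  assumes bcd: "\<bar>b\<bar> \<le> 1" "\<bar>c\<bar> \<le> 1" "\<bar>d\<bar> \<le> 1"
    and e: "\<And>p n. p \<in> set ps \<Longrightarrow> e p n \<in> {0, 1}" "\<And>p. p \<in> set ps \<Longrightarrow> periodic p (e p)"
    and ps: "distinct ps" "\<And>p. p \<in> set ps \<Longrightarrow> prime p"
    and f: "periodic q f" "\<And>n. \<bar>f n\<bar> \<le> 1" "q > 0" and cop: "\<And>p. p \<in> set ps \<Longrightarrow> coprime q p"
  shows "\<bar>(\<Sum>n\<in>{1..N}. f n * brun b c d w (\<lambda>p. 2 * e p n) ps i) - real N * avg q f * brun b c d w (\<lambda>p. 2 * avg p (e p)) ps i\<bar>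
     \<le> 4 * real q * brun_count w (\<lambda>p. 2 * real p) ps i"
  using e ps f cop
proof (induction ps arbitrary: q f i)
  case Nil
  have "\<bar>(\<Sum>n\<in>{1..N}. f n * b) - real N * avg q f * b\<bar> = \<bar>b\<bar> * \<bar>(\<Sum>n\<in>{1..N}. f n) - real N * avg q f\<bar>"
    unfolding abs_mult[symmetric] sum_distrib_right[symmetric] by (simp add: algebra_simps)
  also have "\<dots> \<le> 1 * (4 * real q)" using bcd Nil by (intro mult_mono mean_periodic) auto
  finally show ?case by simp
next
  case (Cons p ps)
  have p: "prime p" "p > 0" "coprime q p" using Cons.prems(4,8) prime_gt_0_nat by auto
  let ?f = "\<lambda>n. f n * e p n"
  have per: "periodic (q * p) ?f" using Cons.prems by (intro periodic_mult) auto
  have avg: "avg (q * p) ?f = avg q f * avg p (e p)" using Cons.prems p by (intro avg_mult_coprime) auto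
  have le: "\<bar>?f n\<bar> \<le> 1" for n using Cons.prems(1)[of p n] Cons.prems(6)[of n] by auto
  let ?V = "\<lambda>n. brun b c d w (\<lambda>p. 2 * e p n) ps" and ?W = "brun b c d w (\<lambda>p. 2 * avg p (e p)) ps"
  let ?R = "brun_count w (\<lambda>p. 2 * real p) ps"
  have cp: "coprime (q * p) p'" if "p' \<in> set ps" for p'
  proof -
    have "p \<noteq> p'" "prime p'" "coprime q p'" using that Cons.prems by auto
    thus ?thesis using p primes_coprime[of p p'] by simp
  qed
  have IH1: "\<bar>(\<Sum>n\<in>{1..N}. f n * ?V n i) - real N * avg q f * ?W i\<bar> \<le> 4 * real q * ?R i"
    using Cons.prems by (intro Cons.IH) auto
  have tri: "\<bar>(S1 + k * S2) - (M1 + k * M2)\<bar> \<le> E1 + E2" if "\<bar>S1 - M1\<bar> \<le> E1" "\<bar>k * (S2 - M2)\<bar> \<le> E2"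
    for S1 S2 M1 M2 E1 E2 k :: real using that unfolding right_diff_distrib by linarith
  show ?case
  proof (cases "real p \<le> w i")
    case True
    have IH2: "\<bar>(\<Sum>n\<in>{1..N}. ?f n * ?V n (Suc i)) - real N * avg (q * p) ?f * ?W (Suc i)\<bar> \<le> 4 * real (q * p) * ?R (Suc i)"
      using Cons.prems p by (intro Cons.IH per le cp) auto
    have e1: "(\<Sum>n\<in>{1..N}. f n * brun b c d w (\<lambda>p. 2 * e p n) (p # ps) i) = (\<Sum>n\<in>{1..N}. f n * ?V n i) + 2 * c * (\<Sum>n\<in>{1..N}. ?f n * ?V n (Suc i))"
      unfolding sum_distrib_left sum.distrib[symmetric] using True by (intro sum.cong refl) (simp add: algebra_simps)
    have e2: "real N * avg q f * brun b c d w (\<lambda>p. 2 * avg p (e p)) (p # ps) i = real N * avg q f * ?W i + 2 * c * (real N * avg (q * p) ?f * ?W (Suc i))"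
      unfolding avg using True by (simp add: algebra_simps)
    have e3: "\<bar>2 * c * ((\<Sum>n\<in>{1..N}. ?f n * ?V n (Suc i)) - real N * avg (q * p) ?f * ?W (Suc i))\<bar> \<le> (2 * 1) * (4 * real (q * p) * ?R (Suc i))"
      unfolding abs_mult using IH2 bcd by (intro mult_mono) (auto simp: abs_mult)
    have e4: "4 * real q * brun_count w (\<lambda>p. 2 * real p) (p # ps) i = 4 * real q * ?R i + (2 * 1) * (4 * real (q * p) * ?R (Suc i))"
      using True by (simp add: algebra_simps)
    show ?thesis unfolding e1 e2 e4 by (rule tri[OF IH1 e3])
  next
    case False
    have m: "\<bar>(\<Sum>n\<in>{1..N}. ?f n) - real N * avg (q * p) ?f\<bar> \<le> 4 * real (q * p)"
      using Cons.prems p by (intro mean_periodic per le) auto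
    have e1: "(\<Sum>n\<in>{1..N}. f n * brun b c d w (\<lambda>p. 2 * e p n) (p # ps) i) = (\<Sum>n\<in>{1..N}. f n * ?V n i) + 2 * d * (\<Sum>n\<in>{1..N}. ?f n)"
      unfolding sum_distrib_left sum.distrib[symmetric] using False by (intro sum.cong refl) (simp add: algebra_simps)
    have e2: "real N * avg q f * brun b c d w (\<lambda>p. 2 * avg p (e p)) (p # ps) i = real N * avg q f * ?W i + 2 * d * (real N * avg (q * p) ?f)"
      unfolding avg using False by (simp add: algebra_simps)
    have e3: "\<bar>2 * d * ((\<Sum>n\<in>{1..N}. ?f n) - real N * avg (q * p) ?f)\<bar> \<le> (2 * 1) * (4 * real (q * p))"
      unfolding abs_mult using m bcd by (intro mult_mono) (auto simp: abs_mult)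
    have e4: "4 * real q * brun_count w (\<lambda>p. 2 * real p) (p # ps) i = 4 * real q * ?R i + (2 * 1) * (4 * real (q * p))"
      using False by (simp add: algebra_simps)
    show ?thesis unfolding e1 e2 e4 by (rule tri[OF IH1 e3])
  qed
qed

text \<open>
  The prime chosen in position \<open>j\<close> is at most \<open>w j\<close>, so the sum over all choices is at most a product over the
  positions. The factor \<open>Y\<close> accounts for a final prime above its threshold.
\<close>

lemma brun_count_le:
  fixes w :: "nat \<Rightarrow> real"
  defines "X \<equiv> \<lambda>ps j. 1 + (\<Sum>p\<leftarrow>filter (\<lambda>p. real p \<le> w j) ps. 2 * real p)"
  defines "Y \<equiv> \<lambda>ps. 1 + (\<Sum>p\<leftarrow>ps. 2 * real p)"
  assumes "i + length ps \<le> J"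
  shows "brun_count w (\<lambda>p. 2 * real p) ps i \<le> Y ps * (\<Prod>j\<in>{i..<J}. X ps j)"
  using assms(3)
proof (induction ps arbitrary: i)
  case Nil
  thus ?case by (simp add: X_def Y_def)
next
  case (Cons p ps)
  let ?R = "brun_count w (\<lambda>p. 2 * real p)"
  have iJ: "i < J" using Cons.prems by simp
  have X1: "X ps j \<ge> 1" for ps j unfolding X_def by (auto intro!: sum_list_nonneg)
  have Y1: "Y ps \<ge> 1" for ps unfolding Y_def by (auto intro!: sum_list_nonneg)
  have Xm: "X ps j \<le> X (p # ps) j" for j by (simp add: X_def)
  have Ym: "Y (p # ps) = Y ps + 2 * real p" by (simp add: Y_def)
  define PP where "PP = (\<Prod>j\<in>{Suc i..<J}. X ps j)"
  have P1: "PP \<ge> 1" unfolding PP_def by (intro prod_ge_1) (use X1 in auto)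
  have Pm: "PP \<le> (\<Prod>j\<in>{Suc i..<J}. X (p # ps) j)" unfolding PP_def
    by (intro prod_mono) (use X1 Xm in \<open>auto intro: order_trans[of 0 1]\<close>)
  have split: "(\<Prod>j\<in>{i..<J}. X ps' j) = X ps' i * (\<Prod>j\<in>{Suc i..<J}. X ps' j)" for ps'
    using iJ by (simp add: prod.atLeast_Suc_lessThan)
  have IH1: "?R ps i \<le> Y ps * (X ps i * PP)" using Cons.IH[of i] Cons.prems by (simp add: split PP_def)
  have IH2: "?R ps (Suc i) \<le> Y ps * PP" using Cons.IH[of "Suc i"] Cons.prems by (simp add: PP_def)
  have goal: "Y (p # ps) * (X (p # ps) i * PP) \<le> Y (p # ps) * (\<Prod>j\<in>{i..<J}. X (p # ps) j)"
    unfolding split using Pm X1[of "p # ps" i] Y1[of "p # ps"] by (intro mult_left_mono) auto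
  show ?case
  proof (cases "real p \<le> w i")
    case True
    have "?R (p # ps) i \<le> Y ps * (X ps i * PP) + 2 * real p * (Y ps * PP)"
      using True IH1 mult_left_mono[OF IH2, of "2 * real p"] by simp
    also have "\<dots> = Y ps * (X (p # ps) i * PP)" using True by (simp add: X_def algebra_simps)
    also have "\<dots> \<le> Y (p # ps) * (X (p # ps) i * PP)" unfolding Ym using X1[of "p # ps" i] P1
      by (intro mult_right_mono) auto
    finally show ?thesis using goal by linarith
  next
    case False
    have "1 * 1 \<le> X ps i * PP" using X1[of ps i] P1 by (intro mult_mono) auto
    hence "2 * real p * 1 \<le> 2 * real p * (X ps i * PP)" by (intro mult_left_mono) auto
    hence "?R (p # ps) i \<le> Y ps * (X ps i * PP) + 2 * real p * (X ps i * PP)"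
      using False IH1 by simp
    also have "\<dots> = Y (p # ps) * (X (p # ps) i * PP)" using False by (simp add: X_def Y_def algebra_simps)
    finally show ?thesis using goal by linarith
  qed
qed

lemma power_div_fact_step:
  fixes x g :: real assumes "x \<ge> 0" "g \<ge> 0"
  shows "x ^ Suc m / fact (Suc m) + g * (x ^ m / fact m) \<le> (x + g) ^ Suc m / fact (Suc m)"
proof -
  have a: "x ^ Suc m + real (Suc m) * g * x ^ m \<le> (x + g) ^ Suc m" for m
  proof (induction m)
    case (Suc m)
    have "x ^ Suc (Suc m) + real (Suc (Suc m)) * g * x ^ Suc m \<le> (x + g) * (x ^ Suc m + real (Suc m) * g * x ^ m)"
      using assms by (simp add: algebra_simps)
    also have "\<dots> \<le> (x + g) * (x + g) ^ Suc m" using assms by (intro mult_left_mono Suc.IH) auto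
    finally show ?case by simp
  qed (auto simp: algebra_simps)
  have h: "x ^ m / fact m = real (Suc m) * x ^ m / fact (Suc m)"
    unfolding fact_Suc by (simp del: of_nat_Suc)
  have "x ^ Suc m / fact (Suc m) + g * (x ^ m / fact m) = (x ^ Suc m + real (Suc m) * g * x ^ m) / fact (Suc m)"
    unfolding h by (simp add: add_divide_distrib mult_ac del: fact_Suc of_nat_Suc)
  also have "\<dots> \<le> (x + g) ^ Suc m / fact (Suc m)" using a[of m] by (intro divide_right_mono) auto
  finally show ?thesis .
qed

text \<open>
  When the positions are counted from \<open>i\<close>, a minimal forbidden set with its last element in position \<open>j\<close> consists of
  \<open>j - i + 1\<close> primes, and all of them exceed \<open>w j\<close> because the list is descending. The sets of
  \<open>m\<close> such primes contribute at most the \<open>m\<close>-th power of \<open>\<sigma>\<close> divided by \<open>fact m\<close>.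
\<close>

lemma brun_err_le:
  fixes w :: "nat \<Rightarrow> real" and g :: "nat \<Rightarrow> real"
  defines "\<sigma> \<equiv> \<lambda>ps j. \<Sum>p\<leftarrow>filter (\<lambda>p. w j < real p) ps. g p"
  assumes w: "antimono w" and g: "\<And>p. p \<in> set ps \<Longrightarrow> g p \<ge> 0" and ps: "sorted_wrt (>) ps"
    and J: "i + length ps \<le> J"
  shows "brun_err w g ps i \<le> (\<Sum>j\<in>{i..<J}. \<sigma> ps j ^ Suc (j - i) / fact (Suc (j - i)))"
  using g ps J
proof (induction ps arbitrary: i)
  case Nil
  thus ?case by (simp add: \<sigma>_def)
next
  case (Cons p ps)
  have iJ: "i < J" using Cons.prems by simp
  have gp: "g p \<ge> 0" using Cons.prems by simp
  have s0: "\<sigma> ps j \<ge> 0" for j unfolding \<sigma>_def using Cons.prems by (intro sum_list_nonneg) auto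
  have IH1: "brun_err w g ps i \<le> (\<Sum>j\<in>{i..<J}. \<sigma> ps j ^ Suc (j - i) / fact (Suc (j - i)))"
    using Cons by auto
  have split: "{i..<J} = insert i {Suc i..<J}" using iJ by auto
  show ?case
  proof (cases "real p \<le> w i")
    case True
    have IH2: "brun_err w g ps (Suc i) \<le> (\<Sum>j\<in>{Suc i..<J}. \<sigma> ps j ^ (j - i) / fact (j - i))"
    proof -
      have "brun_err w g ps (Suc i) \<le> (\<Sum>j\<in>{Suc i..<J}. \<sigma> ps j ^ Suc (j - Suc i) / fact (Suc (j - Suc i)))"
        using Cons.prems by (intro Cons.IH) auto
      also have "\<dots> = (\<Sum>j\<in>{Suc i..<J}. \<sigma> ps j ^ (j - i) / fact (j - i))"
        by (intro sum.cong refl) (auto simp: Suc_diff_Suc simp del: fact_Suc power_Suc)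
      finally show ?thesis .
    qed
    have "brun_err w g (p # ps) i \<le> (\<Sum>j\<in>{i..<J}. \<sigma> ps j ^ Suc (j - i) / fact (Suc (j - i)))
        + g p * (\<Sum>j\<in>{Suc i..<J}. \<sigma> ps j ^ (j - i) / fact (j - i))"
      using True IH1 mult_left_mono[OF IH2 gp] by simp
    also have "\<dots> = \<sigma> ps i ^ Suc (i - i) / fact (Suc (i - i)) + (\<Sum>j\<in>{Suc i..<J}. \<sigma> ps j ^ Suc (j - i) / fact (Suc (j - i)) + g p * (\<sigma> ps j ^ (j - i) / fact (j - i)))"
      unfolding split by (subst sum.insert) (auto simp: sum.distrib sum_distrib_left)
    also have "\<dots> \<le> \<sigma> (p # ps) i ^ Suc (i - i) / fact (Suc (i - i)) + (\<Sum>j\<in>{Suc i..<J}. \<sigma> (p # ps) j ^ Suc (j - i) / fact (Suc (j - i)))"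
    proof (intro add_mono sum_mono)
      show "\<sigma> ps i ^ Suc (i - i) / fact (Suc (i - i)) \<le> \<sigma> (p # ps) i ^ Suc (i - i) / fact (Suc (i - i))"
        using gp by (simp add: \<sigma>_def)
    next
      fix j assume j: "j \<in> {Suc i..<J}"
      show "\<sigma> ps j ^ Suc (j - i) / fact (Suc (j - i)) + g p * (\<sigma> ps j ^ (j - i) / fact (j - i)) \<le> \<sigma> (p # ps) j ^ Suc (j - i) / fact (Suc (j - i))"
      proof (cases "real p \<le> w j")
        case True
        hence "\<not> w j < real q" if "q \<in> set ps" for q using Cons.prems(2) that by fastforce
        hence "\<sigma> ps j = 0" "\<sigma> (p # ps) j = 0" using True by (auto simp: \<sigma>_def filter_empty_conv[THEN iffD2])
        thus ?thesis using j by (simp add: power_0_left)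
      next
        case False
        hence "\<sigma> (p # ps) j = \<sigma> ps j + g p" by (simp add: \<sigma>_def)
        thus ?thesis using power_div_fact_step[OF s0 gp, of j "j - i"] by simp
      qed
    qed
    also have "\<dots> = (\<Sum>j\<in>{i..<J}. \<sigma> (p # ps) j ^ Suc (j - i) / fact (Suc (j - i)))"
      unfolding split by (subst sum.insert) auto
    finally show ?thesis .
  next
    case False
    have "brun_err w g (p # ps) i \<le> (\<Sum>j\<in>{i..<J}. \<sigma> ps j ^ Suc (j - i) / fact (Suc (j - i))) + g p"
      using False IH1 by simp
    also have "\<dots> = (\<sigma> ps i + g p) + (\<Sum>j\<in>{Suc i..<J}. \<sigma> ps j ^ Suc (j - i) / fact (Suc (j - i)))"
      unfolding split by (subst sum.insert) auto
    also have "\<dots> \<le> \<sigma> (p # ps) i + (\<Sum>j\<in>{Suc i..<J}. \<sigma> (p # ps) j ^ Suc (j - i) / fact (Suc (j - i)))"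
    proof (intro add_mono sum_mono divide_right_mono power_mono s0)
      show "\<sigma> ps i + g p \<le> \<sigma> (p # ps) i" using False by (simp add: \<sigma>_def)
      show "\<sigma> ps j \<le> \<sigma> (p # ps) j" for j using gp by (simp add: \<sigma>_def)
    qed auto
    also have "\<dots> = (\<Sum>j\<in>{i..<J}. \<sigma> (p # ps) j ^ Suc (j - i) / fact (Suc (j - i)))"
      unfolding split by (subst sum.insert) auto
    finally show ?thesis .
  qed
qed


lemma power_div_fact_le:
  fixes x :: real assumes "x \<ge> 0" "n > 0"
  shows "x ^ n / fact n \<le> (exp 1 * x / n) ^ n"
proof -
  have "(real n) ^ n / fact n \<le> exp (real n)"
  proof -
    have "(\<Sum>k\<in>{n}. inverse (fact k) * real n ^ k) \<le> (\<Sum>k. inverse (fact k) * real n ^ k)"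
      by (intro sum_le_suminf summable_exp) auto
    thus ?thesis by (simp add: exp_def divide_inverse mult.commute)
  qed
  also have "exp (real n) = exp 1 ^ n" by (simp add: exp_of_nat_mult[symmetric])
  finally have "(real n) ^ n \<le> exp 1 ^ n * fact n" by (simp add: pos_divide_le_eq)
  hence "x ^ n * (real n) ^ n \<le> x ^ n * (exp 1 ^ n * fact n)" using assms by (intro mult_left_mono) auto
  thus ?thesis using assms by (simp add: power_divide power_mult_distrib field_simps)
qed

lemma antimono_powr_power:
  fixes z \<theta> :: real
  assumes "z \<ge> 1" "0 < \<theta>" "\<theta> \<le> 1" shows "antimono (\<lambda>j. z powr (\<theta> ^ (j - L)))"
proof (intro antimonoI powr_mono)
  fix i j :: nat assume "i \<le> j"
  thus "\<theta> ^ (j - L) \<le> \<theta> ^ (i - L)" using assms by (intro power_decreasing) auto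
qed (use assms in auto)

lemma sum_truncated_geometric_le:
  assumes "0 < \<theta>" "\<theta> < 1" shows "(\<Sum>j<J. \<theta> ^ (j - L)) \<le> real L + 1 / (1 - \<theta> :: real)"
proof -
  have "(\<Sum>j<J. \<theta> ^ (j - L)) \<le> (\<Sum>j<L + J. \<theta> ^ (j - L))"
    using assms by (intro sum_mono2) auto
  also have "{..<L + J} = {..<L} \<union> {L..<L + J}" by auto
  also have "(\<Sum>j\<in>\<dots>. \<theta> ^ (j - L)) = (\<Sum>j<L. \<theta> ^ (j - L)) + (\<Sum>j\<in>{L..<L + J}. \<theta> ^ (j - L))"
    by (intro sum.union_disjoint) auto
  also have "(\<Sum>j<L. \<theta> ^ (j - L)) = L" by simp
  also have "(\<Sum>j\<in>{L..<L + J}. \<theta> ^ (j - L)) = (\<Sum>j<J. \<theta> ^ j)"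
    using sum.shift_bounds_nat_ivl[of "\<lambda>j. \<theta> ^ (j - L)" 0 L J] by (simp add: atLeast0LessThan add.commute)
  also have "\<dots> \<le> 1 / (1 - \<theta>)" using assms by (subst sum_gp_strict) (auto intro!: divide_right_mono)
  finally show ?thesis by simp
qed

text \<open>
  Each factor in \<open>brun_count_le\<close> is at most the fourth power of its threshold, also when the threshold is below \<open>2\<close> and
  no prime meets it. The exponents \<open>\<theta> ^ (j - L)\<close> form a geometric series after \<open>L\<close> initial terms equal to one.
\<close>

lemma brun_count_numeric:
  fixes z \<theta> :: real
  assumes z: "z \<ge> 2" and th: "0 < \<theta>" "\<theta> < 1" and ps: "distinct ps" "\<And>p. p \<in> set ps \<Longrightarrow> prime p \<and> real p \<le> z"
  shows "brun_count (\<lambda>j. z powr (\<theta> ^ (j - L))) (\<lambda>p. 2 * real p) ps 0 \<le> z powr (4 * (real L + 1 / (1 - \<theta>) + 1))"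
proof -
  define w where "w = (\<lambda>j. z powr (\<theta> ^ (j - L)))"
  have w1: "w j \<ge> 1" for j unfolding w_def using z th by (intro ge_one_powr_ge_zero) auto
  have X: "1 + (\<Sum>p\<leftarrow>filter (\<lambda>p. real p \<le> y) ps. 2 * real p) \<le> y ^ 4" if y: "y \<ge> 1" for y
  proof (cases "y < 2")
    case True
    have "filter (\<lambda>p. real p \<le> y) ps = []" using ps(2) prime_ge_2_nat True
      by (auto simp: filter_empty_conv not_le intro!: less_le_trans[OF True])
    thus ?thesis using y by (simp only: list.map sum_list.Nil) simp
  next
    case False
    have "(\<Sum>p\<leftarrow>filter (\<lambda>p. real p \<le> y) ps. 2 * real p) = (\<Sum>p\<in>set (filter (\<lambda>p. real p \<le> y) ps). 2 * real p)"
      using ps(1) by (intro sum_list_distinct_conv_sum_set) auto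
    also have "\<dots> \<le> (\<Sum>p\<in>{1..nat \<lfloor>y\<rfloor>}. 2 * y)"
    proof (rule order_trans)
      show "(\<Sum>p\<in>set (filter (\<lambda>p. real p \<le> y) ps). 2 * real p) \<le> (\<Sum>p\<in>set (filter (\<lambda>p. real p \<le> y) ps). 2 * y)"
        by (intro sum_mono) auto
      show "(\<Sum>p\<in>set (filter (\<lambda>p. real p \<le> y) ps). 2 * y) \<le> (\<Sum>p\<in>{1..nat \<lfloor>y\<rfloor>}. 2 * y)"
      proof (intro sum_mono2)
        show "set (filter (\<lambda>p. real p \<le> y) ps) \<subseteq> {1..nat \<lfloor>y\<rfloor>}"
          using ps(2) prime_gt_0_nat by (force simp: le_nat_floor Suc_le_eq)
      qed (use y in auto)
    qed
    also have "\<dots> = real (nat \<lfloor>y\<rfloor>) * (2 * y)" by simp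
    also have "\<dots> \<le> y * (2 * y)" using y by (intro mult_right_mono) auto
    finally have "1 + (\<Sum>p\<leftarrow>filter (\<lambda>p. real p \<le> y) ps. 2 * real p) \<le> 1 + 2 * y^2" by (simp add: power2_eq_square)
    also have "\<dots> \<le> y ^ 4"
    proof -
      have "y^2 \<ge> 2^2" using False by (intro power_mono) auto
      hence h4: "4 \<le> y^2" by simp
      have "4 * y^2 \<le> y^2 * y^2" by (intro mult_right_mono h4) auto
      moreover note h4
      moreover have "y ^ 4 = y^2 * y^2" by (simp add: power2_eq_square eval_nat_numeral)
      ultimately show ?thesis by linarith
    qed
    finally show ?thesis .
  qed
  have Xz: "1 + (\<Sum>p\<leftarrow>ps. 2 * real p) \<le> z ^ 4"
  proof -
    have "filter (\<lambda>p. real p \<le> z) ps = ps" using ps(2) by (auto simp: filter_id_conv)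
    thus ?thesis using X[of z] z by simp
  qed
  define J where "J = length ps"
  have "brun_count w (\<lambda>p. 2 * real p) ps 0 \<le> (1 + (\<Sum>p\<leftarrow>ps. 2 * real p)) * (\<Prod>j\<in>{0..<J}. 1 + (\<Sum>p\<leftarrow>filter (\<lambda>p. real p \<le> w j) ps. 2 * real p))"
    by (intro brun_count_le) (simp add: J_def)
  also have "\<dots> \<le> z ^ 4 * (\<Prod>j\<in>{0..<J}. w j ^ 4)"
  proof (intro mult_mono Xz prod_mono prod_nonneg conjI X w1)
    show "0 \<le> 1 + (\<Sum>p\<leftarrow>filter (\<lambda>p. real p \<le> w j) ps. 2 * real p)" for j
      by (intro add_nonneg_nonneg sum_list_nonneg) auto
    thus "0 \<le> 1 + (\<Sum>p\<leftarrow>filter (\<lambda>p. real p \<le> w j) ps. 2 * real p)" for j .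
  qed (use z in auto)
  also have "\<dots> = z powr 4 * z powr (\<Sum>j\<in>{0..<J}. 4 * \<theta> ^ (j - L))"
  proof -
    have "w j ^ 4 = z powr (4 * \<theta> ^ (j - L))" for j
      using z by (simp add: w_def powr_realpow[symmetric] powr_powr mult.commute del: powr_numeral)
    moreover have "z ^ 4 = z powr 4" using z by (simp add: powr_numeral)
    ultimately show ?thesis using z by (simp add: powr_sum)
  qed
  also have "\<dots> = z powr (4 + 4 * (\<Sum>j<J. \<theta> ^ (j - L)))"
    by (simp add: powr_add sum_distrib_left atLeast0LessThan)
  also have "\<dots> \<le> z powr (4 + 4 * (real L + 1 / (1 - \<theta>)))"
    using z sum_truncated_geometric_le[OF th, where J = J and L = L] by (intro powr_mono) auto
  finally show ?thesis by (simp add: w_def algebra_simps)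
qed

text \<open>
  Let \<open>\<tau> = - ln \<theta>\<close>. By \<open>sum_inv_prime_le\<close> the sum of \<open>g\<close> over the primes above the threshold in position \<open>j > L\<close> is at most
  \<open>A * (1 + (j - L) * \<tau>)\<close>, and there are none for \<open>j \<le> L\<close>. With \<open>L\<close> large and \<open>\<tau>\<close> small compared with \<open>A\<close>, this sum is at
  most \<open>(j + 1) / (2 * exp 1)\<close>, so that the term of \<open>brun_err_le\<close> is at most \<open>(1/2) ^ (j + 1)\<close>.
\<close>

lemma brun_err_numeric:
  fixes z A \<theta> :: real and g :: "nat \<Rightarrow> real"
  assumes z: "z \<ge> 2" and A: "A > 0" and L: "real L \<ge> 4 * exp 1 * A" and th: "\<theta> = exp (- 1 / (4 * exp 1 * A))"
    and ps: "sorted_wrt (>) ps" "\<And>p. p \<in> set ps \<Longrightarrow> prime p \<and> real p \<le> z"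
    and g: "\<And>p. p \<in> set ps \<Longrightarrow> 0 \<le> g p \<and> g p \<le> A / 43 * (1 / real p)"
  shows "brun_err (\<lambda>j. z powr (\<theta> ^ (j - L))) g ps 0 \<le> (1/2) ^ L"
proof -
  define \<tau> where "\<tau> = 1 / (4 * exp 1 * A)"
  have t0: "\<tau> > 0" using A by (simp add: \<tau>_def)
  have th': "\<theta> = exp (- \<tau>)" by (simp add: th \<tau>_def)
  have th01: "0 < \<theta>" "\<theta> < 1" using t0 by (auto simp: th')
  define w where "w = (\<lambda>j. z powr (\<theta> ^ (j - L)))"
  define \<sigma> where "\<sigma> = (\<lambda>j. \<Sum>p\<leftarrow>filter (\<lambda>p. w j < real p) ps. g p)"
  have am: "antimono w" unfolding w_def using z th01 by (intro antimono_powr_power) auto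
  have s0: "\<sigma> j \<ge> 0" for j unfolding \<sigma>_def using g by (intro sum_list_nonneg) auto
  have sL: "\<sigma> j = 0" if "j \<le> L" for j
  proof -
    have "filter (\<lambda>p. w j < real p) ps = []" using ps(2) that z by (auto simp: filter_empty_conv w_def not_less)
    thus ?thesis unfolding \<sigma>_def by (simp only: list.map sum_list.Nil)
  qed
  have dist: "distinct ps" using ps(1) by (induction ps) auto
  have s: "\<sigma> j \<le> A * (1 + (real j - real L) * \<tau>)" if j: "j > L" for j
  proof -
    have w1: "w j > 1" unfolding w_def using z th01 by (intro gr_one_powr) auto
    have wz: "w j \<le> z" using z th01 powr_mono[of "\<theta> ^ (j - L)" 1 z] by (simp add: w_def power_le_one)
    have "\<sigma> j = (\<Sum>p\<in>set (filter (\<lambda>p. w j < real p) ps). g p)" unfolding \<sigma>_def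
      using dist by (intro sum_list_distinct_conv_sum_set) auto
    also have "\<dots> \<le> (\<Sum>p\<in>set (filter (\<lambda>p. w j < real p) ps). A / 43 * (1 / real p))"
      using g by (intro sum_mono) auto
    also have "\<dots> \<le> (\<Sum>p\<in>primes_in (w j) z. A / 43 * (1 / real p))"
      using ps(2) A by (intro sum_mono2 finite_primes_in) (auto simp: primes_in_def)
    also have "\<dots> = A / 43 * recip_sum (primes_in (w j) z)" by (simp only: sum_distrib_left)
    also have "\<dots> \<le> A / 43 * (43 * (1 + ln (ln z / ln (w j))))"
      using A by (intro mult_left_mono sum_inv_prime_le[OF w1 wz]) auto
    also have "ln z / ln (w j) = exp (\<tau> * real (j - L))"
    proof -
      have "ln (w j) = \<theta> ^ (j - L) * ln z" using z by (simp add: w_def ln_powr)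
      moreover have "\<theta> ^ (j - L) = exp (- (\<tau> * real (j - L)))"
        unfolding th' by (simp add: exp_of_nat_mult[symmetric] mult.commute)
      ultimately have "ln z = ln (w j) * exp (\<tau> * real (j - L))" by (simp add: exp_minus)
      moreover have "ln (w j) > 0" using w1 by simp
      ultimately show ?thesis by simp
    qed
    also have "A / 43 * (43 * X) = A * X" for X by simp
    finally show ?thesis using j by (simp add: of_nat_diff mult.commute)
  qed
  have summand_le: "\<sigma> j ^ Suc (j - 0) / fact (Suc (j - 0)) \<le> (if j \<le> L then 0 else (1/2) ^ Suc j)" for j
  proof (cases "j \<le> L")
    case True
    thus ?thesis using sL by simp
  next
    case False
    hence j: "j > L" by simp
    have "\<sigma> j ^ Suc j / fact (Suc j) \<le> (exp 1 * \<sigma> j / real (Suc j)) ^ Suc j"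
      using s0 by (intro power_div_fact_le) auto
    also have "\<dots> \<le> (1/2) ^ Suc j"
    proof (intro power_mono)
      have "exp 1 * \<sigma> j \<le> exp 1 * (A * (1 + (real j - real L) * \<tau>))" using s[OF j] by (intro mult_left_mono) auto
      also have "\<dots> = exp 1 * A + (real j - real L) * (exp 1 * A * \<tau>)" by (simp add: algebra_simps)
      also have "exp 1 * A * \<tau> = 1/4" using A by (simp add: \<tau>_def)
      also have "exp 1 * A + (real j - real L) * (1/4) \<le> 1/2 * real (Suc j)"
      proof -
        have "a + (x - l) * (1/4) \<le> 1/2 * (x + 1)" if "4 * a \<le> l" "l < x" "0 \<le> l" for a x l :: real using that by (simp add: field_simps)
        from this[of "exp 1 * A" "real L" "real j"] show ?thesis using L j by simp
      qed
      finally show "exp 1 * \<sigma> j / real (Suc j) \<le> 1/2" by (simp add: pos_divide_le_eq)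
    qed (use s0 in auto)
    finally show ?thesis using False by simp
  qed
  define J where "J = length ps"
  have "brun_err w g ps 0 \<le> (\<Sum>j\<in>{0..<J}. \<sigma> j ^ Suc (j - 0) / fact (Suc (j - 0)))"
    unfolding \<sigma>_def using g ps by (intro brun_err_le am) (auto simp: J_def)
  also have "\<dots> \<le> (\<Sum>j\<in>{0..<J}. if j \<le> L then 0 else (1/2) ^ Suc j)" by (intro sum_mono summand_le)
  also have "\<dots> \<le> (\<Sum>j\<in>{0..<J + L + 1}. if j \<le> L then 0 else (1/2) ^ Suc j)" by (intro sum_mono2) auto
  also have "\<dots> = (\<Sum>j\<in>{L+1..<J + L + 1}. (1/2) ^ Suc j)" by (intro sum.mono_neutral_cong_right) auto
  also have "\<dots> = (\<Sum>j\<in>{0..<J}. (1/2) ^ Suc (j + (L + 1)))"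
    using sum.shift_bounds_nat_ivl[of "\<lambda>j. (1/2::real) ^ Suc j" 0 "L+1" J] by (simp add: add.commute add.left_commute)
  also have "\<dots> = (1/2) ^ (L + 2) * (\<Sum>j<J. (1/2) ^ j)" by (simp add: sum_distrib_left power_add atLeast0LessThan mult_ac)
  also have "\<dots> \<le> (1/2) ^ (L + 2) * 2" by (intro mult_left_mono) (auto simp: sum_gp_strict)
  also have "\<dots> \<le> (1/2) ^ L" by simp
  finally show ?thesis by (simp add: w_def)
qed

text \<open>
  A fundamental lemma for the sifting factors \<open>1 - 2 * e p n\<close>: they are independent of a periodic \<open>f\<close> up to the relative
  size \<open>\<delta>\<close>, at the cost of a rounding error that is a power of \<open>z\<close> with an exponent depending on \<open>k\<close> and \<open>\<delta>\<close> only.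
  The product is replaced by \<open>brun_main\<close> at the cost of \<open>brun_err\<close>. The mean of \<open>brun_main\<close> is bounded by
  \<open>1 + \<delta>\<close>, because \<open>brun_identity\<close> applies to the means as well: they satisfy \<open>0 \<le> 2 * avg p (e p) \<le> 2\<close>.
\<close>

lemma brun_correlation_bound:
  fixes \<delta> :: real and k :: nat
  assumes k: "k > 0" and d: "\<delta> > 0"
  obtains D :: real where "D > 0" "\<And>z U e q f N. z \<ge> 2 \<Longrightarrow> finite U \<Longrightarrow> (\<And>p. p \<in> U \<Longrightarrow> prime p \<and> real p \<le> z)
    \<Longrightarrow> (\<And>p n. p \<in> U \<Longrightarrow> e p n \<in> {0, 1}) \<Longrightarrow> (\<And>p. p \<in> U \<Longrightarrow> periodic p (e p))
    \<Longrightarrow> (\<And>p. p \<in> U \<Longrightarrow> avg p (e p) \<le> real k / real p)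
    \<Longrightarrow> q > 0 \<Longrightarrow> periodic q f \<Longrightarrow> (\<And>n. \<bar>f n\<bar> \<le> 1) \<Longrightarrow> (\<And>p. p \<in> U \<Longrightarrow> coprime q p)
    \<Longrightarrow> \<bar>\<Sum>n\<in>{1..N}. f n * (\<Prod>p\<in>U. 1 - 2 * e p n)\<bar> \<le> real N * (\<bar>avg q f\<bar> * (1 + \<delta>) + \<delta>) + 8 * real q * z powr D"
proof -
  \<comment> \<open>\<open>A / 43 = 2 * k\<close>, where \<open>43\<close> is the constant of \<open>sum_inv_prime_le\<close>\<close>
  define A where "A = 86 * real k"
  have A: "A > 0" using k by (simp add: A_def)
  define \<theta> where "\<theta> = exp (- 1 / (4 * exp 1 * A))"
  have th: "0 < \<theta>" "\<theta> < 1" using A by (auto simp: \<theta>_def)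
  obtain L1 where L1: "(1/2::real) ^ L1 < \<delta>" using real_arch_pow_inv[OF d, of "1/2"] by auto
  define L where "L = max L1 (nat \<lceil>4 * exp 1 * A\<rceil>)"
  have L: "real L \<ge> 4 * exp 1 * A" unfolding L_def by linarith
  have "(1/2::real) ^ L \<le> (1/2) ^ L1" unfolding L_def by (intro power_decreasing) auto
  hence Ld: "(1/2::real) ^ L \<le> \<delta>" using L1 by linarith
  define D where "D = 4 * (real L + 1 / (1 - \<theta>) + 1)"
  have D: "D > 0" using th unfolding D_def by (intro mult_pos_pos add_nonneg_pos) auto
  show ?thesis
  proof (rule that[OF D])
    fix z U e q f N
    assume z: "z \<ge> 2" and U: "finite U" "\<And>p. p \<in> U \<Longrightarrow> prime p \<and> real p \<le> z"
      and e: "\<And>p n. p \<in> U \<Longrightarrow> e p n \<in> {0, 1}" "\<And>p. p \<in> U \<Longrightarrow> periodic p (e p)"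
      and av: "\<And>p. p \<in> U \<Longrightarrow> avg p (e p) \<le> real k / real p"
      and q: "q > 0" "periodic q f" "\<And>n. \<bar>f n\<bar> \<le> 1" "\<And>p. p \<in> U \<Longrightarrow> coprime q p"
    define w where "w = (\<lambda>j. z powr (\<theta> ^ (j - L)))"
    define ps where "ps = rev (sorted_list_of_set U)"
    have ps: "set ps = U" "distinct ps" "sorted_wrt (>) ps"
      using U(1) strict_sorted_list_of_set[of U] by (auto simp: ps_def sorted_wrt_rev)
    have prod: "(\<Prod>p\<in>U. h p) = (\<Prod>p\<leftarrow>ps. h p)" for h :: "nat \<Rightarrow> real"
      using ps prod.distinct_set_conv_list[of ps h] by simp
    have a0: "0 \<le> avg p (e p)" "avg p (e p) \<le> 1" if "p \<in> U" for p
    proof -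
      have r: "0 \<le> e p n \<and> e p n \<le> 1" for n using e(1)[OF that, of n] by auto
      show "0 \<le> avg p (e p)" unfolding avg_def using r by (intro divide_nonneg_nonneg sum_nonneg) auto
      have "\<bar>avg p (e p)\<bar> \<le> 1" using U(2)[OF that] r by (intro avg_abs_le) (auto simp: prime_gt_0_nat abs_le_iff intro: order_trans[of _ 0])
      thus "avg p (e p) \<le> 1" by simp
    qed
    let ?F = "\<lambda>n. \<Prod>p\<leftarrow>ps. 1 - 2 * e p n"
    let ?R = "brun_count w (\<lambda>p. 2 * real p) ps 0"
    have R: "?R \<le> z powr D" unfolding w_def D_def using z th ps U by (intro brun_count_numeric) auto
    have E: "brun_err w (\<lambda>p. 2 * avg p (e p)) ps 0 \<le> \<delta>"
    proof -
      have "brun_err w (\<lambda>p. 2 * avg p (e p)) ps 0 \<le> (1/2) ^ L" unfolding w_def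
      proof (rule brun_err_numeric[OF z A L \<theta>_def ps(3)])
        fix p assume "p \<in> set ps"
        hence p: "p \<in> U" using ps by simp
        show "prime p \<and> real p \<le> z" using U(2)[OF p] .
        show "0 \<le> 2 * avg p (e p) \<and> 2 * avg p (e p) \<le> A / 43 * (1 / real p)"
          using a0[OF p] av[OF p] by (simp add: A_def)
      qed
      thus ?thesis using Ld by linarith
    qed
    have E0: "0 \<le> brun_err w (\<lambda>p. 2 * avg p (e p)) ps 0" using ps a0 by (intro brun_nonneg) auto
    have B: "\<bar>brun_main w (\<lambda>p. 2 * avg p (e p)) ps 0\<bar> \<le> 1 + \<delta>"
    proof -
      have "\<bar>(\<Prod>p\<leftarrow>ps. 1 - 2 * avg p (e p)) - brun_main w (\<lambda>p. 2 * avg p (e p)) ps 0\<bar> \<le> brun_err w (\<lambda>p. 2 * avg p (e p)) ps 0"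
        using ps a0 by (intro brun_identity) auto
      moreover have "\<bar>\<Prod>p\<leftarrow>ps. 1 - 2 * avg p (e p)\<bar> \<le> 1"
      proof -
        have "\<bar>\<Prod>p\<in>U. 1 - 2 * avg p (e p)\<bar> = (\<Prod>p\<in>U. \<bar>1 - 2 * avg p (e p)\<bar>)" by (rule abs_prod)
        also have "\<dots> \<le> 1" by (intro prod_le_1) (use a0 in \<open>auto simp: abs_le_iff\<close>)
        finally show ?thesis by (simp add: prod)
      qed
      ultimately show ?thesis using E by linarith
    qed
    have m1: "\<bar>(\<Sum>n\<in>{1..N}. f n * brun_main w (\<lambda>p. 2 * e p n) ps 0) - real N * avg q f * brun_main w (\<lambda>p. 2 * avg p (e p)) ps 0\<bar> \<le> 4 * real q * ?R"
      using e U q ps by (intro mean_brun) auto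
    have m2: "\<bar>(\<Sum>n\<in>{1..N}. 1 * brun_err w (\<lambda>p. 2 * e p n) ps 0) - real N * avg 1 (\<lambda>_. 1) * brun_err w (\<lambda>p. 2 * avg p (e p)) ps 0\<bar> \<le> 4 * real 1 * ?R"
      using e U ps by (intro mean_brun) (auto simp: periodic_def)
    have R0: "?R \<ge> 0" by (intro brun_nonneg) auto
    have "\<bar>\<Sum>n\<in>{1..N}. f n * ?F n\<bar> \<le> \<bar>\<Sum>n\<in>{1..N}. f n * brun_main w (\<lambda>p. 2 * e p n) ps 0\<bar> + (\<Sum>n\<in>{1..N}. brun_err w (\<lambda>p. 2 * e p n) ps 0)"
    proof -
      have "(\<Sum>n\<in>{1..N}. f n * ?F n) = (\<Sum>n\<in>{1..N}. f n * brun_main w (\<lambda>p. 2 * e p n) ps 0) + (\<Sum>n\<in>{1..N}. f n * (?F n - brun_main w (\<lambda>p. 2 * e p n) ps 0))"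
        unfolding sum.distrib[symmetric] by (intro sum.cong refl) (simp add: algebra_simps)
      moreover have "\<bar>\<Sum>n\<in>{1..N}. f n * (?F n - brun_main w (\<lambda>p. 2 * e p n) ps 0)\<bar> \<le> (\<Sum>n\<in>{1..N}. brun_err w (\<lambda>p. 2 * e p n) ps 0)"
      proof (intro order_trans[OF sum_abs] sum_mono)
        fix n
        have r: "0 \<le> e p n \<and> e p n \<le> 1" if "p \<in> set ps" for p using e(1)[of p n] that ps by auto
        have "\<bar>f n * (?F n - brun_main w (\<lambda>p. 2 * e p n) ps 0)\<bar> \<le> 1 * brun_err w (\<lambda>p. 2 * e p n) ps 0"
          unfolding abs_mult using q(3) r by (intro mult_mono brun_identity) auto
        thus "\<bar>f n * (?F n - brun_main w (\<lambda>p. 2 * e p n) ps 0)\<bar> \<le> brun_err w (\<lambda>p. 2 * e p n) ps 0" by simp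
      qed
      ultimately show ?thesis by linarith
    qed
    also have "\<bar>\<Sum>n\<in>{1..N}. f n * brun_main w (\<lambda>p. 2 * e p n) ps 0\<bar> \<le> real N * (\<bar>avg q f\<bar> * (1 + \<delta>)) + 4 * real q * ?R"
    proof -
      have "\<bar>real N * avg q f * brun_main w (\<lambda>p. 2 * avg p (e p)) ps 0\<bar> \<le> real N * \<bar>avg q f\<bar> * (1 + \<delta>)"
        unfolding abs_mult using B by (simp add: mult_left_mono)
      thus ?thesis using m1 unfolding mult.assoc by linarith
    qed
    also have "(\<Sum>n\<in>{1..N}. brun_err w (\<lambda>p. 2 * e p n) ps 0) \<le> real N * \<delta> + 4 * real q * ?R"
    proof -
      have "real N * brun_err w (\<lambda>p. 2 * avg p (e p)) ps 0 \<le> real N * \<delta>" using E by (intro mult_left_mono) auto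
      moreover have "4 * ?R \<le> 4 * real q * ?R" using R0 q(1) by (intro mult_right_mono) auto
      ultimately show ?thesis using m2 by (simp add: avg_def)
    qed
    also have "real N * (\<bar>avg q f\<bar> * (1 + \<delta>)) + 4 * real q * ?R + (real N * \<delta> + 4 * real q * ?R) = real N * (\<bar>avg q f\<bar> * (1 + \<delta>) + \<delta>) + 8 * real q * ?R"
      by (simp add: algebra_simps)
    also have "8 * real q * ?R \<le> 8 * real q * z powr D" using R by (intro mult_left_mono) auto
    finally show "\<bar>\<Sum>n\<in>{1..N}. f n * (\<Prod>p\<in>U. 1 - 2 * e p n)\<bar> \<le> real N * (\<bar>avg q f\<bar> * (1 + \<delta>) + \<delta>) + 8 * real q * z powr D"
      unfolding prod by simp
  qed
qed

section \<open>Sets of primes of relative density zero\<close>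

text \<open>
  Primes above \<open>sqrt t\<close> have weight at least \<open>ln t / 2\<close> in \<open>psi t\<close>, and the others number at most \<open>sqrt t\<close>.
\<close>

lemma card_primes_le:
  assumes "t > 1" shows "real (card {p. prime p \<and> real p \<le> t}) \<le> 10 * t / ln t"
proof -
  have lt: "ln t > 0" using assms by simp
  have fin: "finite {p. prime p \<and> real p \<le> t}"
    by (rule finite_subset[of _ "{..nat \<lfloor>t\<rfloor>}"]) (auto simp: le_nat_floor)
  have "{p. prime p \<and> real p \<le> t} \<subseteq> {1..nat \<lfloor>sqrt t\<rfloor>} \<union> primes_in (sqrt t) t"
  proof
    fix p assume "p \<in> {p. prime p \<and> real p \<le> t}"
    thus "p \<in> {1..nat \<lfloor>sqrt t\<rfloor>} \<union> primes_in (sqrt t) t" using prime_gt_0_nat[of p]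
      by (cases "real p \<le> sqrt t") (auto simp: primes_in_def le_nat_floor Suc_le_eq)
  qed
  hence "real (card {p. prime p \<and> real p \<le> t}) \<le> real (card ({1..nat \<lfloor>sqrt t\<rfloor>} \<union> primes_in (sqrt t) t))"
    by (intro of_nat_mono card_mono) auto
  also have "\<dots> \<le> real (nat \<lfloor>sqrt t\<rfloor>) + real (card (primes_in (sqrt t) t))"
    using card_Un_le[of "{1..nat \<lfloor>sqrt t\<rfloor>}" "primes_in (sqrt t) t"] by simp
  also have "real (nat \<lfloor>sqrt t\<rfloor>) \<le> 2 * t / ln t"
  proof -
    have "ln t * sqrt t \<le> (2 * sqrt t) * sqrt t" using assms by (intro mult_right_mono ln_le_2_sqrt) auto
    also have "\<dots> = 2 * t" using assms by simp
    finally have "sqrt t \<le> 2 * t / ln t" using lt by (simp add: field_simps)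
    moreover have "real (nat \<lfloor>sqrt t\<rfloor>) \<le> sqrt t" using assms by simp
    ultimately show ?thesis by linarith
  qed
  also have "real (card (primes_in (sqrt t) t)) \<le> 8 * t / ln t"
  proof -
    have "ln t / 2 * real (card (primes_in (sqrt t) t)) = (\<Sum>p\<in>primes_in (sqrt t) t. ln (sqrt t))" using assms by (simp add: ln_sqrt)
    also have "\<dots> \<le> (\<Sum>p\<in>primes_in (sqrt t) t. Lam p)"
    proof (intro sum_mono)
      fix p assume "p \<in> primes_in (sqrt t) t"
      hence "prime p" "sqrt t < p" by (auto simp: primes_in_def)
      thus "ln (sqrt t) \<le> Lam p" using assms by (simp del: ln_le_cancel_iff) (intro ln_mono, auto)
    qed
    also have "\<dots> \<le> psi t" unfolding psi_def using prime_gt_0_nat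
      by (intro sum_mono2) (auto simp: primes_in_def le_nat_floor Suc_le_eq mangoldt_nonneg)
    also have "\<dots> \<le> 4 * t" using assms by (intro psi_le) auto
    finally show ?thesis using lt by (simp add: field_simps)
  qed
  finally show ?thesis by (simp add: field_simps)
qed

text \<open>
  Cut the range into dyadic blocks. By the density hypothesis and Chebyshev's bound each block has mass at most a small
  multiple of \<open>1 / (\<epsilon> * ln N)\<close>, and there are \<open>O(ln N)\<close> blocks.
\<close>

lemma zero_density_sum_inv:
  assumes P: "\<And>p. p \<in> P \<Longrightarrow> prime p" and dens: "has_relative_density P 0"
    and eps: "0 < \<epsilon>" and A: "A \<ge> 1" and eta: "\<eta> > 0"
  obtains N0 :: nat where "\<And>N. N \<ge> N0 \<Longrightarrow> recip_sum (P \<inter> primes_in (real N powr \<epsilon>) (A * real N)) \<le> \<eta>"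
proof -
  \<comment> \<open>at most \<open>6 * ln N\<close> blocks of mass at most \<open>20 * \<eta>2 / (\<epsilon> * ln N)\<close> each\<close>
  define \<eta>2 where "\<eta>2 = \<eta> * \<epsilon> / 120"
  have e2: "\<eta>2 > 0" using eps eta by (simp add: \<eta>2_def)
  have "\<forall>\<^sub>F x in at_top. \<bar>real (card (P \<inter> pos_upto x)) / real (card ({p. prime p} \<inter> pos_upto x))\<bar> < \<eta>2"
    using tendstoD[OF dens[unfolded has_relative_density_def] e2] by simp
  then obtain t1 where t1: "\<And>x. x \<ge> t1 \<Longrightarrow> \<bar>real (card (P \<inter> pos_upto x)) / real (card ({p. prime p} \<inter> pos_upto x))\<bar> < \<eta>2"
    by (auto simp: eventually_at_top_linorder)
  have cnt: "real (card (P \<inter> {p. real p \<le> t})) \<le> \<eta>2 * (10 * t / ln t)" if t: "t \<ge> t1" "t \<ge> 2" for t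
  proof -
    have 1: "P \<inter> pos_upto t = P \<inter> {p. real p \<le> t}" using P prime_gt_0_nat by (auto simp: pos_upto_def Suc_le_eq)
    have 2: "{p. prime p} \<inter> pos_upto t = {p. prime p \<and> real p \<le> t}" using prime_gt_0_nat by (auto simp: pos_upto_def Suc_le_eq)
    have fin: "finite {p. prime p \<and> real p \<le> t}"
      by (rule finite_subset[of _ "{..nat \<lfloor>t\<rfloor>}"]) (auto simp: le_nat_floor)
    have "2 \<in> {p::nat. prime p \<and> real p \<le> t}" using t by simp
    hence pos: "card {p. prime p \<and> real p \<le> t} > 0" using fin card_gt_0_iff by blast
    have "real (card (P \<inter> {p. real p \<le> t})) \<le> \<eta>2 * real (card {p. prime p \<and> real p \<le> t})"
      using t1[OF t(1)] pos unfolding 1 2 by (simp add: field_simps)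
    also have "\<dots> \<le> \<eta>2 * (10 * t / ln t)" using e2 t by (intro mult_left_mono card_primes_le) auto
    finally show ?thesis .
  qed
  have "\<forall>\<^sub>F N::nat in sequentially. real N powr \<epsilon> \<ge> max t1 2 \<and> real N \<ge> max 2 (4 * A)"
    using eps by (intro eventually_conj) (real_asymp | simp add: eventually_ge_at_top filterlim_at_top)+
  then obtain N0 :: nat where N0: "\<And>N. N \<ge> N0 \<Longrightarrow> real N powr \<epsilon> \<ge> max t1 2 \<and> real N \<ge> max 2 (4 * A)"
    by (auto simp: eventually_sequentially)
  show ?thesis
  proof (rule that[of N0])
    fix N assume "N \<ge> N0"
    note N = N0[OF this]
    define z where "z = real N powr \<epsilon>"
    have z: "z \<ge> t1" "z \<ge> 2" using N by (auto simp: z_def)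
    have N2: "real N \<ge> 2" "real N \<ge> 4 * A" using N by auto
    have lz: "ln z = \<epsilon> * ln N" using N2 by (simp add: z_def ln_powr)
    have lN: "ln N > 0" using N2 by simp
    define B where "B = (\<lambda>j. P \<inter> primes_in (2^j * z) (2^(Suc j) * z))"
    have finB: "finite (B j)" for j by (simp add: B_def)
    have Bdisj: "B i \<inter> B j = {}" if "i \<noteq> j" for i j
    proof -
      have "B i \<inter> B j = {}" if "i < j" for i j
      proof -
        have "2^(Suc i) * z \<le> 2^j * z" using that z by (intro mult_right_mono power_increasing) auto
        thus ?thesis by (auto simp: B_def primes_in_def)
      qed
      thus ?thesis using that by (metis inf_commute linorder_neqE_nat)
    qed
    define J where "J = nat \<lceil>log 2 (A * N)\<rceil>"
    have AN: "A * N \<ge> 2" using A N2 mult_mono[of 1 A 2 "real N"] by simp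
    have "log 2 (A * N) \<ge> 0" using AN by simp
    hence J: "real J \<le> log 2 (A * N) + 1" "log 2 (A * N) \<le> real J" unfolding J_def by linarith+
    have Jl: "real J \<le> 6 * ln N"
    proof -
      have "A * real N \<le> real N * real N" using A N2 by (intro mult_right_mono) auto
      hence "ln (A * N) \<le> ln (real N * N)" using AN by (intro ln_mono) auto
      also have "\<dots> = 2 * ln N" using N2 by (simp add: ln_mult)
      finally have l: "ln (A * N) \<le> 2 * ln N" .
      have l2: "ln 2 \<ge> (2/3::real)" by (rule ln2_ge_two_thirds)
      have "log 2 (A * N) = ln (A * N) / ln 2" by (simp add: log_def)
      also have "\<dots> \<le> (2 * ln N) / (2/3)" using l l2 lN by (intro frac_le) auto
      finally have "log 2 (A * N) \<le> 3 * ln N" by simp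
      moreover have "ln 2 \<le> ln N" using N2 by simp
      ultimately show ?thesis using J l2 by linarith
    qed
    have cov: "P \<inter> primes_in z (A * N) \<subseteq> (\<Union>j<J. B j)"
    proof
      fix p assume p: "p \<in> P \<inter> primes_in z (A * N)"
      define j where "j = (LEAST j. real p \<le> 2^(Suc j) * z)"
      have pz: "z < p" "real p \<le> A * N" using p by (auto simp: primes_in_def)
      have "A * N = 2 powr (log 2 (A * N))" using AN by simp
      also have "\<dots> \<le> 2 powr J" using J by (intro powr_mono) auto
      also have "\<dots> = 2 ^ J" by (simp add: powr_realpow)
      finally have AJ: "A * N \<le> 2 ^ J" .
      have J0: "J > 0" using AJ AN by (cases J) auto
      have "2 ^ J * 1 \<le> 2 ^ J * z" using z by (intro mult_left_mono) auto
      hence "real p \<le> 2 ^ J * z" using pz(2) AJ by linarith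
      hence ex: "real p \<le> 2^(Suc (J - 1)) * z" using J0 by simp
      have j1: "real p \<le> 2^(Suc j) * z" unfolding j_def by (rule LeastI[of "\<lambda>j. real p \<le> 2^(Suc j) * z", OF ex])
      have j2: "j \<le> J - 1" unfolding j_def by (rule Least_le[of "\<lambda>j. real p \<le> 2^(Suc j) * z", OF ex])
      have "2^j * z < p"
      proof (cases j)
        case (Suc i)
        have "\<not> real p \<le> 2^(Suc i) * z" using not_less_Least[of i "\<lambda>j. real p \<le> 2^(Suc j) * z"] Suc unfolding j_def by auto
        thus ?thesis using Suc by simp
      qed (use pz in simp)
      hence "p \<in> B j" using p j1 by (auto simp: B_def primes_in_def)
      thus "p \<in> (\<Union>j<J. B j)" using j2 J0 by auto
    qed
    have bl: "recip_sum (B j) \<le> 20 * \<eta>2 / (\<epsilon> * ln N)" for j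
    proof -
      define t where "t = 2^(Suc j) * z"
      have "1 * z \<le> 2^(Suc j) * z" using z by (intro mult_right_mono one_le_power) auto
      hence t: "t \<ge> z" by (simp add: t_def)
      have "recip_sum (B j) \<le> (\<Sum>p\<in>B j. 1 / (2^j * z))"
        using z by (intro sum_mono divide_left_mono) (auto simp: B_def primes_in_def intro!: mult_pos_pos less_le_trans[of 0 2 z])
      also have "\<dots> = real (card (B j)) * (1 / (2^j * z))" by simp
      finally have b1: "recip_sum (B j) \<le> real (card (B j)) * (1 / (2^j * z))" .
      have "real (card (B j)) \<le> real (card (P \<inter> {p. real p \<le> t}))"
      proof (intro of_nat_mono card_mono)
        show "finite (P \<inter> {p. real p \<le> t})" by (rule finite_subset[of _ "{..nat \<lfloor>t\<rfloor>}"]) (auto simp: le_nat_floor)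
      qed (auto simp: B_def primes_in_def t_def)
      also have "\<dots> \<le> \<eta>2 * (10 * t / ln t)" using t z by (intro cnt) auto
      also have "\<dots> \<le> \<eta>2 * (10 * t / ln z)" using t z e2 by (intro mult_left_mono divide_left_mono ln_mono) auto
      finally have "real (card (B j)) * (1 / (2^j * z)) \<le> \<eta>2 * (10 * t / ln z) * (1 / (2^j * z))"
        using z by (intro mult_right_mono) auto
      also have "\<eta>2 * (10 * t / ln z) * (1 / (2^j * z)) = 20 * \<eta>2 / (\<epsilon> * ln N)"
        using z by (simp add: t_def lz)
      finally show ?thesis using b1 by linarith
    qed
    have "recip_sum (P \<inter> primes_in z (A * N)) \<le> (\<Sum>p\<in>(\<Union>j<J. B j). 1 / real p)"
      using finB by (intro sum_mono2 cov) auto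
    also have "\<dots> \<le> (\<Sum>j<J. \<Sum>p\<in>B j. 1 / real p)"
      using finB Bdisj by (subst sum.UNION_disjoint) auto
    also have "\<dots> \<le> (\<Sum>j<J. 20 * \<eta>2 / (\<epsilon> * ln N))" by (intro sum_mono bl)
    also have "\<dots> = real J * (20 * \<eta>2 / (\<epsilon> * ln N))" by simp
    also have "\<dots> \<le> 6 * ln N * (20 * \<eta>2 / (\<epsilon> * ln N))" using Jl e2 eps lN by (intro mult_right_mono) auto
    also have "\<dots> = \<eta>" using eps lN by (simp add: \<eta>2_def)
    finally show "recip_sum (P \<inter> primes_in (real N powr \<epsilon>) (A * real N)) \<le> \<eta>" by (simp add: z_def)
  qed
qed

section \<open>Signs given by the number of divisors in a set\<close>

text \<open>
  The map \<open>n \<mapsto> a * n + h\<close> is injective into \<open>{1..a * N + h}\<close>, and this interval contains at most \<open>(a * N + h) / c\<close>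
  multiples of \<open>c\<close>.
\<close>

lemma sum_dvd_linear_le:
  assumes "finite F" "a > 0" "\<And>c. c \<in> F \<Longrightarrow> c > 0"
  shows "(\<Sum>n\<in>{1..N}. of_bool (\<exists>c\<in>F. c dvd a * n + h)) \<le> real (a * N + h) * recip_sum F"
proof -
  have "(\<Sum>n\<in>{1..N}. of_bool (\<exists>c\<in>F. c dvd a * n + h) :: real) \<le> (\<Sum>n\<in>{1..N}. \<Sum>c\<in>F. of_bool (c dvd a * n + h))"
  proof (intro sum_mono)
    fix n
    show "(of_bool (\<exists>c\<in>F. c dvd a * n + h) :: real) \<le> (\<Sum>c\<in>F. of_bool (c dvd a * n + h))"
    proof (cases "\<exists>c\<in>F. c dvd a * n + h")
      case True
      then obtain c where "c \<in> F" "c dvd a * n + h" by blast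
      thus ?thesis using member_le_sum[of c F "\<lambda>c. of_bool (c dvd a * n + h) :: real"] assms(1) by auto
    qed (auto intro: sum_nonneg)
  qed
  also have "\<dots> = (\<Sum>c\<in>F. \<Sum>n\<in>{1..N}. of_bool (c dvd a * n + h))" by (rule sum.swap)
  also have "\<dots> \<le> (\<Sum>c\<in>F. real (a * N + h) * (1 / real c))"
  proof (intro sum_mono)
    fix c assume c: "c \<in> F"
    have inj: "inj_on (\<lambda>n. a * n + h) {1..N}" using assms(2) by (auto simp: inj_on_def)
    have "(\<Sum>n\<in>{1..N}. of_bool (c dvd a * n + h) :: real) = (\<Sum>m\<in>(\<lambda>n. a * n + h) ` {1..N}. of_bool (c dvd m))"
      by (subst sum.reindex[OF inj]) simp
    also have "\<dots> \<le> (\<Sum>m\<in>{1..a * N + h}. of_bool (c dvd m))"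
      using assms(2) by (intro sum_mono2) (auto simp: Suc_le_eq)
    also have "\<dots> = real ((a * N + h) div c)" by (rule sum_of_bool_dvd[OF assms(3)[OF c]])
    also have "\<dots> \<le> real (a * N + h) / real c" by (rule of_nat_div_le_of_nat)
    finally show "(\<Sum>n\<in>{1..N}. of_bool (c dvd a * n + h) :: real) \<le> real (a * N + h) * (1 / real c)" by simp
  qed
  finally show ?thesis by (simp add: sum_distrib_left)
qed

definition sgn_omega :: "nat set \<Rightarrow> nat \<Rightarrow> real" where "sgn_omega K n = (-1) ^ omega_on K n"

lemma sgn_omega_cases: "sgn_omega K n = 1 \<or> sgn_omega K n = -1"
  unfolding sgn_omega_def by (metis neg_one_even_power neg_one_odd_power)

lemma abs_sgn_omega [simp]: "\<bar>sgn_omega K n\<bar> = 1" by (simp add: sgn_omega_def power_abs)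

lemma finite_dvd_in: "n > 0 \<Longrightarrow> finite {k\<in>K. k dvd (n::nat)}"
  by (rule finite_subset[of _ "{d. d dvd n}"]) auto

lemma sgn_omega_Un: "n > 0 \<Longrightarrow> K1 \<inter> K2 = {} \<Longrightarrow> sgn_omega (K1 \<union> K2) n = sgn_omega K1 n * sgn_omega K2 n"
proof -
  assume n: "n > 0" "K1 \<inter> K2 = {}"
  have "{k\<in>K1 \<union> K2. k dvd n} = {k\<in>K1. k dvd n} \<union> {k\<in>K2. k dvd n}" by auto
  hence "omega_on (K1 \<union> K2) n = omega_on K1 n + omega_on K2 n" unfolding omega_on_def
    using finite_dvd_in[OF n(1)] n(2) by (simp, intro card_Un_disjoint) auto
  thus ?thesis by (simp add: sgn_omega_def power_add)
qed

lemma sgn_omega_cong: "(\<And>c. c \<in> K \<or> c \<in> K' \<Longrightarrow> (c \<in> K \<and> c dvd n) = (c \<in> K' \<and> c dvd n')) \<Longrightarrow> sgn_omega K n = sgn_omega K' n'"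
  unfolding sgn_omega_def omega_on_def by (rule arg_cong[of _ _ "\<lambda>S. (-1) ^ card S"]) auto

lemma sgn_omega_finite: "finite V \<Longrightarrow> sgn_omega V n = (\<Prod>p\<in>V. 1 - 2 * of_bool (p dvd n))"
proof -
  assume V: "finite V"
  have "(\<Prod>p\<in>V. 1 - 2 * of_bool (p dvd n) :: real) = (\<Prod>p\<in>V. if p dvd n then -1 else 1)"
    by (intro prod.cong) auto
  also have "\<dots> = (-1) ^ card (V \<inter> {p. p dvd n})" using V by (simp add: prod.If_cases)
  also have "V \<inter> {p. p dvd n} = {p\<in>V. p dvd n}" by auto
  finally show ?thesis by (simp add: sgn_omega_def omega_on_def)
qed


text \<open>
  This is what the arguments below extract from pairwise coprimality and from the divergence of the reciprocals. Unlike
  coprimality, it is shared by a set and the set of powers of its elements.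
\<close>

locale divergent_prime_part =
  fixes K :: "nat set"
  assumes K2: "\<And>c. c \<in> K \<Longrightarrow> c \<ge> 2"
    and tail: "\<And>\<eta>::real. \<eta> > 0 \<Longrightarrow> \<exists>w. \<forall>F. finite F \<longrightarrow> F \<subseteq> {c\<in>K. \<not> prime c \<and> c > w} \<longrightarrow> recip_sum F \<le> \<eta>"
    and div: "\<And>(C::real) w. \<exists>Q. finite Q \<and> (\<forall>p\<in>Q. p \<in> K \<and> prime p \<and> p > w) \<and> recip_sum Q \<ge> C"
begin

lemma prime_dvd_mult_outside:
  assumes "prime p" "\<not> p dvd b" shows "b dvd p * m \<longleftrightarrow> b dvd (m::nat)"
proof -
  have "coprime b p" using prime_imp_coprime[OF assms] by (simp only: coprime_commute)
  thus ?thesis by (rule coprime_dvd_mult_right_iff)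
qed

text \<open>
  When a prime \<open>p > w\<close> not dividing \<open>m\<close> is multiplied to \<open>m\<close>, the only element of \<open>K1\<close> that can become a divisor is \<open>p\<close>
  itself, since \<open>p\<close> divides no other element of \<open>K1\<close>.
\<close>

lemma mean_sgn_omega_truncated:
  fixes w :: nat
  defines "K1 \<equiv> {c\<in>K. prime c \<or> c \<le> w}"
  shows "(\<lambda>N. (\<Sum>n\<in>{1..N}. sgn_omega K1 n) / real N) \<longlonglongrightarrow> 0"
proof -
  define s :: "nat \<Rightarrow> real" where "s = (\<lambda>p. if p \<in> K then -1 else 1)"
  interpret almost_mult "sgn_omega K1" s w
  proof
    fix p m :: nat assume p: "prime p" "p > w" "m > 0" "\<not> p dvd m"
    let ?S = "{b\<in>K1. b dvd m}"
    have "{b\<in>K1. b dvd p * m} = ?S \<union> (if p \<in> K then {p} else {})"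
    proof (intro equalityI subsetI)
      fix b assume b: "b \<in> {b\<in>K1. b dvd p * m}"
      show "b \<in> ?S \<union> (if p \<in> K then {p} else {})"
      proof (cases "b = p")
        case True thus ?thesis using b by (auto simp: K1_def)
      next
        case False
        have "\<not> p dvd b"
        proof (cases "prime b")
          case True thus ?thesis using False p(1) primes_dvd_imp_eq by blast
        next
          case nb: False
          hence "b \<le> w" "b \<ge> 2" using b K2 by (auto simp: K1_def)
          thus ?thesis using p(2) by (auto dest: dvd_imp_le)
        qed
        thus ?thesis using b prime_dvd_mult_outside[OF p(1)] by auto
      qed
    next
      fix b assume "b \<in> ?S \<union> (if p \<in> K then {p} else {})"
      thus "b \<in> {b\<in>K1. b dvd p * m}" using p by (auto simp: K1_def split: if_splits)
    qed
    moreover have "finite ?S" "p \<notin> ?S" using p finite_dvd_in by auto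
    ultimately have "omega_on K1 (p * m) = omega_on K1 m + (if p \<in> K then 1 else 0)"
      by (simp add: omega_on_def)
    thus "sgn_omega K1 (p * m) = s p * sgn_omega K1 m" by (simp add: sgn_omega_def s_def)
  qed (auto simp: s_def)
  show ?thesis
  proof (rule mean_value_zero)
    fix C :: real
    obtain Q where "finite Q" "\<forall>p\<in>Q. p \<in> K \<and> prime p \<and> p > w" "recip_sum Q \<ge> C" using div[where C = C and w = w] by auto
    thus "\<exists>Q. finite Q \<and> (\<forall>p\<in>Q. prime p \<and> p > w \<and> s p = -1) \<and> recip_sum Q \<ge> C"
      by (intro exI[of _ Q]) (auto simp: s_def)
  qed
qed

text \<open>
  The large composite elements of \<open>K\<close> affect the sign at few integers, by the bound on their reciprocals.
\<close>

lemma mean_sgn_omega: "(\<lambda>N. (\<Sum>n\<in>{1..N}. sgn_omega K n) / real N) \<longlonglongrightarrow> 0"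
proof (rule LIMSEQ_I)
  fix r :: real assume r: "r > 0"
  obtain w where w: "\<And>F. finite F \<Longrightarrow> F \<subseteq> {c\<in>K. \<not> prime c \<and> c > w} \<Longrightarrow> recip_sum F \<le> r / 8"
    using tail[of "r / 8"] r by auto
  define K1 where "K1 = {c\<in>K. prime c \<or> c \<le> w}"
  obtain N0 where N0: "\<And>N. N \<ge> N0 \<Longrightarrow> norm ((\<Sum>n\<in>{1..N}. sgn_omega K1 n) / real N - 0) < r / 2"
    using LIMSEQ_D[OF mean_sgn_omega_truncated[of w], of "r / 2"] r unfolding K1_def by auto
  show "\<exists>no. \<forall>N\<ge>no. norm ((\<Sum>n\<in>{1..N}. sgn_omega K n) / real N - 0) < r"
  proof (intro exI[of _ "max 1 N0"] allI impI)
    fix N assume "N \<ge> max 1 N0"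
    hence N: "N \<ge> N0" "N \<ge> 1" by auto
    define F where "F = {c\<in>K. \<not> prime c \<and> c > w \<and> c \<le> N}"
    have finF: "finite F" by (rule finite_subset[of _ "{..N}"]) (auto simp: F_def)
    have "\<bar>(\<Sum>n\<in>{1..N}. sgn_omega K n) - (\<Sum>n\<in>{1..N}. sgn_omega K1 n)\<bar> \<le> (\<Sum>n\<in>{1..N}. 2 * of_bool (\<exists>c\<in>F. c dvd 1 * n + 0))"
      unfolding sum_subtractf[symmetric]
    proof (intro order_trans[OF sum_abs] sum_mono)
      fix n assume n: "n \<in> {1..N}"
      show "\<bar>sgn_omega K n - sgn_omega K1 n\<bar> \<le> 2 * of_bool (\<exists>c\<in>F. c dvd 1 * n + 0)"
      proof (cases "\<exists>c\<in>F. c dvd n")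
        case True
        thus ?thesis using sgn_omega_cases[of K n] sgn_omega_cases[of K1 n] by auto
      next
        case False
        have "sgn_omega K n = sgn_omega K1 n"
        proof (rule sgn_omega_cong)
          fix c assume "c \<in> K \<or> c \<in> K1"
          have "c \<in> K1" if "c \<in> K" "c dvd n"
          proof (rule ccontr)
            assume "c \<notin> K1"
            hence "c \<in> F" using that dvd_imp_le[OF that(2)] n by (auto simp: K1_def F_def)
            thus False using False that by blast
          qed
          thus "(c \<in> K \<and> c dvd n) = (c \<in> K1 \<and> c dvd n)" by (auto simp: K1_def)
        qed
        thus ?thesis by simp
      qed
    qed
    also have "\<dots> = 2 * (\<Sum>n\<in>{1..N}. of_bool (\<exists>c\<in>F. c dvd 1 * n + 0))" by (simp only: sum_distrib_left)
    also have "\<dots> \<le> 2 * (real (1 * N + 0) * recip_sum F)"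
    proof (intro mult_left_mono sum_dvd_linear_le finF)
      show "c > 0" if "c \<in> F" for c using K2[of c] that by (simp add: F_def)
    qed auto
    also have "\<dots> \<le> 2 * (real (1 * N + 0) * (r / 8))"
      using finF by (intro mult_left_mono w) (auto simp: F_def)
    finally have d: "\<bar>(\<Sum>n\<in>{1..N}. sgn_omega K n) - (\<Sum>n\<in>{1..N}. sgn_omega K1 n)\<bar> \<le> r / 4 * N" by simp
    have eq: "(\<Sum>n\<in>{1..N}. sgn_omega K n) / real N = (\<Sum>n\<in>{1..N}. sgn_omega K1 n) / real N + ((\<Sum>n\<in>{1..N}. sgn_omega K n) - (\<Sum>n\<in>{1..N}. sgn_omega K1 n)) / N"
      by (simp add: diff_divide_distrib)
    have v: "\<bar>((\<Sum>n\<in>{1..N}. sgn_omega K n) - (\<Sum>n\<in>{1..N}. sgn_omega K1 n)) / N\<bar> \<le> r / 4"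
      using d N by (simp add: field_simps)
    define u where "u = (\<Sum>n\<in>{1..N}. sgn_omega K1 n) / real N"
    define v where "v = ((\<Sum>n\<in>{1..N}. sgn_omega K n) - (\<Sum>n\<in>{1..N}. sgn_omega K1 n)) / N"
    have "\<bar>u\<bar> < r / 2" "\<bar>v\<bar> \<le> r / 4" using N0[OF N(1)] v by (simp_all add: u_def v_def)
    hence "\<bar>u + v\<bar> < r" using r by linarith
    hence "\<bar>(\<Sum>n\<in>{1..N}. sgn_omega K n) / real N\<bar> < r" using eq by (simp only: u_def v_def)
    thus "norm ((\<Sum>n\<in>{1..N}. sgn_omega K n) / real N - 0) < r" by simp
  qed
qed

end

section \<open>Correlations along affine forms\<close>

lemma avg_prod_coprime:
  assumes "finite Q" "\<And>p. p \<in> Q \<Longrightarrow> prime p" "\<And>p. p \<in> Q \<Longrightarrow> periodic p (h p)"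
  shows "periodic (\<Prod>Q) (\<lambda>n. \<Prod>p\<in>Q. h p n) \<and> avg (\<Prod>Q) (\<lambda>n. \<Prod>p\<in>Q. h p n) = (\<Prod>p\<in>Q. avg p (h p))"
  using assms
proof (induction Q rule: finite_induct)
  case empty
  show ?case by (simp add: periodic_def avg_def)
next
  case (insert p Q)
  have "coprime p (\<Prod>Q)" using insert.hyps insert.prems(1)
    by (intro prod_coprime_right) (metis insertCI primes_coprime)
  moreover have "\<Prod>Q > 0" using insert.prems(1) by (intro prod_pos) (auto simp: prime_gt_0_nat)
  ultimately show ?case using insert by (simp add: periodic_mult avg_mult_coprime prime_gt_0_nat)
qed

lemma avg_dvd_linear_le:
  fixes p a h :: nat
  assumes "prime p" "\<not> p dvd a" shows "(\<Sum>r<p. of_bool (p dvd a * r + h) :: real) \<le> 1"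
proof -
  have "card {r\<in>{..<p}. p dvd a * r + h} \<le> Suc 0"
  proof (subst card_le_Suc0_iff_eq)
    have *: "x = y" if "x < p" "y < p" "x \<le> y" "p dvd a * x + h" "p dvd a * y + h" for x y
    proof -
      have "p dvd (a * y + h) - (a * x + h)" using that by (metis dvd_diff_nat)
      also have "(a * y + h) - (a * x + h) = a * (y - x)" by (simp add: diff_mult_distrib2)
      finally have "p dvd y - x" using assms prime_dvd_mult_iff by blast
      thus "x = y" using that dvd_imp_le[of p "y - x"] by (cases "y - x = 0") auto
    qed
    show "\<forall>x\<in>{r\<in>{..<p}. p dvd a * r + h}. \<forall>y\<in>{r\<in>{..<p}. p dvd a * r + h}. x = y"
      using * by (metis (mono_tags, lifting) lessThan_iff mem_Collect_eq nat_le_linear)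
  qed auto
  moreover have "(\<Sum>r<p. of_bool (p dvd a * r + h) :: real) = card {r\<in>{..<p}. p dvd a * r + h}"
    by (simp add: of_bool_def sum.If_cases Int_def)
  ultimately show ?thesis by simp
qed

lemma exists_dvd_linear:
  fixes p a h :: nat
  assumes "prime p" "\<not> p dvd a" obtains r where "r < p" "p dvd a * r + (h::nat)"
proof -
  have "coprime a p" using prime_imp_coprime[OF assms] by (simp only: coprime_commute)
  then obtain x where x: "[a * x = 1] (mod p)" using cong_solve_coprime_nat by auto
  have p0: "p > 0" using assms prime_gt_0_nat by auto
  define r where "r = (x * (h * (p - 1))) mod p"
  have "[a * r + h = a * (x * (h * (p - 1))) + h] (mod p)"
    unfolding r_def by (intro cong_add cong_mult) (auto simp: cong_def)
  also have "a * (x * (h * (p - 1))) + h = (a * x) * (h * (p - 1)) + h" by (simp add: mult.assoc)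
  also have "[(a * x) * (h * (p - 1)) + h = 1 * (h * (p - 1)) + h] (mod p)"
    by (intro cong_add cong_mult x) auto
  also have "1 * (h * (p - 1)) + h = h * p" using p0 by (cases p) auto
  finally have "p dvd a * r + h" by (simp add: cong_dvd_iff)
  moreover have "r < p" using p0 by (simp add: r_def)
  ultimately show ?thesis using that by blast
qed

locale affine_forms =
  fixes k :: nat and a h :: "nat \<Rightarrow> nat"
  assumes k: "k \<ge> 1"
    and pos: "\<And>i. i \<in> {1..k} \<Longrightarrow> a i > 0"
    and indep: "\<And>i j. i \<in> {1..k} \<Longrightarrow> j \<in> {1..k} \<Longrightarrow> i \<noteq> j \<Longrightarrow> int (a i) * int (h j) - int (a j) * int (h i) \<noteq> 0"
begin

definition hit :: "nat \<Rightarrow> nat \<Rightarrow> real" where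
  "hit p n = of_bool (\<exists>i\<in>{1..k}. p dvd a i * n + h i)"

lemma hit_cases: "hit p n \<in> {0, 1}" unfolding hit_def of_bool_def by auto

lemma abs_hit_factor: "0 \<le> \<bar>1 - 2 * hit p n\<bar> \<and> \<bar>1 - 2 * hit p n\<bar> \<le> 1"
  using hit_cases[of p n] by auto

lemma periodic_hit: "periodic p (hit p)"
proof -
  have "p dvd a i * (n + p) + h i \<longleftrightarrow> p dvd a i * n + h i" for i n
    using dvd_add_right_iff[of p "a i * p" "a i * n + h i"] by (simp add: algebra_simps)
  thus ?thesis by (simp add: periodic_def hit_def)
qed

text \<open>
  A prime above this number divides no coefficient \<open>a i\<close> and no determinant of two of the forms. The summand \<open>2 * k\<close>
  ensures that the mean of \<open>1 - 2 * hit p n\<close> is nonnegative for larger primes.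
\<close>

definition excl_bound :: nat where
  "excl_bound = (\<Sum>i\<in>{1..k}. a i) + (\<Sum>i\<in>{1..k}. \<Sum>j\<in>{1..k}. nat \<bar>int (a i) * int (h j) - int (a j) * int (h i)\<bar>) + 2 * k"

lemma excl_bound_ge:
  assumes "i \<in> {1..k}" "j \<in> {1..k}"
  shows "a i \<le> excl_bound" "\<bar>int (a i) * int (h j) - int (a j) * int (h i)\<bar> \<le> int excl_bound"
proof -
  have "a i \<le> (\<Sum>i\<in>{1..k}. a i)" using assms by (intro member_le_sum) auto
  thus "a i \<le> excl_bound" by (simp add: excl_bound_def)
  have "nat \<bar>int (a i) * int (h j) - int (a j) * int (h i)\<bar> \<le> (\<Sum>j\<in>{1..k}. nat \<bar>int (a i) * int (h j) - int (a j) * int (h i)\<bar>)"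
    using assms by (intro member_le_sum[of j "{1..k}" "\<lambda>j. nat \<bar>int (a i) * int (h j) - int (a j) * int (h i)\<bar>"]) auto
  also have "\<dots> \<le> (\<Sum>i\<in>{1..k}. \<Sum>j\<in>{1..k}. nat \<bar>int (a i) * int (h j) - int (a j) * int (h i)\<bar>)"
    using assms by (intro member_le_sum[of i "{1..k}" "\<lambda>i. \<Sum>j\<in>{1..k}. nat \<bar>int (a i) * int (h j) - int (a j) * int (h i)\<bar>"]) auto
  finally show "\<bar>int (a i) * int (h j) - int (a j) * int (h i)\<bar> \<le> int excl_bound"
    unfolding excl_bound_def by linarith
qed

lemma not_dvd_coeff:
  assumes "p > excl_bound" "i \<in> {1..k}" shows "\<not> p dvd a i"
  using assms excl_bound_ge(1)[of i i] pos[of i] by (auto dest: dvd_imp_le)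

lemma at_most_one_value_divisible:
  assumes p: "p > excl_bound" and ij: "i \<in> {1..k}" "j \<in> {1..k}" "p dvd a i * n + h i" "p dvd a j * n + h j"
  shows "i = j"
proof (rule ccontr)
  assume ne: "i \<noteq> j"
  let ?d = "int (a i) * int (h j) - int (a j) * int (h i)"
  have 1: "int p dvd int (a i * n + h i)" "int p dvd int (a j * n + h j)" using ij(3,4) int_dvd_int_iff by blast+
  have "?d = int (a i) * int (a j * n + h j) - int (a j) * int (a i * n + h i)"
    by (simp add: algebra_simps)
  also have "int p dvd \<dots>" using 1 by (intro dvd_diff dvd_mult) auto
  finally have "int p dvd ?d" .
  moreover have "?d \<noteq> 0" using indep[OF ij(1,2) ne] .
  ultimately have "\<bar>int p\<bar> \<le> \<bar>?d\<bar>" using dvd_imp_le_int by blast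
  thus False using excl_bound_ge(2)[OF ij(1,2)] p by linarith
qed

text \<open>
  Each of the forms is divisible by \<open>p\<close> on exactly one residue class, and the union of these \<open>k\<close> classes contains at least
  one of them.
\<close>

lemma avg_hit_bounds:
  assumes p: "prime p" "p > excl_bound"
  shows "1 / real p \<le> avg p (hit p)" "avg p (hit p) \<le> real k / real p" "2 * k < p"
proof -
  have p0: "p > 0" using p prime_gt_0_nat by auto
  have one: "1 \<in> {1..k}" using k by simp
  obtain r where r: "r < p" "p dvd a 1 * r + h 1" using exists_dvd_linear[OF p(1) not_dvd_coeff[OF p(2) one]] by blast
  have "hit p r \<le> (\<Sum>r<p. hit p r)" using r by (intro member_le_sum) (auto simp: hit_def)
  moreover have "hit p r = 1" using r one unfolding hit_def by (simp only: of_bool_eq_1_iff) blast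
  ultimately show "1 / real p \<le> avg p (hit p)" unfolding avg_def by (intro divide_right_mono) auto
  have "(\<Sum>r<p. hit p r) \<le> (\<Sum>r<p. \<Sum>i\<in>{1..k}. of_bool (p dvd a i * r + h i))"
  proof (intro sum_mono)
    fix r
    show "hit p r \<le> (\<Sum>i\<in>{1..k}. of_bool (p dvd a i * r + h i))"
    proof (cases "\<exists>i\<in>{1..k}. p dvd a i * r + h i")
      case True
      then obtain i where "i \<in> {1..k}" "p dvd a i * r + h i" by blast
      thus ?thesis using member_le_sum[of i "{1..k}" "\<lambda>i. of_bool (p dvd a i * r + h i) :: real"] by (auto simp: hit_def)
    next
      case False
      hence "hit p r = 0" unfolding hit_def by (simp only: of_bool_eq_0_iff not_False_eq_True)
      thus ?thesis by (simp add: sum_nonneg)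
    qed
  qed
  also have "\<dots> = (\<Sum>i\<in>{1..k}. \<Sum>r<p. of_bool (p dvd a i * r + h i))" by (rule sum.swap)
  also have "\<dots> \<le> (\<Sum>i\<in>{1..k}. 1)"
    by (intro sum_mono avg_dvd_linear_le[OF p(1)] not_dvd_coeff p(2))
  finally show "avg p (hit p) \<le> real k / real p" unfolding avg_def by (intro divide_right_mono) auto
  show "2 * k < p" using p(2) by (simp add: excl_bound_def)
qed

text \<open>
  At most one factor differs from one, so the \<open>k\<close> signs belonging to \<open>p\<close> combine into one factor of the type
  treated by the sieve.
\<close>

lemma prod_hit:
  assumes "p > excl_bound"
  shows "(\<Prod>i\<in>{1..k}. 1 - 2 * of_bool (p dvd a i * n + h i) :: real) = 1 - 2 * hit p n"
proof (cases "\<exists>i\<in>{1..k}. p dvd a i * n + h i")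
  case True
  then obtain i where i: "i \<in> {1..k}" "p dvd a i * n + h i" by blast
  have "(\<Prod>i\<in>{1..k}. 1 - 2 * of_bool (p dvd a i * n + h i) :: real)
      = (1 - 2 * of_bool (p dvd a i * n + h i)) * (\<Prod>i\<in>{1..k} - {i}. 1 - 2 * of_bool (p dvd a i * n + h i))"
    using i by (intro prod.remove) auto
  also have "(\<Prod>i\<in>{1..k} - {i}. 1 - 2 * of_bool (p dvd a i * n + h i) :: real) = 1"
    using at_most_one_value_divisible[OF assms i(1) _ i(2)] by (intro prod.neutral) auto
  finally show ?thesis using True i by (simp add: hit_def)
next
  case False
  hence "hit p n = 0" unfolding hit_def by (simp only: of_bool_eq_0_iff not_False_eq_True)
  moreover have "(\<Prod>i\<in>{1..k}. 1 - 2 * of_bool (p dvd a i * n + h i) :: real) = 1"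
    using False by (intro prod.neutral) auto
  ultimately show ?thesis by simp
qed

lemma periodic_sgn_omega_forms:
  assumes "finite B" "\<And>c. c \<in> B \<Longrightarrow> c dvd q"
  shows "periodic q (\<lambda>n. \<Prod>i\<in>{1..k}. sgn_omega B (a i * n + h i))"
  unfolding periodic_def
proof (intro allI prod.cong refl sgn_omega_cong)
  fix n i c assume "c \<in> B \<or> c \<in> B"
  hence "c dvd a i * q" using assms(2) by auto
  hence "c dvd a i * q + (a i * n + h i) \<longleftrightarrow> c dvd a i * n + h i" by (rule dvd_add_right_iff)
  moreover have "a i * (n + q) + h i = a i * q + (a i * n + h i)" by (simp add: algebra_simps)
  ultimately show "(c \<in> B \<and> c dvd a i * (n + q) + h i) = (c \<in> B \<and> c dvd a i * n + h i)" by (simp only:)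
qed

end

locale correlation = divergent_prime_part K + affine_forms k a h for K k a h +
  assumes dens: "has_relative_density {p\<in>K. prime p} 0"
begin

definition corr :: "nat \<Rightarrow> real" where "corr n = (\<Prod>i\<in>{1..k}. sgn_omega K (a i * n + h i))"

lemma abs_prod_sgn [simp]: "\<bar>\<Prod>i\<in>I. sgn_omega B (f i)\<bar> = 1" by (simp add: abs_prod)

text \<open>
  The factors are at most \<open>1 - 1 / p \<le> exp (- 1 / p)\<close>, and the sum of \<open>1 / p\<close> over the primes of \<open>K\<close> diverges.
\<close>

lemma exists_small_product:
  assumes "\<delta> > 0"
  obtains Q where "finite Q" "\<And>p. p \<in> Q \<Longrightarrow> p \<in> K \<and> prime p \<and> p > w" "\<bar>\<Prod>p\<in>Q. 1 - 2 * avg p (hit p)\<bar> \<le> \<delta>"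
proof -
  obtain Q where Q: "finite Q" "\<forall>p\<in>Q. p \<in> K \<and> prime p \<and> p > max w excl_bound" "recip_sum Q \<ge> - ln \<delta>"
    using div[where C = "- ln \<delta>" and w = "max w excl_bound"] by auto
  have "\<bar>\<Prod>p\<in>Q. 1 - 2 * avg p (hit p)\<bar> = (\<Prod>p\<in>Q. \<bar>1 - 2 * avg p (hit p)\<bar>)" by (rule abs_prod)
  also have "\<dots> \<le> (\<Prod>p\<in>Q. exp (- (1 / real p)))"
  proof (intro prod_mono conjI)
    fix p assume "p \<in> Q"
    hence p: "prime p" "p > excl_bound" using Q by auto
    note b = avg_hit_bounds[OF p]
    have "2 * (real k / real p) \<le> 1" using b(3) p by (simp add: field_simps)
    hence "\<bar>1 - 2 * avg p (hit p)\<bar> = 1 - 2 * avg p (hit p)" using b(2) by simp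
    also have "\<dots> \<le> 1 + - (1 / real p)" using b(1) by (smt (verit) divide_nonneg_nonneg of_nat_0_le_iff)
    also have "\<dots> \<le> exp (- (1 / real p))" by (rule exp_ge_add_one_self)
    finally show "\<bar>1 - 2 * avg p (hit p)\<bar> \<le> exp (- (1 / real p))" .
  qed auto
  also have "\<dots> = exp (- recip_sum Q)" using Q(1) by (simp add: exp_sum sum_negf[symmetric])
  also have "\<dots> \<le> exp (ln \<delta>)" using Q(3) by simp
  finally have "\<bar>\<Prod>p\<in>Q. 1 - 2 * avg p (hit p)\<bar> \<le> \<delta>" using assms by simp
  thus ?thesis using that[of Q] Q by auto
qed

text \<open>
  The divisors in \<open>K\<close> of the values of the forms fall into three classes: elements up to \<open>w\<close>, collected in the periodic
  first factor; the primes of \<open>Q\<close>, which will make the mean small; and the primes of \<open>U\<close>, which are left to the sieve.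
  The last hypothesis excludes all others.
\<close>

lemma corr_factorization:
  fixes w :: nat and z :: real and Q :: "nat set"
  defines "B \<equiv> {c\<in>K. c \<le> w}" and "U \<equiv> {p\<in>K. prime p \<and> w < p \<and> real p \<le> z} - Q"
  assumes w: "w \<ge> excl_bound" and Q: "finite Q" "\<And>p. p \<in> Q \<Longrightarrow> p \<in> K \<and> prime p \<and> p > w"
    and n: "n \<ge> 1" and good: "\<And>i c. i \<in> {1..k} \<Longrightarrow> c \<in> K \<Longrightarrow> c > w \<Longrightarrow> \<not> prime c \<or> real c > z \<Longrightarrow> c \<notin> Q \<Longrightarrow> \<not> c dvd a i * n + h i"
  shows "corr n = (\<Prod>i\<in>{1..k}. sgn_omega B (a i * n + h i)) * (\<Prod>p\<in>Q. 1 - 2 * hit p n) * (\<Prod>p\<in>U. 1 - 2 * hit p n)"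
proof -
  have finU: "finite U" by (rule finite_subset[of _ "{..nat \<lfloor>z\<rfloor>}"]) (auto simp: U_def le_nat_floor)
  define V where "V = Q \<union> U"
  have V: "finite V" "Q \<inter> U = {}" using finU Q by (auto simp: V_def U_def)
  have Vw: "p > excl_bound" if "p \<in> V" for p using that Q(2)[of p] w by (auto simp: V_def U_def)
  have eq: "sgn_omega K (a i * n + h i) = sgn_omega B (a i * n + h i) * (\<Prod>p\<in>V. 1 - 2 * of_bool (p dvd a i * n + h i))"
    if i: "i \<in> {1..k}" for i
  proof -
    have m: "a i * n + h i > 0" using pos[OF i] n by simp
    have "sgn_omega K (a i * n + h i) = sgn_omega (B \<union> V) (a i * n + h i)"
    proof (rule sgn_omega_cong)
      fix c assume "c \<in> K \<or> c \<in> B \<union> V"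
      have "c \<in> B \<union> V" if c: "c \<in> K" "c dvd a i * n + h i"
      proof (rule ccontr)
        assume no: "c \<notin> B \<union> V"
        hence "c > w" "c \<notin> Q" "\<not> prime c \<or> real c > z" using c by (auto simp: B_def V_def U_def not_le)
        thus False using good[OF i c(1)] c(2) by blast
      qed
      moreover have "c \<in> K" if "c \<in> B \<union> V" using that Q by (auto simp: B_def V_def U_def)
      ultimately show "(c \<in> K \<and> c dvd a i * n + h i) = (c \<in> B \<union> V \<and> c dvd a i * n + h i)" by blast
    qed
    also have "\<dots> = sgn_omega B (a i * n + h i) * sgn_omega V (a i * n + h i)"
      using Q by (intro sgn_omega_Un[OF m]) (force simp: B_def V_def U_def)
    finally show ?thesis by (simp add: sgn_omega_finite[OF V(1)])
  qed
  have "corr n = (\<Prod>i\<in>{1..k}. sgn_omega B (a i * n + h i)) * (\<Prod>i\<in>{1..k}. \<Prod>p\<in>V. 1 - 2 * of_bool (p dvd a i * n + h i))"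
    unfolding corr_def prod.distrib[symmetric] by (intro prod.cong refl eq)
  also have "(\<Prod>i\<in>{1..k}. \<Prod>p\<in>V. 1 - 2 * of_bool (p dvd a i * n + h i) :: real) = (\<Prod>p\<in>V. \<Prod>i\<in>{1..k}. 1 - 2 * of_bool (p dvd a i * n + h i))"
    by (rule prod.swap)
  also have "\<dots> = (\<Prod>p\<in>V. 1 - 2 * hit p n)" by (intro prod.cong refl prod_hit Vw)
  also have "\<dots> = (\<Prod>p\<in>Q. 1 - 2 * hit p n) * (\<Prod>p\<in>U. 1 - 2 * hit p n)"
    unfolding V_def using finU Q V by (intro prod.union_disjoint) auto
  finally show ?thesis by (simp add: mult.assoc)
qed

text \<open>
  Outside a set of small density \<open>corr n = f n * (\<Prod>p\<in>U. 1 - 2 * hit p n)\<close> with a periodic \<open>f\<close> whose period does not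
  depend on \<open>N\<close> and whose mean is at most \<open>\<delta>\<close>, due to the primes of \<open>Q\<close>. The sieve up to \<open>z = N powr \<epsilon>\<close> then
  bounds the correlation sum. The excluded \<open>n\<close> are those for which a form is divisible by a composite element of \<open>K\<close>
  above \<open>w\<close>, or by a prime of \<open>K\<close> above \<open>z\<close>.
\<close>

lemma corr_mean_bound:
  assumes eta: "0 < \<eta>" "\<eta> \<le> 1"
  obtains N0 :: nat where "\<And>N. N \<ge> N0 \<Longrightarrow> \<bar>\<Sum>n\<in>{1..N}. corr n\<bar> \<le> \<eta> * real N"
proof -
  define \<delta> where "\<delta> = \<eta> / 12"
  have d: "0 < \<delta>" "\<delta> \<le> 1" using eta by (auto simp: \<delta>_def)
  define S where "S = (\<Sum>i\<in>{1..k}. a i + h i)"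
  have Si: "a i + h i \<le> S" if "i \<in> {1..k}" for i unfolding S_def using that by (intro member_le_sum[of i _ "\<lambda>i. a i + h i"]) auto
  have S1: "S \<ge> 1" using Si[of 1] pos[of 1] k by auto
  \<comment> \<open>the excluded \<open>n\<close> number at most \<open>k * S * N * (2 * \<delta>') = \<eta> / 4 * N\<close>\<close>
  define \<delta>' where "\<delta>' = \<eta> / (8 * real k * real S)"
  have d': "\<delta>' > 0" using eta k S1 by (simp add: \<delta>'_def)
  obtain w0 where w0: "\<And>F. finite F \<Longrightarrow> F \<subseteq> {c\<in>K. \<not> prime c \<and> c > w0} \<Longrightarrow> recip_sum F \<le> \<delta>'"
    using tail[OF d'] by auto
  define w where "w = max w0 excl_bound"
  define B where "B = {c\<in>K. c \<le> w}"
  have finB: "finite B" by (rule finite_subset[of _ "{..w}"]) (auto simp: B_def)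
  define q0 where "q0 = \<Prod>B"
  have q0: "q0 > 0" unfolding q0_def using K2 by (intro prod_pos) (force simp: B_def)
  define F0 where "F0 = (\<lambda>n. \<Prod>i\<in>{1..k}. sgn_omega B (a i * n + h i))"
  have perF0: "periodic q0 F0" unfolding F0_def q0_def by (intro periodic_sgn_omega_forms finB dvd_prodI)
  obtain Q where Q: "finite Q" "\<And>p. p \<in> Q \<Longrightarrow> p \<in> K \<and> prime p \<and> p > w" "\<bar>\<Prod>p\<in>Q. 1 - 2 * avg p (hit p)\<bar> \<le> \<delta>"
    using exists_small_product[OF d(1), of w] by blast
  define FQ where "FQ = (\<lambda>n. \<Prod>p\<in>Q. 1 - 2 * hit p n)"
  have per1: "periodic p (\<lambda>n. 1 - 2 * hit p n)" for p using periodic_hit[of p] by (simp add: periodic_def)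
  have avg1: "avg p (\<lambda>n. 1 - 2 * hit p n) = 1 - 2 * avg p (hit p)" if "p \<in> Q" for p
    using Q(2)[OF that] by (simp add: avg_def sum_subtractf sum_distrib_left[symmetric] diff_divide_distrib prime_gt_0_nat)
  have perQ: "periodic (\<Prod>Q) FQ" and avgQ: "avg (\<Prod>Q) FQ = (\<Prod>p\<in>Q. 1 - 2 * avg p (hit p))"
    using avg_prod_coprime[of Q "\<lambda>p n. 1 - 2 * hit p n"] Q per1 avg1 by (auto simp: FQ_def)
  have Qpos: "\<Prod>Q > 0" using Q(2) by (intro prod_pos) (auto simp: prime_gt_0_nat)
  have copB: "coprime q0 p" if "prime p" "p > w" for p
  proof -
    have "coprime c p" if "c \<in> B" for c
    proof -
      have "\<not> p dvd c" using that \<open>p > w\<close> K2[of c] by (auto simp: B_def dest: dvd_imp_le)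
      thus ?thesis using prime_imp_coprime[OF \<open>prime p\<close>] by (simp only: coprime_commute)
    qed
    thus ?thesis unfolding q0_def by (intro prod_coprime_left)
  qed
  define f where "f = (\<lambda>n. F0 n * FQ n)"
  define q where "q = q0 * \<Prod>Q"
  have q: "q > 0" using q0 Qpos by (simp add: q_def)
  have perf: "periodic q f" unfolding f_def q_def by (intro periodic_mult perF0 perQ)
  have absFQ: "\<bar>FQ n\<bar> \<le> 1" for n unfolding FQ_def abs_prod
    by (intro prod_le_1 abs_hit_factor)
  have absF0: "\<bar>F0 n\<bar> = 1" for n by (simp add: F0_def)
  have absf: "\<bar>f n\<bar> \<le> 1" for n using absFQ[of n] by (simp add: f_def abs_mult absF0)
  have avgf: "\<bar>avg q f\<bar> \<le> \<delta>"
  proof -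
    have "coprime q0 (\<Prod>Q)" using Q(2) copB by (intro prod_coprime_right) auto
    hence "avg q f = avg q0 F0 * avg (\<Prod>Q) FQ" unfolding q_def f_def by (intro avg_mult_coprime perF0 perQ q0 Qpos)
    hence "\<bar>avg q f\<bar> = \<bar>avg q0 F0\<bar> * \<bar>\<Prod>p\<in>Q. 1 - 2 * avg p (hit p)\<bar>" by (simp add: avgQ abs_mult)
    also have "\<dots> \<le> 1 * \<delta>" using avg_abs_le[OF q0, of F0 1] absF0 Q(3) by (intro mult_mono) auto
    finally show ?thesis by simp
  qed
  have k0: "k > 0" using k by simp
  show thesis
  proof (rule brun_correlation_bound[OF k0 d(1)])
    fix D :: real
    assume D: "D > 0" and brun: "\<And>z U e q f N. z \<ge> 2 \<Longrightarrow> finite U \<Longrightarrow> (\<And>p. p \<in> U \<Longrightarrow> prime p \<and> real p \<le> z)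
      \<Longrightarrow> (\<And>p n. p \<in> U \<Longrightarrow> e p n \<in> {0, 1}) \<Longrightarrow> (\<And>p. p \<in> U \<Longrightarrow> periodic p (e p))
      \<Longrightarrow> (\<And>p. p \<in> U \<Longrightarrow> avg p (e p) \<le> real k / real p)
      \<Longrightarrow> q > 0 \<Longrightarrow> periodic q f \<Longrightarrow> (\<And>n. \<bar>f n\<bar> \<le> 1) \<Longrightarrow> (\<And>p. p \<in> U \<Longrightarrow> coprime q p)
      \<Longrightarrow> \<bar>\<Sum>n\<in>{1..N}. f n * (\<Prod>p\<in>U. 1 - 2 * e p n)\<bar> \<le> real N * (\<bar>avg q f\<bar> * (1 + \<delta>) + \<delta>) + 8 * real q * z powr D"
    \<comment> \<open>so that the rounding error \<open>z powr D\<close> of the sieve is \<open>sqrt N\<close>\<close>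
    define \<epsilon> where "\<epsilon> = 1 / (2 * D)"
    have eps: "\<epsilon> > 0" using D by (simp add: \<epsilon>_def)
    define P where "P = {p\<in>K. prime p}"
    have SR: "real S \<ge> 1" using S1 by simp
    obtain N1 where N1: "\<And>N. N \<ge> N1 \<Longrightarrow> recip_sum (P \<inter> primes_in (real N powr \<epsilon>) (real S * real N)) \<le> \<delta>'"
      using zero_density_sum_inv[of P \<epsilon> "real S" \<delta>'] dens eps SR d' by (auto simp: P_def)
    have "\<forall>\<^sub>F N::nat in sequentially. real N powr \<epsilon> \<ge> 2"
      using eps by real_asymp
    then obtain N2 where N2: "\<And>N. N \<ge> N2 \<Longrightarrow> real N powr \<epsilon> \<ge> 2" by (auto simp: eventually_sequentially)
    define N3 where "N3 = nat \<lceil>(32 * real q / \<eta>)^2\<rceil>"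
    show thesis
    proof (rule that[of "Max {1, N1, N2, N3}"])
      fix N assume "N \<ge> Max {1, N1, N2, N3}"
      hence N: "N \<ge> 1" "N \<ge> N1" "N \<ge> N2" "N \<ge> N3" by auto
      define z where "z = real N powr \<epsilon>"
      have z2: "z \<ge> 2" using N2[OF N(3)] by (simp add: z_def)
      have "z powr D = real N powr (1/2)" using D by (simp add: z_def powr_powr \<epsilon>_def)
      hence zD: "z powr D = sqrt N" by (simp add: powr_half_sqrt)
      define U where "U = {p\<in>K. prime p \<and> w < p \<and> real p \<le> z} - Q"
      have finU: "finite U" by (rule finite_subset[of _ "{..nat \<lfloor>z\<rfloor>}"]) (auto simp: U_def le_nat_floor)
      have main: "\<bar>\<Sum>n\<in>{1..N}. f n * (\<Prod>p\<in>U. 1 - 2 * hit p n)\<bar> \<le> real N * (\<bar>avg q f\<bar> * (1 + \<delta>) + \<delta>) + 8 * real q * z powr D"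
      proof (rule brun[OF z2 finU _ hit_cases periodic_hit _ q perf absf])
        fix p assume p: "p \<in> U"
        show "prime p \<and> real p \<le> z" using p by (simp add: U_def)
        show "avg p (hit p) \<le> real k / real p" using p by (intro avg_hit_bounds) (auto simp: U_def w_def)
        have "coprime p' p" if "p' \<in> Q" for p' using Q(2)[OF that] that p by (intro primes_coprime) (auto simp: U_def)
        hence "coprime (\<Prod>Q) p" by (intro prod_coprime_left)
        thus "coprime q p" using copB[of p] p by (simp add: q_def U_def)
      qed
      have e1: "\<bar>avg q f\<bar> * (1 + \<delta>) + \<delta> \<le> \<eta> / 4"
      proof -
        have "\<bar>avg q f\<bar> * (1 + \<delta>) \<le> \<delta> * 2" using avgf d by (intro mult_mono) auto
        thus ?thesis by (simp add: \<delta>_def)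
      qed
      have e2: "8 * real q * z powr D \<le> \<eta> / 4 * N"
      proof -
        have "(32 * real q / \<eta>)^2 \<le> real N" using N(4) unfolding N3_def by linarith
        hence "32 * real q / \<eta> \<le> sqrt N" by (rule real_le_rsqrt)
        hence "32 * real q \<le> \<eta> * sqrt N" using eta by (simp add: field_simps)
        hence "32 * real q * sqrt N \<le> \<eta> * sqrt N * sqrt N" by (intro mult_right_mono) auto
        also have "\<eta> * sqrt N * sqrt N = \<eta> * real N" by (simp add: mult.assoc)
        finally show ?thesis unfolding zD by simp
      qed
      define F where "F = {c\<in>K. \<not> prime c \<and> w < c \<and> c \<le> S * N} \<union> (P \<inter> primes_in z (real S * real N))"
      have finF1: "finite {c\<in>K. \<not> prime c \<and> w < c \<and> c \<le> S * N}" by (rule finite_subset[of _ "{..S * N}"]) auto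
      have finF: "finite F" using finF1 by (simp add: F_def)
      have Fpos: "c > 0" if "c \<in> F" for c using that K2[of c] by (auto simp: F_def P_def)
      have sumF: "recip_sum F \<le> 2 * \<delta>'"
      proof -
        have "recip_sum F \<le> (\<Sum>c\<in>{c\<in>K. \<not> prime c \<and> w < c \<and> c \<le> S * N}. 1 / real c) + recip_sum (P \<inter> primes_in z (real S * real N))"
          unfolding F_def using finF1 by (subst sum.union_disjoint) (auto simp: P_def)
        also have "(\<Sum>c\<in>{c\<in>K. \<not> prime c \<and> w < c \<and> c \<le> S * N}. 1 / real c) \<le> \<delta>'"
          using finF1 by (intro w0) (auto simp: w_def)
        also have "recip_sum (P \<inter> primes_in z (real S * real N)) \<le> \<delta>'" using N1[OF N(2)] by (simp add: z_def)
        finally show ?thesis by simp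
      qed
      define bad where "bad = (\<lambda>n. \<Sum>i\<in>{1..k}. of_bool (\<exists>c\<in>F. c dvd a i * n + h i) :: real)"
      have ptw: "\<bar>corr n - f n * (\<Prod>p\<in>U. 1 - 2 * hit p n)\<bar> \<le> 2 * bad n" if n: "n \<in> {1..N}" for n
      proof (cases "\<exists>i\<in>{1..k}. \<exists>c\<in>F. c dvd a i * n + h i")
        case True
        then obtain i where i: "i \<in> {1..k}" "\<exists>c\<in>F. c dvd a i * n + h i" by blast
        have "of_bool (\<exists>c\<in>F. c dvd a i * n + h i) \<le> bad n" unfolding bad_def
          using i(1) by (intro member_le_sum[of i "{1..k}" "\<lambda>i. of_bool (\<exists>c\<in>F. c dvd a i * n + h i) :: real"]) auto
        hence b: "bad n \<ge> 1" using i(2) by (simp only: of_bool_eq(2))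
        have "\<bar>\<Prod>p\<in>U. 1 - 2 * hit p n\<bar> \<le> 1" unfolding abs_prod by (intro prod_le_1 abs_hit_factor)
        hence "\<bar>f n\<bar> * \<bar>\<Prod>p\<in>U. 1 - 2 * hit p n\<bar> \<le> 1 * 1" using absf by (intro mult_mono) auto
        moreover have "\<bar>corr n\<bar> = 1" by (simp add: corr_def)
        ultimately show ?thesis using b unfolding abs_mult[symmetric] by linarith
      next
        case False
        have "corr n = f n * (\<Prod>p\<in>U. 1 - 2 * hit p n)"
          unfolding f_def F0_def FQ_def B_def U_def
        proof (rule corr_factorization[OF _ Q(1,2)])
          show "excl_bound \<le> w" by (simp add: w_def)
          show "1 \<le> n" using n by simp
          fix i c assume c: "i \<in> {1..k}" "c \<in> K" "w < c" "\<not> prime c \<or> z < real c" "c \<notin> Q"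
          show "\<not> c dvd a i * n + h i"
          proof
            assume dv: "c dvd a i * n + h i"
            have "a i * n + h i > 0" using pos[OF c(1)] n by simp
            hence "c \<le> a i * n + h i" using dvd_imp_le[OF dv] by simp
            also have "\<dots> \<le> a i * N + h i * N" using n by (intro add_mono mult_le_mono) auto
            also have "\<dots> = (a i + h i) * N" by (simp add: algebra_simps)
            also have "\<dots> \<le> S * N" using Si[OF c(1)] by (intro mult_le_mono) auto
            finally have cS: "c \<le> S * N" .
            hence "real c \<le> real S * real N" by (metis of_nat_le_iff of_nat_mult)
            hence "c \<in> F" using c cS by (auto simp: F_def P_def primes_in_def)
            thus False using False c(1) dv by blast
          qed
        qed
        moreover have "bad n \<ge> 0" unfolding bad_def by (intro sum_nonneg) auto
        ultimately show ?thesis by simp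
      qed
      have badsum: "(\<Sum>n\<in>{1..N}. bad n) \<le> \<eta> / 4 * N"
      proof -
        have "(\<Sum>n\<in>{1..N}. bad n) = (\<Sum>i\<in>{1..k}. \<Sum>n\<in>{1..N}. of_bool (\<exists>c\<in>F. c dvd a i * n + h i))"
          unfolding bad_def by (rule sum.swap)
        also have "\<dots> \<le> (\<Sum>i\<in>{1..k}. real S * real N * (2 * \<delta>'))"
        proof (intro sum_mono)
          fix i assume i: "i \<in> {1..k}"
          have "(\<Sum>n\<in>{1..N}. of_bool (\<exists>c\<in>F. c dvd a i * n + h i)) \<le> real (a i * N + h i) * recip_sum F"
            by (intro sum_dvd_linear_le finF pos i Fpos)
          also have "\<dots> \<le> real S * real N * (2 * \<delta>')"
          proof (intro mult_mono sumF)
            have "a i * N + h i \<le> a i * N + h i * N" using N(1) by simp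
            also have "\<dots> = (a i + h i) * N" by (simp add: algebra_simps)
            also have "\<dots> \<le> S * N" using Si[OF i] by (intro mult_le_mono) auto
            finally show "real (a i * N + h i) \<le> real S * real N" by (metis of_nat_le_iff of_nat_mult)
          qed (auto intro: sum_nonneg)
          finally show "(\<Sum>n\<in>{1..N}. of_bool (\<exists>c\<in>F. c dvd a i * n + h i)) \<le> real S * real N * (2 * \<delta>')" .
        qed
        also have "\<dots> = real k * (real S * real N * (2 * \<delta>'))" by simp
        also have "\<dots> = \<eta> / 4 * N" using k S1 by (simp add: \<delta>'_def)
        finally show ?thesis .
      qed
      have "\<bar>(\<Sum>n\<in>{1..N}. corr n) - (\<Sum>n\<in>{1..N}. f n * (\<Prod>p\<in>U. 1 - 2 * hit p n))\<bar> \<le> (\<Sum>n\<in>{1..N}. 2 * bad n)"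
        unfolding sum_subtractf[symmetric] by (intro order_trans[OF sum_abs] sum_mono ptw)
      also have "\<dots> = 2 * (\<Sum>n\<in>{1..N}. bad n)" by (rule sum_distrib_left[symmetric])
      also have "\<dots> \<le> 2 * (\<eta> / 4 * N)" using badsum by (intro mult_left_mono) auto
      finally have c1: "\<bar>(\<Sum>n\<in>{1..N}. corr n) - (\<Sum>n\<in>{1..N}. f n * (\<Prod>p\<in>U. 1 - 2 * hit p n))\<bar> \<le> 2 * (\<eta> / 4 * N)" .
      have c2: "real N * (\<bar>avg q f\<bar> * (1 + \<delta>) + \<delta>) \<le> real N * (\<eta> / 4)" using e1 by (intro mult_left_mono) auto
      have fin: "\<bar>s\<bar> \<le> 4 * v" if "\<bar>s - t\<bar> \<le> 2 * v" "\<bar>t\<bar> \<le> x + y" "x \<le> v" "y \<le> v" for s t v x y :: real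
        using that by linarith
      have "real N * (\<bar>avg q f\<bar> * (1 + \<delta>) + \<delta>) \<le> \<eta> / 4 * real N" using c2 by (simp only: mult.commute)
      from fin[OF c1 main this e2] have "\<bar>\<Sum>n\<in>{1..N}. corr n\<bar> \<le> 4 * (\<eta> / 4 * N)" .
      thus "\<bar>\<Sum>n\<in>{1..N}. corr n\<bar> \<le> \<eta> * real N" by simp
    qed
  qed
qed

lemma mean_corr: "(\<lambda>N. (\<Sum>n\<in>{1..N}. corr n) / real N) \<longlonglongrightarrow> 0"
proof (rule LIMSEQ_I)
  fix r :: real assume r: "r > 0"
  define \<eta> where "\<eta> = min 1 (r / 2)"
  have e: "0 < \<eta>" "\<eta> \<le> 1" "\<eta> < r" using r by (auto simp: \<eta>_def min_def)
  show "\<exists>no. \<forall>N\<ge>no. norm ((\<Sum>n\<in>{1..N}. corr n) / real N - 0) < r"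
  proof (rule corr_mean_bound[OF e(1,2)])
    fix N0 assume N0: "\<And>N. N \<ge> N0 \<Longrightarrow> \<bar>\<Sum>n\<in>{1..N}. corr n\<bar> \<le> \<eta> * real N"
    show ?thesis
    proof (intro exI[of _ "max 1 N0"] allI impI)
      fix N assume N: "N \<ge> max 1 N0"
      hence "\<bar>\<Sum>n\<in>{1..N}. corr n\<bar> / real N \<le> \<eta>" using N0[of N] by (simp add: field_simps)
      thus "norm ((\<Sum>n\<in>{1..N}. corr n) / real N - 0) < r" using e(3) by simp
    qed
  qed
qed

end

section \<open>Sets of pairwise coprime integers\<close>

lemma bounded_sums_imp_tail:
  assumes "\<And>F. finite F \<Longrightarrow> F \<subseteq> X \<Longrightarrow> recip_sum F \<le> M" and "\<eta> > 0"
  shows "\<exists>w. \<forall>F. finite F \<longrightarrow> F \<subseteq> {c\<in>X. c > w} \<longrightarrow> recip_sum F \<le> \<eta>"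
proof -
  define f where "f = (\<lambda>n. if n \<in> X then 1 / real n else 0)"
  have "summable f"
  proof (rule summableI_nonneg_bounded)
    fix n
    have "sum f {..<n} = recip_sum ({..<n} \<inter> X)" by (simp add: f_def sum.inter_restrict)
    also have "\<dots> \<le> M" by (intro assms(1)) auto
    finally show "sum f {..<n} \<le> M" .
  qed (simp add: f_def)
  then obtain w where w: "\<And>m n. m \<ge> w \<Longrightarrow> norm (sum f {m..<n}) < \<eta>"
    using assms(2) by (meson summable_Cauchy)
  show ?thesis
  proof (intro exI[of _ w] allI impI)
    fix F assume F: "finite F" "F \<subseteq> {c\<in>X. c > w}"
    have sub: "F \<subseteq> {w..<Suc (Max F)}" using F by (auto simp: less_Suc_eq_le)
    have "recip_sum F = sum f F" using F by (intro sum.cong) (auto simp: f_def)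
    also have "\<dots> \<le> sum f {w..<Suc (Max F)}" using sub by (intro sum_mono2) (auto simp: f_def)
    also have "\<dots> \<le> \<eta>" using w[of w "Suc (Max F)"] by simp
    finally show "recip_sum F \<le> \<eta>" .
  qed
qed

lemma composite_has_small_prime:
  assumes "a \<ge> 2" "\<not> prime (a::nat)" obtains p where "prime p" "p dvd a" "p * p \<le> a"
proof -
  obtain m where m: "m dvd a" "m \<noteq> 1" "m \<noteq> a" using assms by (auto simp: prime_nat_iff)
  then obtain n where n: "a = m * n" by (auto elim: dvdE)
  have mn: "m > 1" "n > 1" using m n assms(1) by (cases m; cases n; auto)+
  define l where "l = min m n"
  have l: "l > 1" "l dvd a" "l * l \<le> a" using mn n by (auto simp: l_def min_def intro: mult_le_mono)
  obtain p where p: "prime p" "p dvd l" using l(1) prime_factor_nat[of l] by auto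
  have "p \<le> l" using p l(1) by (intro dvd_imp_le) auto
  hence "p * p \<le> l * l" by (intro mult_le_mono)
  thus ?thesis using that[of p] p l by (meson dvd_trans le_trans)
qed

locale coprime_set =
  fixes A :: "nat set"
  assumes A2: "\<And>a. a \<in> A \<Longrightarrow> a \<ge> 2"
    and cop: "\<And>a b. a \<in> A \<Longrightarrow> b \<in> A \<Longrightarrow> a \<noteq> b \<Longrightarrow> coprime a b"
begin

text \<open>
  Each composite \<open>a\<close> has a prime factor \<open>q a\<close> with \<open>(q a)\<^sup>2 \<le> a\<close>, and these are distinct by coprimality, so the sum is at
  most the sum of \<open>1 / p\<^sup>2\<close> over distinct integers \<open>p \<ge> 2\<close>.
\<close>

lemma composite_sum_le:
  assumes F: "finite F" "F \<subseteq> {a\<in>A. \<not> prime a}" shows "recip_sum F \<le> 1"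
proof -
  have "\<forall>a\<in>F. \<exists>p. prime p \<and> p dvd a \<and> p * p \<le> a"
    using F A2 composite_has_small_prime by (metis (mono_tags, lifting) mem_Collect_eq subset_iff)
  then obtain q where q: "\<And>a. a \<in> F \<Longrightarrow> prime (q a) \<and> q a dvd a \<and> q a * q a \<le> a" by metis
  have inj: "inj_on q F"
  proof (rule inj_onI, rule ccontr)
    fix a b assume ab: "a \<in> F" "b \<in> F" "q a = q b" "a \<noteq> b"
    hence "coprime a b" using F cop by auto
    hence "is_unit (q a)" using q[OF ab(1)] q[OF ab(2)] ab(3) by (metis coprime_common_divisor)
    thus False using q[OF ab(1)] not_prime_unit by auto
  qed
  have "recip_sum F \<le> (\<Sum>a\<in>F. 1 / real (q a) ^ 2)"
  proof (intro sum_mono divide_left_mono)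
    fix a assume "a \<in> F"
    note q = q[OF this]
    have "real (q a * q a) \<le> real a" using q by (simp only: of_nat_le_iff)
    thus "real (q a) ^ 2 \<le> real a" by (simp add: power2_eq_square)
    have "q a > 0" using q prime_gt_0_nat by auto
    hence "a > 0" using q by (auto intro: Nat.gr0I)
    thus "0 < real a * real (q a) ^ 2" using \<open>q a > 0\<close> by simp
  qed auto
  also have "\<dots> = (\<Sum>p\<in>q ` F. 1 / real p ^ 2)" using inj by (simp add: sum.reindex)
  also have "\<dots> \<le> 1" using F q prime_ge_2_nat by (intro sum_inv_squares_le) auto
  finally show ?thesis .
qed

text \<open>
  The multiplicity of \<open>a\<close> in \<open>n\<close> is the number of powers \<open>a ^ j\<close> with \<open>j \<ge> 1\<close> dividing \<open>n\<close>. Passing to this set turns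
  \<open>Omega_on A\<close> into \<open>omega_on powers\<close>, so that both functions of the theorem are treated at once.
\<close>

definition powers :: "nat set" where "powers = {a ^ j |a j. a \<in> A \<and> j \<ge> 1}"

lemma prime_in_powers: "prime p \<Longrightarrow> p \<in> powers \<longleftrightarrow> p \<in> A"
proof
  assume p: "prime p" "p \<in> powers"
  then obtain a j where aj: "p = a ^ j" "a \<in> A" "j \<ge> 1" by (auto simp: powers_def)
  have "a dvd p" using aj by (simp add: dvd_power)
  hence "a = p" using p(1) A2[OF aj(2)] by (auto simp: prime_nat_iff)
  thus "p \<in> A" using aj by simp
next
  assume "p \<in> A"
  hence "p = p ^ 1 \<and> p \<in> A \<and> (1::nat) \<ge> 1" by simp
  thus "p \<in> powers" unfolding powers_def by blast
qed

lemma powers_ge_2: "c \<in> powers \<Longrightarrow> c \<ge> 2"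
proof -
  assume "c \<in> powers"
  then obtain a j where aj: "c = a ^ j" "a \<in> A" "j \<ge> 1" by (auto simp: powers_def)
  have "a ^ 1 \<le> a ^ j" using aj A2[OF aj(2)] by (intro power_increasing) auto
  thus "c \<ge> 2" using aj A2[OF aj(2)] by simp
qed

text \<open>
  A composite element of \<open>powers\<close> is a composite element of \<open>A\<close> or a power \<open>a ^ j\<close> with \<open>j \<ge> 2\<close>; the latter contribute at
  most \<open>2 / a\<^sup>2\<close> for each \<open>a\<close>.
\<close>

lemma powers_sum_le:
  assumes F: "finite F" "F \<subseteq> {a\<in>powers. \<not> prime a}" shows "recip_sum F \<le> 3"
proof -
  define m where "m = Max (insert 0 F)"
  define Y where "Y = (A \<inter> {..m}) \<times> {2..m}"
  have finA: "finite (A \<inter> {..m})" by simp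
  have sub: "F \<subseteq> (F \<inter> A) \<union> (\<lambda>(a, j). a ^ j) ` Y"
  proof
    fix c assume c: "c \<in> F"
    hence cm: "c \<le> m" using F by (simp add: m_def)
    obtain a j where aj: "c = a ^ j" "a \<in> A" "j \<ge> 1" using c F by (auto simp: powers_def)
    have a2: "a \<ge> 2" using A2 aj by auto
    show "c \<in> (F \<inter> A) \<union> (\<lambda>(a, j). a ^ j) ` Y"
    proof (cases "j = 1")
      case True
      thus ?thesis using aj c by auto
    next
      case False
      have "a ^ 1 \<le> a ^ j" using aj a2 by (intro power_increasing) auto
      moreover have "j < a ^ j" using a2 by (intro power_gt_expt) auto
      ultimately have "(a, j) \<in> Y" using aj cm False by (auto simp: Y_def)
      thus ?thesis using aj(1) by force
    qed
  qed
  have "recip_sum F \<le> (\<Sum>c\<in>(F \<inter> A) \<union> (\<lambda>(a, j). a ^ j) ` Y. 1 / real c)"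
    using F(1) by (intro sum_mono2 sub) (auto simp: Y_def)
  also have "\<dots> \<le> recip_sum (F \<inter> A) + (\<Sum>c\<in>(\<lambda>(a, j). a ^ j) ` Y. 1 / real c)"
    using F(1) by (subst sum_Un) (auto simp: Y_def intro!: sum_nonneg)
  also have "recip_sum (F \<inter> A) \<le> 1" using F by (intro composite_sum_le) auto
  also have "(\<Sum>c\<in>(\<lambda>(a, j). a ^ j) ` Y. 1 / real c) \<le> (\<Sum>(a, j)\<in>Y. (1 / real a) ^ j)"
  proof -
    have "(\<Sum>c\<in>(\<lambda>(a, j). a ^ j) ` Y. 1 / real c) \<le> sum ((\<lambda>c. 1 / real c) \<circ> (\<lambda>(a, j). a ^ j)) Y"
      by (rule sum_image_le) (auto simp: Y_def)
    also have "\<dots> = (\<Sum>(a, j)\<in>Y. (1 / real a) ^ j)" by (intro sum.cong) (auto simp: power_divide)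
    finally show ?thesis .
  qed
  also have "(\<Sum>(a, j)\<in>Y. (1 / real a) ^ j) = (\<Sum>a\<in>A \<inter> {..m}. \<Sum>j\<in>{2..m}. (1 / real a) ^ j)"
    unfolding Y_def by (simp add: sum.cartesian_product)
  also have "\<dots> \<le> (\<Sum>a\<in>A \<inter> {..m}. 2 * (1 / real a) ^ 2)"
  proof (intro sum_mono sum_power_from_2_le)
    fix a assume "a \<in> A \<inter> {..m}"
    hence "a \<ge> 2" using A2 by auto
    thus "1 / real a \<le> 1 / 2" by (simp add: field_simps)
  qed auto
  also have "\<dots> = 2 * (\<Sum>a\<in>A \<inter> {..m}. 1 / real a ^ 2)" by (simp add: sum_distrib_left power_divide)
  also have "\<dots> \<le> 2 * 1" using A2 by (intro mult_left_mono sum_inv_squares_le) auto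
  finally show ?thesis by simp
qed

lemma Omega_on_eq_omega_on_powers:
  assumes n: "n > 0" shows "Omega_on A n = omega_on powers n"
proof -
  define I where "I = (SIGMA a:{a\<in>A. a dvd n}. {1..multiplicity a n})"
  have fin: "finite {a\<in>A. a dvd n}" using n by (rule finite_dvd_in)
  have pd: "a ^ j dvd n \<longleftrightarrow> j \<le> multiplicity a n" if "a \<in> A" for a j
    using n A2[OF that] by (intro power_dvd_iff_le_multiplicity) auto
  have "{k\<in>powers. k dvd n} = (\<lambda>(a, j). a ^ j) ` I"
  proof (intro equalityI subsetI)
    fix c assume "c \<in> {k\<in>powers. k dvd n}"
    then obtain a j where aj: "c = a ^ j" "a \<in> A" "j \<ge> 1" "a ^ j dvd n" by (auto simp: powers_def)
    have "a dvd n" using aj by (metis One_nat_def Suc_le_eq dvd_power dvd_trans)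
    hence "(a, j) \<in> I" using aj pd by (auto simp: I_def)
    thus "c \<in> (\<lambda>(a, j). a ^ j) ` I" using aj(1) by force
  next
    fix c assume "c \<in> (\<lambda>(a, j). a ^ j) ` I"
    then obtain a j where aj: "c = a ^ j" "a \<in> A" "j \<ge> 1" "j \<le> multiplicity a n" by (auto simp: I_def)
    thus "c \<in> {k\<in>powers. k dvd n}" using pd unfolding powers_def by blast
  qed
  moreover have "inj_on (\<lambda>(a, j). a ^ j) I"
  proof (intro inj_onI, clarify)
    fix a j b l assume I: "(a, j) \<in> I" "(b, l) \<in> I" and eq: "a ^ j = b ^ l"
    hence ab: "a \<in> A" "b \<in> A" "j \<ge> 1" "l \<ge> 1" by (auto simp: I_def)
    have "a = b"
    proof (rule ccontr)
      assume "a \<noteq> b"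
      hence "coprime (a ^ j) (b ^ l)" using cop[OF ab(1,2)] by simp
      hence "is_unit (a ^ j)" unfolding eq[symmetric] by simp
      thus False using A2[OF ab(1)] ab(3) by (simp add: is_unit_power_iff)
    qed
    thus "a = b \<and> j = l" using eq A2[OF ab(1)] by (simp add: power_inject_exp)
  qed
  ultimately have "omega_on powers n = card I" by (simp add: omega_on_def card_image)
  also have "\<dots> = Omega_on A n" using fin by (simp add: I_def Omega_on_def)
  finally show ?thesis by simp
qed

text \<open>
  Finite sums of \<open>1 / a\<close> over \<open>A\<close> are unbounded. The composite elements contribute at most \<open>1\<close> and the elements up to
  \<open>w\<close> at most \<open>w + 1\<close>, so the primes above \<open>w\<close> account for the divergence.
\<close>

lemma primes_diverge:
  assumes inf: "(\<Sum>\<^sub>\<infinity>a\<in>A. ennreal (1 / real a)) = \<infinity>"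
  shows "\<exists>Q. finite Q \<and> (\<forall>p\<in>Q. p \<in> A \<and> prime p \<and> p > w) \<and> recip_sum Q \<ge> C"
proof -
  have "\<exists>F. finite F \<and> F \<subseteq> A \<and> recip_sum F > C + 1 + (real w + 1)"
  proof (rule ccontr)
    assume "\<not> ?thesis"
    hence le: "recip_sum F \<le> C + 1 + (real w + 1)" if "finite F" "F \<subseteq> A" for F using that by (meson not_le)
    have "(\<Sum>\<^sub>\<infinity>a\<in>A. ennreal (1 / real a)) \<le> ennreal (C + 1 + (real w + 1))"
    proof (rule infsum_le_finite_sums)
      show "(\<lambda>a. ennreal (1 / real a)) summable_on A" by (rule nonneg_summable_on_complete) auto
      fix F assume "finite F" "F \<subseteq> A"
      thus "(\<Sum>a\<in>F. ennreal (1 / real a)) \<le> ennreal (C + 1 + (real w + 1))"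
        using le[of F] by (subst sum_ennreal) (auto intro: ennreal_leI)
    qed
    thus False using inf by (simp add: top_unique)
  qed
  then obtain F where F: "finite F" "F \<subseteq> A" "recip_sum F > C + 1 + (real w + 1)" by blast
  define Q where "Q = {p\<in>F. prime p \<and> p > w}"
  define S where "S = {a\<in>F. prime a \<and> a \<le> w}"
  have fin: "finite Q" "finite {a\<in>F. \<not> prime a}" "finite S" using F(1) by (auto simp: Q_def S_def)
  have "F = (Q \<union> {a\<in>F. \<not> prime a}) \<union> S" by (auto simp: Q_def S_def)
  hence "recip_sum F = (\<Sum>a\<in>(Q \<union> {a\<in>F. \<not> prime a}) \<union> S. 1 / real a)" by (rule arg_cong)
  also have "\<dots> = (\<Sum>a\<in>Q \<union> {a\<in>F. \<not> prime a}. 1 / real a) + recip_sum S"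
    using fin by (intro sum.union_disjoint) (auto simp: Q_def S_def)
  also have "(\<Sum>a\<in>Q \<union> {a\<in>F. \<not> prime a}. 1 / real a) = recip_sum Q + (\<Sum>a\<in>{a\<in>F. \<not> prime a}. 1 / real a)"
    using fin by (intro sum.union_disjoint) (auto simp: Q_def)
  also have "(\<Sum>a\<in>{a\<in>F. \<not> prime a}. 1 / real a) \<le> 1" using F by (intro composite_sum_le) auto
  also have "recip_sum S \<le> (\<Sum>a\<in>{..w}. 1)"
  proof -
    have "recip_sum S \<le> (\<Sum>a\<in>S. 1)"
      using prime_gt_0_nat by (intro sum_mono) (auto simp: Suc_le_eq S_def)
    also have "\<dots> \<le> (\<Sum>a\<in>{..w}. 1)" by (intro sum_mono2) (auto simp: S_def)
    finally show ?thesis .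
  qed
  finally have "recip_sum Q \<ge> C" using F(3) by simp
  thus ?thesis using F by (intro exI[of _ Q]) (auto simp: Q_def)
qed

end

lemma pos_upto_eq: "pos_upto x = {1..nat \<lfloor>x\<rfloor>}" if "x \<ge> 0"
  using that by (auto simp: pos_upto_def le_nat_floor le_nat_iff le_floor_iff)

text \<open>
  Dividing by \<open>x\<close> instead of \<open>\<lfloor>x\<rfloor>\<close> only decreases the absolute value.
\<close>

lemma real_mean_from_nat:
  assumes "(\<lambda>N. (\<Sum>n\<in>{1..N}. f n) / real N) \<longlonglongrightarrow> 0"
  shows "((\<lambda>x::real. 1 / x * (\<Sum>n\<in>pos_upto x. f n)) \<longlongrightarrow> (0::real)) at_top"
proof -
  have fl: "filterlim (\<lambda>x::real. nat \<lfloor>x\<rfloor>) sequentially at_top"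
    by (rule filterlim_compose[OF filterlim_nat_sequentially filterlim_floor_sequentially])
  have lim: "((\<lambda>x::real. (\<Sum>n\<in>{1..nat \<lfloor>x\<rfloor>}. f n) / real (nat \<lfloor>x\<rfloor>)) \<longlongrightarrow> 0) at_top"
    using filterlim_compose[OF assms fl] by simp
  show ?thesis
  proof (rule Lim_null_comparison[OF _ tendsto_norm_zero[OF lim]])
    show "\<forall>\<^sub>F x::real in at_top. norm (1 / x * (\<Sum>n\<in>pos_upto x. f n)) \<le> norm ((\<Sum>n\<in>{1..nat \<lfloor>x\<rfloor>}. f n) / real (nat \<lfloor>x\<rfloor>))"
      using eventually_ge_at_top[of 1]
    proof eventually_elim
      case (elim x)
      hence "\<lfloor>x\<rfloor> \<ge> 1" by simp
      hence N: "real (nat \<lfloor>x\<rfloor>) \<ge> 1" "real (nat \<lfloor>x\<rfloor>) \<le> x" by linarith+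
      have "\<bar>\<Sum>n\<in>{1..nat \<lfloor>x\<rfloor>}. f n\<bar> / x \<le> \<bar>\<Sum>n\<in>{1..nat \<lfloor>x\<rfloor>}. f n\<bar> / real (nat \<lfloor>x\<rfloor>)"
        using N elim by (intro divide_left_mono) auto
      thus ?case using elim by (simp add: pos_upto_eq abs_mult)
    qed
  qed
qed

theorem theorem1p1:
  fixes A :: "nat set" and lam :: "nat \<Rightarrow> real"
  assumes "A \<subseteq> {0<..} - {1}"
    and "\<forall>a\<in>A. \<forall>b\<in>A. a \<noteq> b \<longrightarrow> gcd a b = 1"
    and "(\<Sum>\<^sub>\<infinity>a\<in>A. ennreal (1 / real a)) = \<infinity>"
    and "lam = (\<lambda>n. (-1) ^ omega_on A n) \<or> lam = (\<lambda>n. (-1) ^ Omega_on A n)"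
  shows "((\<lambda>x::real. 1 / x * (\<Sum>n\<in>pos_upto x. lam n)) \<longlongrightarrow> 0) at_top \<and>
    (\<forall>(k::nat) (a::nat \<Rightarrow> nat) (h::nat \<Rightarrow> nat).
       k \<ge> 2 \<longrightarrow>
       (\<forall>i\<in>{1..k}. a i > 0 \<and> h i > 0) \<longrightarrow>
       (\<forall>i\<in>{1..k}. \<forall>j\<in>{1..k}. i \<noteq> j \<longrightarrow>
          int (a i) * int (h j) - int (a j) * int (h i) \<noteq> 0) \<longrightarrow>
       has_relative_density (A \<inter> {p. prime p}) 0 \<longrightarrow>
       ((\<lambda>x::real. 1 / x * (\<Sum>n\<in>pos_upto x. \<Prod>i\<in>{1..k}. lam (a i * n + h i)))
          \<longlongrightarrow> 0) at_top)"
proof -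
  interpret coprime_set A
  proof
    show "a \<ge> 2" if "a \<in> A" for a
    proof -
      have "a > 0" "a \<noteq> 1" using that assms(1) by auto
      thus ?thesis by linarith
    qed
    show "coprime a b" if "a \<in> A" "b \<in> A" "a \<noteq> b" for a b using that assms(2) by (simp add: coprime_iff_gcd_eq_1)
  qed
  obtain K where K: "\<And>n. n > 0 \<Longrightarrow> lam n = sgn_omega K n" "{p\<in>K. prime p} = A \<inter> {p. prime p}" "\<And>c. c \<in> K \<Longrightarrow> c \<ge> 2"
    "\<And>F. finite F \<Longrightarrow> F \<subseteq> {c\<in>K. \<not> prime c} \<Longrightarrow> recip_sum F \<le> 3"
    using assms(4)
  proof
    assume l: "lam = (\<lambda>n. (-1) ^ omega_on A n)"
    show thesis
    proof (rule that[of A])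
      fix F assume "finite F" "F \<subseteq> {c\<in>A. \<not> prime c}"
      from composite_sum_le[OF this] show "recip_sum F \<le> 3" by simp
    next
      show "lam n = sgn_omega A n" for n by (simp add: l sgn_omega_def)
      show "{p\<in>A. prime p} = A \<inter> {p. prime p}" by blast
    qed (rule A2)
  next
    assume l: "lam = (\<lambda>n. (-1) ^ Omega_on A n)"
    show thesis
    proof (rule that[of powers])
      show "{p\<in>powers. prime p} = A \<inter> {p. prime p}" using prime_in_powers by auto
      show "lam n = sgn_omega powers n" if "n > 0" for n
        using that by (simp add: l sgn_omega_def Omega_on_eq_omega_on_powers)
    qed (rule powers_ge_2 powers_sum_le; assumption)+
  qed
  interpret divergent_prime_part K
  proof
    fix \<eta> :: real assume "\<eta> > 0"
    from bounded_sums_imp_tail[of "{c\<in>K. \<not> prime c}" 3, OF K(4) this]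
    show "\<exists>w. \<forall>F. finite F \<longrightarrow> F \<subseteq> {c\<in>K. \<not> prime c \<and> c > w} \<longrightarrow> recip_sum F \<le> \<eta>" by simp
  next
    fix C :: real and w :: nat
    have AK: "p \<in> K" if "p \<in> A" "prime p" for p using K(2) that by blast
    obtain Q where Q: "finite Q" "\<forall>p\<in>Q. p \<in> A \<and> prime p \<and> p > w" "recip_sum Q \<ge> C"
      using primes_diverge[OF assms(3), of w C] by auto
    show "\<exists>Q. finite Q \<and> (\<forall>p\<in>Q. p \<in> K \<and> prime p \<and> p > w) \<and> recip_sum Q \<ge> C"
      by (intro exI[of _ Q] conjI Q ballI AK) (use Q(2) in auto)
  qed (rule K(3))
  show ?thesis
  proof (intro conjI allI impI real_mean_from_nat)
    have "(\<Sum>n\<in>{1..N}. lam n) = (\<Sum>n\<in>{1..N}. sgn_omega K n)" for N using K(1) by (intro sum.cong) auto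
    thus "(\<lambda>N. (\<Sum>n\<in>{1..N}. lam n) / real N) \<longlonglongrightarrow> 0" using mean_sgn_omega by simp
  next
    fix k :: nat and a h :: "nat \<Rightarrow> nat"
    assume k: "k \<ge> 2" and pos: "\<forall>i\<in>{1..k}. a i > 0 \<and> h i > 0"
      and ind: "\<forall>i\<in>{1..k}. \<forall>j\<in>{1..k}. i \<noteq> j \<longrightarrow> int (a i) * int (h j) - int (a j) * int (h i) \<noteq> 0"
      and dens: "has_relative_density (A \<inter> {p. prime p}) 0"
    interpret correlation K k a h
    proof
      show "k \<ge> 1" using k by simp
      show "a i > 0" if "i \<in> {1..k}" for i using pos that by blast
      show "int (a i) * int (h j) - int (a j) * int (h i) \<noteq> 0" if "i \<in> {1..k}" "j \<in> {1..k}" "i \<noteq> j" for i j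
        using ind that by blast
      show "has_relative_density {p\<in>K. prime p} 0" using dens K(2) by simp
    qed
    have "(\<Sum>n\<in>{1..N}. \<Prod>i\<in>{1..k}. lam (a i * n + h i)) = (\<Sum>n\<in>{1..N}. corr n)" for N
      unfolding corr_def using pos by (intro sum.cong prod.cong refl K(1)) auto
    thus "(\<lambda>N. (\<Sum>n\<in>{1..N}. \<Prod>i\<in>{1..k}. lam (a i * n + h i)) / real N) \<longlonglongrightarrow> 0" using mean_corr by simp
  qed
qed

end
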